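(* Suppose $m$ is an even positive integer and $n\geq 3$. Let $G=G(m,1,n)$ act on $V=U\oplus U^*$, where $U$ is its natural $n$-dimensional representation with basis $x_1,\ldots,x_n$ and $y_1,\ldots,y_n$ is the dual basis of $U^*$. Put $v_i=x_i$, $v_{n+i}=y_i$ ($1\le i\le n$), and for $i,j\in\{1,\ldots,2n\}$ let $q_{ij}=1$ if $i\equiv j \bmod n$ and $q_{ij}=-1$ otherwise. The constant Hochschild 2-cocycles representing elements in $\mathrm{HH}^2(S_{\mathbf{q}}(V),S_{\mathbf{q}}(V)\rtimes G)$ form a vector space with basis all \begin{align*} &t_r^{(-1)}t_s^{(-1)}\otimes x_r^*\wedge x_s^* \qquad (r<s),\\ &t_r^{(-1)}t_s^{(-1)}\otimes y_r^*\wedge y_s^* \qquad (r<s),\\ &t_r^{(-1)}t_s^{(-1)}\otimes x_r^*\wedge y_s^* \qquad (r\neq s),\\ &t_r^{(\varepsilon)}\otimes x_r^*\wedge y_r^*,\\ &\sigma_{rs}^{(\xi)}\otimes x_r^*\wedge y_r^*+\sigma_{rs}^{(\xi)}\otimes x_s^*\wedge y_s^*+\xi\,\sigma_{rs}^{(\xi)}\otimes x_r^*\wedge y_s^*-\xi^{-1}\sigma_{rs}^{(\xi)}\otimes x_s^*\wedge y_r^* \qquad (r<s), \end{align*} where $r,s\in\{1,\ldots,n\}$ and $\varepsilon,\xi$ range over the $m$th roots of unity in $\mathbb{C}$.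
   Context: $G(m,1,n)$ is the group of $n\times n$ monomial matrices whose nonzero entries are $m$th roots of unity, acting naturally on $U$. The dual action on $U^*$ is determined by ${}^g y_i=\varepsilon^{-1}y_j$ if and only if ${}^g x_i=\varepsilon x_j$. Let $\mathcal{C}$ be the group of $m$th roots of unity in $\mathbb{C}$ (so $-1\in\mathcal{C}$). For $\varepsilon\in\mathcal{C}$ and $i\ne j$, $\sigma_{ij}^{(\varepsilon)}\in G(m,1,n)$ is given by $x_k\mapsto x_k$ for $k\notin\{i,j\}$, $x_i\mapsto\varepsilon x_j$, $x_j\mapsto-\varepsilon^{-1}x_i$; and $t_i^{(\varepsilon)}\in G(m,1,n)$ is given by $x_k\mapsto x_k$ for $k\ne i$, $x_i\mapsto\varepsilon x_i$. Note that $\sigma_{rs}^{(\xi)}=\sigma_{sr}^{(-\xi^{-1})}$. Let $N=\dim V=2n$ and let $A=S_{\mathbf{q}}(V)=\mathbb{C}\langle v_1,\ldots,v_N\mid v_iv_j=q_{ij}v_jv_i\ \forall i,j\rangle$, on which $G$ acts by algebra automorphisms. The skew group algebra $A\rtimes G$ is the free left $A$-module with basis $G$ and multiplication $(ag)(bh)=a({}^gb)gh$. Let $v_1^*,\ldots,v_N^*$ be the basis of $V^*$ dual to $v_1,\ldots,v_N$ (so $x_i^*=v_i^*$, $y_i^*=v_{n+i}^*$), and let $\bigwedge_{\mathbf{q}^{-1}}(V^* )$ be the algebra generated by the $v_i^*$ with relations $v_i^*\wedge v_j^*=-q_{ij}^{-1}v_j^*\wedge v_i^*$ for all $i,j$.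 $\mathrm{HH}^\bullet(A,A\rtimes G)=\mathrm{Ext}^\bullet_{A\otimes A^{op}}(A,A\rtimes G)$ is the cohomology of the (dualized) quantum Koszul complex with terms $(A\rtimes G)\otimes\bigwedge^m_{\mathbf{q}^{-1}}(V^* )$. For $\beta\in\{0,1\}^N$ write $(v^* )^{\wedge\beta}$ for the product, in increasing order of index, of the $v_i^*$ with $\beta_i=1$, and let $[i]$ be the $i$th standard unit vector. For $\beta$ with $\beta_1+\cdots+\beta_N=m-1$, the differential $d_m^*$ sends $ag\otimes(v^* )^{\wedge\beta}$ ($a\in A$, $g\in G$) to $$\sum_{i:\beta_i=0}(-1)^{\sum_{s=1}^i\beta_s}\Big[\Big(\Big(\prod_{s=1}^i q_{s,i}^{\beta_s}\Big)v_ia-\Big(\prod_{s=i}^N q_{i,s}^{\beta_s}\Big)a({}^gv_i)\Big)g\Big]\otimes(v^* )^{\wedge(\beta+[i])}.$$ The constant Hochschild 2-cocycles are the elements of $\mathbb{C}G\otimes\bigwedge^2_{\mathbf{q}^{-1}}(V^* )$ lying in the kernel of $d_3^*$. *)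

theory Defs
  imports
    "HOL-Algebra.QuotRing"
    "HOL-Library.Poly_Mapping"
    "Jordan_Normal_Form.VS_Connect"
begin

text \<open>
  Vector spaces are the \<open>vectorspace\<close> locale over \<open>class_ring :: complex ring\<close>, algebras over the
  complex numbers are records of type \<open>(complex, _) module\<close>, which carry a multiplication as well.
  Indices are shifted to start at 0: the generators of \<open>V\<close> are \<open>v_0, ..., v_(2n-1)\<close> with
  \<open>x_i = v_i\<close> and \<open>y_i = v_(n+i)\<close> for \<open>i < n\<close>.  Exponent vectors in \<open>{0,1}^N\<close> are given by their
  supports, the subsets of \<open>{..<N}\<close>.
\<close>

abbreviation CC :: "complex ring" where
  "CC \<equiv> class_ring"

section \<open>Free algebras, quotients, tensor products\<close>

text \<open>
  The wrapper makes concatenation of words the \<open>+\<close> of a \<open>monoid_add\<close>, so that the convolution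
  product of \<open>Poly_Mapping\<close> on \<open>fword \<Rightarrow>\<^sub>0 complex\<close> is the product of the free algebra.
\<close>

datatype fword = Word (letters: "nat list")

instantiation fword :: monoid_add
begin

definition "0 = Word []"

definition "u + v = Word (letters u @ letters v)"

instance
  by standard (simp_all add: zero_fword_def plus_fword_def)

end

abbreviation pscale :: "complex \<Rightarrow> ('a \<Rightarrow>\<^sub>0 complex) \<Rightarrow> ('a \<Rightarrow>\<^sub>0 complex)" where
  "pscale c \<equiv> Poly_Mapping.map ((*) c)"

definition free_algebra :: "nat \<Rightarrow> (complex, fword \<Rightarrow>\<^sub>0 complex) module" where
  "free_algebra N =
    \<lparr>carrier = {p. \<forall>w\<in>Poly_Mapping.keys p. set (letters w) \<subseteq> {..<N}},
     mult = (*), one = 1, zero = 0, add = (+), smult = pscale\<rparr>"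

definition gen :: "nat \<Rightarrow> (fword \<Rightarrow>\<^sub>0 complex)" where
  "gen i = Poly_Mapping.single (Word [i]) 1"

text \<open>
  The library's quotient ring, with the induced scalar multiplication.  If \<open>I\<close> is only a subspace
  of a vector space \<open>M\<close>, then the fields other than \<open>mult\<close> and \<open>one\<close> are the quotient space.
\<close>

definition quotient_algebra :: "(complex, 'a) module \<Rightarrow> 'a set \<Rightarrow> (complex, 'a set) module" where
  "quotient_algebra M I =
    \<lparr>carrier = carrier (M Quot I), mult = mult (M Quot I), one = one (M Quot I),
     zero = zero (M Quot I), add = add (M Quot I),
     smult = (\<lambda>c X. \<Union>x\<in>X. I +>\<^bsub>M\<^esub> (c \<odot>\<^bsub>M\<^esub> x))\<rparr>"

definition free_vs :: "'a set \<Rightarrow> (complex, 'a \<Rightarrow>\<^sub>0 complex) module" where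
  "free_vs S =
    \<lparr>carrier = {p. Poly_Mapping.keys p \<subseteq> S},
     mult = undefined, one = undefined, zero = 0, add = (+), smult = pscale\<rparr>"

abbreviation tpair :: "'a \<Rightarrow> 'b \<Rightarrow> ('a \<times> 'b \<Rightarrow>\<^sub>0 complex)" where
  "tpair u w \<equiv> Poly_Mapping.single (u, w) 1"

definition tensor_relations ::
  "(complex, 'a) module \<Rightarrow> (complex, 'b) module \<Rightarrow> ('a \<times> 'b \<Rightarrow>\<^sub>0 complex) set" where
  "tensor_relations M W =
     {tpair (u \<oplus>\<^bsub>M\<^esub> u') w - tpair u w - tpair u' w | u u' w.
        u \<in> carrier M \<and> u' \<in> carrier M \<and> w \<in> carrier W} \<union>
     {tpair u (w \<oplus>\<^bsub>W\<^esub> w') - tpair u w - tpair u w' | u w w'.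
        u \<in> carrier M \<and> w \<in> carrier W \<and> w' \<in> carrier W} \<union>
     {tpair (c \<odot>\<^bsub>M\<^esub> u) w - pscale c (tpair u w) | c u w. u \<in> carrier M \<and> w \<in> carrier W} \<union>
     {tpair u (c \<odot>\<^bsub>W\<^esub> w) - pscale c (tpair u w) | c u w. u \<in> carrier M \<and> w \<in> carrier W}"

definition tensor_kernel ::
  "(complex, 'a) module \<Rightarrow> (complex, 'b) module \<Rightarrow> ('a \<times> 'b \<Rightarrow>\<^sub>0 complex) set" where
  "tensor_kernel M W =
     LinearCombinations.module.span CC (free_vs (carrier M \<times> carrier W)) (tensor_relations M W)"

text \<open>The tensor product over the complex numbers, as a vector space.\<close>

definition tensor ::
  "(complex, 'a) module \<Rightarrow> (complex, 'b) module \<Rightarrow> (complex, ('a \<times> 'b \<Rightarrow>\<^sub>0 complex) set) module" where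
  "tensor M W = quotient_algebra (free_vs (carrier M \<times> carrier W)) (tensor_kernel M W)"

definition tens ::
  "(complex, 'a) module \<Rightarrow> (complex, 'b) module \<Rightarrow> 'a \<Rightarrow> 'b \<Rightarrow> ('a \<times> 'b \<Rightarrow>\<^sub>0 complex) set" where
  "tens M W u w = tensor_kernel M W +>\<^bsub>free_vs (carrier M \<times> carrier W)\<^esub> tpair u w"

section \<open>Quantum symmetric and quantum exterior algebras\<close>

type_synonym alg_elem = "(fword \<Rightarrow>\<^sub>0 complex) set"

definition qsym_ideal :: "nat \<Rightarrow> (nat \<Rightarrow> nat \<Rightarrow> complex) \<Rightarrow> alg_elem" where
  "qsym_ideal N q = Idl\<^bsub>free_algebra N\<^esub>
     {gen i * gen j - pscale (q i j) (gen j * gen i) | i j. i < N \<and> j < N}"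

definition qsym :: "nat \<Rightarrow> (nat \<Rightarrow> nat \<Rightarrow> complex) \<Rightarrow> (complex, alg_elem) module" where
  "qsym N q = quotient_algebra (free_algebra N) (qsym_ideal N q)"

definition vgen :: "nat \<Rightarrow> (nat \<Rightarrow> nat \<Rightarrow> complex) \<Rightarrow> nat \<Rightarrow> alg_elem" where
  "vgen N q i = qsym_ideal N q +>\<^bsub>free_algebra N\<^esub> gen i"

text \<open>\<open>qext N q\<close> is the quantum exterior algebra on the dual space with parameters inverse to \<open>q\<close>.\<close>

definition qext_ideal :: "nat \<Rightarrow> (nat \<Rightarrow> nat \<Rightarrow> complex) \<Rightarrow> alg_elem" where
  "qext_ideal N q = Idl\<^bsub>free_algebra N\<^esub>
     {gen i * gen j - pscale (- inverse (q i j)) (gen j * gen i) | i j. i < N \<and> j < N}"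

definition qext :: "nat \<Rightarrow> (nat \<Rightarrow> nat \<Rightarrow> complex) \<Rightarrow> (complex, alg_elem) module" where
  "qext N q = quotient_algebra (free_algebra N) (qext_ideal N q)"

definition vdual :: "nat \<Rightarrow> (nat \<Rightarrow> nat \<Rightarrow> complex) \<Rightarrow> nat \<Rightarrow> alg_elem" where
  "vdual N q i = qext_ideal N q +>\<^bsub>free_algebra N\<^esub> gen i"

definition wedge :: "nat \<Rightarrow> (nat \<Rightarrow> nat \<Rightarrow> complex) \<Rightarrow> nat list \<Rightarrow> alg_elem" where
  "wedge N q is = foldr (\<lambda>i u. vdual N q i \<otimes>\<^bsub>qext N q\<^esub> u) is \<one>\<^bsub>qext N q\<^esub>"

definition ext_power :: "nat \<Rightarrow> (nat \<Rightarrow> nat \<Rightarrow> complex) \<Rightarrow> nat \<Rightarrow> (complex, alg_elem) module" where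
  "ext_power N q k = (qext N q)
     \<lparr>carrier := LinearCombinations.module.span CC (qext N q)
        {wedge N q is | is. length is = k \<and> set is \<subseteq> {..<N}}\<rparr>"

section \<open>The group and its action\<close>

definition qpar :: "nat \<Rightarrow> nat \<Rightarrow> nat \<Rightarrow> complex" where
  "qpar n i j = (if i mod n = j mod n then 1 else - 1)"

definition Gm1n :: "nat \<Rightarrow> nat \<Rightarrow> complex mat monoid" where
  "Gm1n m n =
    \<lparr>carrier = {g \<in> carrier_mat n n.
        (\<forall>i<n. \<exists>!j. j < n \<and> g $$ (i, j) \<noteq> 0) \<and>
        (\<forall>j<n. \<exists>!i. i < n \<and> g $$ (i, j) \<noteq> 0) \<and>
        (\<forall>i<n. \<forall>j<n. g $$ (i, j) \<noteq> 0 \<longrightarrow> g $$ (i, j) ^ m = 1)},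
     mult = (*), one = 1\<^sub>m n\<rparr>"

text \<open>
  \<open>act_coeff n g k i\<close> is the coefficient of \<open>v_k\<close> in \<open>g v_i\<close>.  On the \<open>x_i\<close> a matrix acts through
  its columns.  A monomial \<open>g\<close> sends \<open>y_i\<close> to the inverse of its nonzero entry in column \<open>i\<close>, times
  the \<open>y_k\<close> of the same row; the zero entries are covered by \<open>inverse 0 = 0\<close>.
\<close>

definition act_coeff :: "nat \<Rightarrow> complex mat \<Rightarrow> nat \<Rightarrow> nat \<Rightarrow> complex" where
  "act_coeff n g k i =
    (if k < n \<and> i < n then g $$ (k, i)
     else if k \<in> {n..<2 * n} \<and> i \<in> {n..<2 * n} then inverse (g $$ (k - n, i - n))
     else 0)"

abbreviation Sq :: "nat \<Rightarrow> (complex, alg_elem) module" where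
  "Sq n \<equiv> qsym (2 * n) (qpar n)"

abbreviation Sq_gen :: "nat \<Rightarrow> nat \<Rightarrow> alg_elem" where
  "Sq_gen n i \<equiv> vgen (2 * n) (qpar n) i"

definition act_gen :: "nat \<Rightarrow> complex mat \<Rightarrow> nat \<Rightarrow> alg_elem" where
  "act_gen n g i = (\<Oplus>\<^bsub>Sq n\<^esub>k\<in>{..<2 * n}. act_coeff n g k i \<odot>\<^bsub>Sq n\<^esub> Sq_gen n k)"

text \<open>The algebra endomorphism extending the linear action, unique on the carrier.\<close>

definition act :: "nat \<Rightarrow> complex mat \<Rightarrow> alg_elem \<Rightarrow> alg_elem" where
  "act n g = (SOME \<phi>.
     \<phi> \<in> Ring.ring_hom (Sq n) (Sq n) \<inter> LinearCombinations.module_hom CC (Sq n) (Sq n) \<and>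
     (\<forall>i<2 * n. \<phi> (Sq_gen n i) = act_gen n g i))"

definition trefl :: "nat \<Rightarrow> nat \<Rightarrow> complex \<Rightarrow> complex mat" where
  "trefl n r \<epsilon> = mat n n (\<lambda>(k, i). if k = i then (if i = r then \<epsilon> else 1) else 0)"

definition sgm :: "nat \<Rightarrow> nat \<Rightarrow> nat \<Rightarrow> complex \<Rightarrow> complex mat" where
  "sgm n r s \<xi> = mat n n (\<lambda>(k, i).
     if i = r then (if k = s then \<xi> else 0)
     else if i = s then (if k = r then - inverse \<xi> else 0)
     else if k = i then 1 else 0)"

section \<open>The skew group algebra\<close>

type_synonym skew_elem = "complex mat \<Rightarrow> alg_elem"

text \<open>The function \<open>f\<close> stands for the sum of all \<open>f(g) g\<close>.\<close>

definition skew :: "nat \<Rightarrow> nat \<Rightarrow> (complex, skew_elem) module" where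
  "skew m n =
    \<lparr>carrier = carrier (Gm1n m n) \<rightarrow>\<^sub>E carrier (Sq n),
     mult = (\<lambda>f h. \<lambda>k\<in>carrier (Gm1n m n). \<Oplus>\<^bsub>Sq n\<^esub>g\<in>carrier (Gm1n m n).
        f g \<otimes>\<^bsub>Sq n\<^esub> act n g (h (inv\<^bsub>Gm1n m n\<^esub> g \<otimes>\<^bsub>Gm1n m n\<^esub> k))),
     one = (\<lambda>g\<in>carrier (Gm1n m n). if g = \<one>\<^bsub>Gm1n m n\<^esub> then \<one>\<^bsub>Sq n\<^esub> else \<zero>\<^bsub>Sq n\<^esub>),
     zero = (\<lambda>g\<in>carrier (Gm1n m n). \<zero>\<^bsub>Sq n\<^esub>),
     add = (\<lambda>f h. \<lambda>g\<in>carrier (Gm1n m n). f g \<oplus>\<^bsub>Sq n\<^esub> h g),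
     smult = (\<lambda>c f. \<lambda>g\<in>carrier (Gm1n m n). c \<odot>\<^bsub>Sq n\<^esub> f g)\<rparr>"

text \<open>The element \<open>a g\<close>.\<close>

definition skew_single :: "nat \<Rightarrow> nat \<Rightarrow> alg_elem \<Rightarrow> complex mat \<Rightarrow> skew_elem" where
  "skew_single m n a g = (\<lambda>h\<in>carrier (Gm1n m n). if h = g then a else \<zero>\<^bsub>Sq n\<^esub>)"

section \<open>The quantum Koszul complex\<close>

abbreviation Ext :: "nat \<Rightarrow> nat \<Rightarrow> (complex, alg_elem) module" where
  "Ext n k \<equiv> ext_power (2 * n) (qpar n) k"

type_synonym cochain = "(skew_elem \<times> alg_elem \<Rightarrow>\<^sub>0 complex) set"

definition cochains :: "nat \<Rightarrow> nat \<Rightarrow> nat \<Rightarrow> (complex, cochain) module" where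
  "cochains m n k = tensor (skew m n) (Ext n k)"

text \<open>\<open>cochain_elem m n k a g \<beta>\<close> is \<open>a g\<close> tensored with the ordered product of the \<open>v_i^*\<close>, \<open>i \<in> \<beta>\<close>.\<close>

definition cochain_elem ::
  "nat \<Rightarrow> nat \<Rightarrow> nat \<Rightarrow> alg_elem \<Rightarrow> complex mat \<Rightarrow> nat set \<Rightarrow> cochain" where
  "cochain_elem m n k a g \<beta> =
     tens (skew m n) (Ext n k) (skew_single m n a g)
       (wedge (2 * n) (qpar n) (sorted_list_of_set \<beta>))"

text \<open>
  \<open>differential m n k\<close> maps cochains of degree \<open>k - 1\<close> to cochains of degree \<open>k\<close>.  The prescribed
  values are on elements spanning the domain, so on the carrier there is at most one such map.
\<close>

definition differential :: "nat \<Rightarrow> nat \<Rightarrow> nat \<Rightarrow> cochain \<Rightarrow> cochain" where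
  "differential m n k = (SOME d.
     d \<in> LinearCombinations.module_hom CC (cochains m n (k - 1)) (cochains m n k) \<and>
     (\<forall>a\<in>carrier (Sq n). \<forall>g\<in>carrier (Gm1n m n). \<forall>\<beta>. \<beta> \<subseteq> {..<2 * n} \<and> card \<beta> = k - 1 \<longrightarrow>
        d (cochain_elem m n (k - 1) a g \<beta>) =
        (\<Oplus>\<^bsub>cochains m n k\<^esub>i\<in>{..<2 * n} - \<beta>.
           (- 1) ^ card {s \<in> \<beta>. s \<le> i} \<odot>\<^bsub>cochains m n k\<^esub>
           cochain_elem m n k
             ((\<Prod>s\<in>{s \<in> \<beta>. s \<le> i}. qpar n s i) \<odot>\<^bsub>Sq n\<^esub> (Sq_gen n i \<otimes>\<^bsub>Sq n\<^esub> a)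
               \<ominus>\<^bsub>Sq n\<^esub>
              (\<Prod>s\<in>{s \<in> \<beta>. i \<le> s}. qpar n i s) \<odot>\<^bsub>Sq n\<^esub> (a \<otimes>\<^bsub>Sq n\<^esub> act_gen n g i))
             g (insert i \<beta>))))"

text \<open>The subspace of constant cochains, group algebra tensor exterior power.\<close>

definition const_cochains :: "nat \<Rightarrow> nat \<Rightarrow> nat \<Rightarrow> cochain set" where
  "const_cochains m n k = LinearCombinations.module.span CC (cochains m n k)
     {tens (skew m n) (Ext n k) (skew_single m n \<one>\<^bsub>Sq n\<^esub> g) w | g w.
        g \<in> carrier (Gm1n m n) \<and> w \<in> carrier (Ext n k)}"

definition const_2_cocycles :: "nat \<Rightarrow> nat \<Rightarrow> (complex, cochain) module" where
  "const_2_cocycles m n = (cochains m n 2)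
     \<lparr>carrier := {c \<in> const_cochains m n 2. differential m n 3 c = \<zero>\<^bsub>cochains m n 3\<^esub>}\<rparr>"

text \<open>\<open>gtens m n g i j\<close> is \<open>g\<close> tensored with \<open>v_i^* \<and> v_j^*\<close>; recall \<open>x_r = v_r\<close>, \<open>y_r = v_(n+r)\<close>.\<close>

definition gtens :: "nat \<Rightarrow> nat \<Rightarrow> complex mat \<Rightarrow> nat \<Rightarrow> nat \<Rightarrow> cochain" where
  "gtens m n g i j =
     tens (skew m n) (Ext n 2) (skew_single m n \<one>\<^bsub>Sq n\<^esub> g) (wedge (2 * n) (qpar n) [i, j])"

definition sigma_cocycle :: "nat \<Rightarrow> nat \<Rightarrow> nat \<Rightarrow> nat \<Rightarrow> complex \<Rightarrow> cochain" where
  "sigma_cocycle m n r s \<xi> =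
     gtens m n (sgm n r s \<xi>) r (n + r) \<oplus>\<^bsub>cochains m n 2\<^esub>
     gtens m n (sgm n r s \<xi>) s (n + s) \<oplus>\<^bsub>cochains m n 2\<^esub>
     \<xi> \<odot>\<^bsub>cochains m n 2\<^esub> gtens m n (sgm n r s \<xi>) r (n + s) \<ominus>\<^bsub>cochains m n 2\<^esub>
     inverse \<xi> \<odot>\<^bsub>cochains m n 2\<^esub> gtens m n (sgm n r s \<xi>) s (n + r)"

end

theory Submission
  imports Defs
begin

text \<open>
  A constant 2-cochain is a finite combination of cochains \<open>g \<otimes> v_b* \<and> v_e*\<close>.  Its differential
  has coefficients in degree one of the quantum symmetric algebra, and the coefficient of
  \<open>v_k g \<otimes> v_a* \<and> v_b* \<and> v_e*\<close> involves only the three coordinates of the cochain at \<open>g\<close> and a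
  2-subset of \<open>{a, b, e}\<close>.  So being a cocycle is a system of linear equations in the coordinates,
  one independent system for every \<open>g\<close>.

  These systems can be solved by looking at supports.  A monomial matrix \<open>g\<close> permutes the lines
  spanned by the \<open>v_i\<close>, sending \<open>v_i\<close> to \<open>lam i\<close> times \<open>v_(dperm i)\<close>.  Suppose that the coordinate
  \<open>C {b, e}\<close> is nonzero and let \<open>a\<close> be a third index.  If \<open>g\<close> fixes the line of \<open>v_a\<close>, then the
  coefficient of \<open>v_a\<close> at \<open>{a, b, e}\<close> forces \<open>lam a = q_ba q_ea\<close> (\<open>support_fixed\<close>).  If \<open>g\<close> moves that
  line, then the coefficients of \<open>v_a\<close> and of its image can only cancel against terms coming from
  \<open>v_b\<close> and \<open>v_e\<close>, so \<open>g\<close> maps \<open>v_a\<close> into the lines of \<open>v_b, v_e\<close> and one of these into the line of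
  \<open>v_a\<close> (\<open>support_moved\<close>).

  For diagonal \<open>g\<close> the first fact determines the scalars outside \<open>{b, e}\<close>, and since \<open>x_i\<close> and \<open>y_i\<close>
  carry inverse scalars this leaves the products \<open>t_r t_s\<close> with scalars \<open>- 1\<close> and, when
  \<open>{b, e} = {r, n + r}\<close>, the reflections \<open>t_r\<close> with a free scalar.  If \<open>g\<close> is not diagonal, it moves
  at least two of the \<open>x_i\<close> and two of the \<open>y_i\<close>, while by the second fact at most two moved indices
  lie outside \<open>{b, e}\<close>.  Hence \<open>g\<close> exchanges two coordinates \<open>r, s\<close>, it is the identity elsewhere by
  the first fact, and the support lies in the four pairs formed by an \<open>x\<close> and a \<open>y\<close> with index
  \<open>r\<close> or \<open>s\<close>.  The remaining equations (\<open>swap_equations\<close>) make all four coordinates multiples of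
  the one at \<open>{r, n + r}\<close> and, unless that one is zero, force \<open>lam r * lam s = - 1\<close>, which says
  that \<open>g\<close> is one of the elements sigma.

  The passage from cochains to coordinates rests on linear functionals.  A weight function on words
  that respects the quadratic relations descends to the quotient of the free algebra
  (\<open>rel_algebra_functional\<close>); this yields the coefficients of degree at most one on the symmetric
  side and the coordinates of the ordered products on the exterior side.  The universal property of the
  tensor product (\<open>tensor_lift\<close>) turns products of such functionals into coordinates of cochains,
  and it also shows that a differential with the prescribed values exists (\<open>differential\<close>).  Constant
  cochains, and the cochains with linear coefficients in which their differentials lie, are spanned
  by families having dual functionals (\<open>dual_family\<close>), so a cochain of either kind vanishes when all
  its coordinates do.  This gives the equivalence \<open>differential_eq_zero_iff\<close> of the cocycle condition
  with the linear equations.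

  The listed cochains are indexed by labels.  Every label has a distinguished coordinate, where
  its cochain has value 1 and the other listed cochains vanish (\<open>label_dual\<close>); this gives linear
  independence.  A solution of the equations that is not zero at a given group element is nonzero
  at the distinguished coordinate of some label (\<open>support_label\<close>).  So subtracting from a
  cocycle the combination of listed cochains with the same distinguished coordinates leaves zero.
\<close>

section \<open>Linear maps, quotients and tensor products\<close>

abbreviation cmodule :: "(complex, 'a) module \<Rightarrow> bool" where
  "cmodule M \<equiv> Module.module CC M"

abbreviation lin :: "(complex, 'a) module \<Rightarrow> (complex, 'b) module \<Rightarrow> ('a \<Rightarrow> 'b) set" where
  "lin M W \<equiv> LinearCombinations.module_hom CC M W"

text \<open>
  The complex numbers as a module over themselves, so that functionals are linear maps like all others.
\<close>

definition Cmod :: "(complex, complex) module" where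
  "Cmod = \<lparr>carrier = UNIV, mult = (*), one = 1, zero = 0, add = (+), smult = (*)\<rparr>"

lemma Cmod_simps [simp]:
  "carrier Cmod = UNIV" "\<zero>\<^bsub>Cmod\<^esub> = 0" "x \<oplus>\<^bsub>Cmod\<^esub> y = x + y" "c \<odot>\<^bsub>Cmod\<^esub> x = c * x"
  by (simp_all add: Cmod_def)

lemma cring_CC: "cring CC"
  by (rule class_cring.is_cring)

lemma cmodule_Cmod: "cmodule Cmod"
  by (rule module_criteria[OF cring_CC]) (auto simp: algebra_simps intro: exI[of _ "- _"])

lemma finsum_Cmod [simp]: "finsum Cmod f A = sum f A"
proof -
  interpret Module.module CC Cmod by (rule cmodule_Cmod)
  show ?thesis by (induction A rule: infinite_finite_induct) auto
qed

text \<open>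
  The module axioms and their first consequences with the ring operations of the scalars replaced by
  those of the type \<open>complex\<close>.
\<close>

lemma cmoduleD:
  assumes "cmodule M"
  shows "abelian_group M" "vectorspace CC M" "\<zero>\<^bsub>M\<^esub> \<in> carrier M"
    "\<And>x y. x \<in> carrier M \<Longrightarrow> y \<in> carrier M \<Longrightarrow> x \<oplus>\<^bsub>M\<^esub> y \<in> carrier M"
    "\<And>x y. x \<in> carrier M \<Longrightarrow> y \<in> carrier M \<Longrightarrow> x \<ominus>\<^bsub>M\<^esub> y \<in> carrier M"
    "\<And>c x. x \<in> carrier M \<Longrightarrow> c \<odot>\<^bsub>M\<^esub> x \<in> carrier M"
    "\<And>a b x. x \<in> carrier M \<Longrightarrow> (a + b) \<odot>\<^bsub>M\<^esub> x = a \<odot>\<^bsub>M\<^esub> x \<oplus>\<^bsub>M\<^esub> b \<odot>\<^bsub>M\<^esub> x"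
    "\<And>a x y. x \<in> carrier M \<Longrightarrow> y \<in> carrier M \<Longrightarrow> a \<odot>\<^bsub>M\<^esub> (x \<oplus>\<^bsub>M\<^esub> y) = a \<odot>\<^bsub>M\<^esub> x \<oplus>\<^bsub>M\<^esub> a \<odot>\<^bsub>M\<^esub> y"
    "\<And>a b x. x \<in> carrier M \<Longrightarrow> (a * b) \<odot>\<^bsub>M\<^esub> x = a \<odot>\<^bsub>M\<^esub> (b \<odot>\<^bsub>M\<^esub> x)"
    "\<And>x. x \<in> carrier M \<Longrightarrow> 1 \<odot>\<^bsub>M\<^esub> x = x"
    "\<And>x. x \<in> carrier M \<Longrightarrow> 0 \<odot>\<^bsub>M\<^esub> x = \<zero>\<^bsub>M\<^esub>"
    "\<And>a. a \<odot>\<^bsub>M\<^esub> \<zero>\<^bsub>M\<^esub> = \<zero>\<^bsub>M\<^esub>"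
    "\<And>x y. x \<in> carrier M \<Longrightarrow> y \<in> carrier M \<Longrightarrow> x \<ominus>\<^bsub>M\<^esub> y = x \<oplus>\<^bsub>M\<^esub> (- 1) \<odot>\<^bsub>M\<^esub> y"
proof -
  interpret Module.module CC M by fact
  show "abelian_group M" ..
  show "vectorspace CC M" by (intro vectorspace.intro assms class_field)
  show "\<zero>\<^bsub>M\<^esub> \<in> carrier M" by simp
  show "\<And>x y. x \<in> carrier M \<Longrightarrow> y \<in> carrier M \<Longrightarrow> x \<oplus>\<^bsub>M\<^esub> y \<in> carrier M" by simp
  show "\<And>x y. x \<in> carrier M \<Longrightarrow> y \<in> carrier M \<Longrightarrow> x \<ominus>\<^bsub>M\<^esub> y \<in> carrier M" by simp
  show "\<And>c x. x \<in> carrier M \<Longrightarrow> c \<odot>\<^bsub>M\<^esub> x \<in> carrier M" by simp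
  show "\<And>a b x. x \<in> carrier M \<Longrightarrow> (a + b) \<odot>\<^bsub>M\<^esub> x = a \<odot>\<^bsub>M\<^esub> x \<oplus>\<^bsub>M\<^esub> b \<odot>\<^bsub>M\<^esub> x"
    using smult_l_distr by simp
  show "\<And>a x y. x \<in> carrier M \<Longrightarrow> y \<in> carrier M \<Longrightarrow>
      a \<odot>\<^bsub>M\<^esub> (x \<oplus>\<^bsub>M\<^esub> y) = a \<odot>\<^bsub>M\<^esub> x \<oplus>\<^bsub>M\<^esub> a \<odot>\<^bsub>M\<^esub> y"
    using smult_r_distr by simp
  show "\<And>a b x. x \<in> carrier M \<Longrightarrow> (a * b) \<odot>\<^bsub>M\<^esub> x = a \<odot>\<^bsub>M\<^esub> (b \<odot>\<^bsub>M\<^esub> x)"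
    using smult_assoc1 by simp
  show "\<And>x. x \<in> carrier M \<Longrightarrow> 1 \<odot>\<^bsub>M\<^esub> x = x" using smult_one by simp
  show "\<And>x. x \<in> carrier M \<Longrightarrow> 0 \<odot>\<^bsub>M\<^esub> x = \<zero>\<^bsub>M\<^esub>" using lmult_0 by simp
  show "\<And>a. a \<odot>\<^bsub>M\<^esub> \<zero>\<^bsub>M\<^esub> = \<zero>\<^bsub>M\<^esub>" using rmult_0 by simp
  show "\<And>x y. x \<in> carrier M \<Longrightarrow> y \<in> carrier M \<Longrightarrow> x \<ominus>\<^bsub>M\<^esub> y = x \<oplus>\<^bsub>M\<^esub> (- 1) \<odot>\<^bsub>M\<^esub> y"
    using smult_minus_1 by (simp add: a_minus_def class_ring_simps)
qed

lemma linI: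
  assumes "\<And>x. x \<in> carrier M \<Longrightarrow> f x \<in> carrier W"
    and "\<And>x y. x \<in> carrier M \<Longrightarrow> y \<in> carrier M \<Longrightarrow> f (x \<oplus>\<^bsub>M\<^esub> y) = f x \<oplus>\<^bsub>W\<^esub> f y"
    and "\<And>c x. x \<in> carrier M \<Longrightarrow> f (c \<odot>\<^bsub>M\<^esub> x) = c \<odot>\<^bsub>W\<^esub> f x"
  shows "f \<in> lin M W"
  using assms by (auto simp: LinearCombinations.module_hom_def)

lemma linD:
  assumes "f \<in> lin M W"
  shows "\<And>x. x \<in> carrier M \<Longrightarrow> f x \<in> carrier W"
    and "\<And>x y. x \<in> carrier M \<Longrightarrow> y \<in> carrier M \<Longrightarrow> f (x \<oplus>\<^bsub>M\<^esub> y) = f x \<oplus>\<^bsub>W\<^esub> f y"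
    and "\<And>c x. x \<in> carrier M \<Longrightarrow> f (c \<odot>\<^bsub>M\<^esub> x) = c \<odot>\<^bsub>W\<^esub> f x"
  using assms by (auto simp: LinearCombinations.module_hom_def)

lemma lin_zero: "cmodule M \<Longrightarrow> cmodule W \<Longrightarrow> f \<in> lin M W \<Longrightarrow> f \<zero>\<^bsub>M\<^esub> = \<zero>\<^bsub>W\<^esub>"
  using mod_hom.f0_is_0[of CC M W f] by (simp add: mod_hom_def mod_hom_axioms_def)

lemma lin_minus:
  "cmodule M \<Longrightarrow> cmodule W \<Longrightarrow> f \<in> lin M W \<Longrightarrow> x \<in> carrier M \<Longrightarrow> y \<in> carrier M \<Longrightarrow>
    f (x \<ominus>\<^bsub>M\<^esub> y) = f x \<ominus>\<^bsub>W\<^esub> f y"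
  using mod_hom.f_minus[of CC M W f] by (simp add: mod_hom_def mod_hom_axioms_def)

lemma lin_finsum:
  assumes M: "cmodule M" and W: "cmodule W" and f: "f \<in> lin M W"
    and "\<And>i. i \<in> A \<Longrightarrow> v i \<in> carrier M"
  shows "f (finsum M v A) = finsum W (\<lambda>i. f (v i)) A"
proof -
  interpret M: Module.module CC M by fact
  interpret W: Module.module CC W by fact
  show ?thesis using assms(4)
  proof (induction A rule: infinite_finite_induct)
    case (insert i A)
    then show ?case
      by (subst M.finsum_insert, (auto)[4], subst W.finsum_insert)
        (auto simp: linD[OF f])
  qed (auto simp: lin_zero[OF M W f])
qed

lemma lin_comp: "f \<in> lin M W \<Longrightarrow> h \<in> lin W Z \<Longrightarrow> (\<lambda>x. h (f x)) \<in> lin M Z"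
  by (intro linI) (auto simp: linD)

lemma lin_cong: "f \<in> lin M W \<Longrightarrow> (\<And>x. x \<in> carrier M \<Longrightarrow> f x = h x) \<Longrightarrow> cmodule M \<Longrightarrow> h \<in> lin M W"
  using cmoduleD(4,6)[of M] by (fastforce simp: LinearCombinations.module_hom_def Pi_iff)

lemma lin_const_zero: "cmodule W \<Longrightarrow> (\<lambda>x. \<zero>\<^bsub>W\<^esub>) \<in> lin M W"
  using abelian_group.axioms cmoduleD(3,12)
  by (intro linI) (auto simp: cmoduleD abelian_groupE)

lemma lin_add:
  assumes W: "cmodule W" and f: "f \<in> lin M W" and h: "h \<in> lin M W"
  shows "(\<lambda>x. f x \<oplus>\<^bsub>W\<^esub> h x) \<in> lin M W"
proof -
  interpret W: Module.module CC W by fact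
  show ?thesis
    by (intro linI) (auto simp: linD[OF f] linD[OF h] W.a_ac cmoduleD[OF W])
qed

lemma lin_scale:
  assumes W: "cmodule W" and f: "f \<in> lin M W"
  shows "(\<lambda>x. c \<odot>\<^bsub>W\<^esub> f x) \<in> lin M W"
  by (intro linI) (simp_all add: linD[OF f] cmoduleD(4,6,8)[OF W] mult.commute flip: cmoduleD(9)[OF W])

lemma lin_scale_vector:
  assumes W: "cmodule W" and f: "f \<in> lin M Cmod" and w: "w \<in> carrier W"
  shows "(\<lambda>x. f x \<odot>\<^bsub>W\<^esub> w) \<in> lin M W"
  by (intro linI) (simp_all add: linD[OF f] cmoduleD[OF W] w)

lemma lin_sum:
  assumes M: "cmodule M" and W: "cmodule W" and "\<And>i. i \<in> A \<Longrightarrow> f i \<in> lin M W"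
  shows "(\<lambda>x. finsum W (\<lambda>i. f i x) A) \<in> lin M W"
proof -
  interpret W: Module.module CC W by fact
  show ?thesis using assms(3)
  proof (induction A rule: infinite_finite_induct)
    case (insert i A)
    have "f i \<in> lin M W" using insert.prems[of i] by simp
    moreover have "(\<lambda>x. finsum W (\<lambda>i. f i x) A) \<in> lin M W" using insert by simp
    ultimately have L: "(\<lambda>x. f i x \<oplus>\<^bsub>W\<^esub> finsum W (\<lambda>i. f i x) A) \<in> lin M W"
      by (rule lin_add[OF W])
    have cl: "f j x \<in> carrier W" if "x \<in> carrier M" "j \<in> insert i A" for x j
      using linD(1)[OF insert.prems[OF that(2)] that(1)] .
    show ?case
    proof (rule lin_cong[OF L _ M])
      fix x assume "x \<in> carrier M"
      then show "f i x \<oplus>\<^bsub>W\<^esub> finsum W (\<lambda>i. f i x) A = finsum W (\<lambda>i. f i x) (insert i A)"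
        using insert.hyps cl by (intro W.finsum_insert[symmetric]) auto
    qed
  qed (auto simp: lin_const_zero[OF W])
qed

subsection \<open>Quotients\<close>

locale quotient_space =
  fixes M :: "(complex, 'a) module" and I :: "'a set"
  assumes M: "cmodule M" and I: "LinearCombinations.submodule CC I M"
begin

sublocale M: Module.module CC M by (rule M)

lemma I_facts: "I \<subseteq> carrier M" "\<zero>\<^bsub>M\<^esub> \<in> I" "x \<in> I \<Longrightarrow> y \<in> I \<Longrightarrow> x \<oplus>\<^bsub>M\<^esub> y \<in> I"
  "x \<in> I \<Longrightarrow> c \<odot>\<^bsub>M\<^esub> x \<in> I"
  using I by (auto simp: LinearCombinations.submodule_def)

sublocale I: abelian_subgroup I M
proof (rule abelian_subgroupI3)
  have "\<ominus>\<^bsub>M\<^esub> x \<in> I" if "x \<in> I" for x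
    using M.smult_minus_1[of x] I_facts(1) I_facts(4)[of x "- 1"] that
    by (auto simp: class_ring_simps)
  then have "subgroup I (add_monoid M)"
    using I_facts by unfold_locales (auto simp: a_inv_def)
  then show "additive_subgroup I M" by (rule additive_subgroup.intro)
  show "abelian_group M" ..
qed

abbreviation "Q \<equiv> quotient_algebra M I"

abbreviation coset :: "'a \<Rightarrow> 'a set" where
  "coset x \<equiv> I +>\<^bsub>M\<^esub> x"

lemma coset_eq_iff:
  assumes "x \<in> carrier M" "y \<in> carrier M"
  shows "coset x = coset y \<longleftrightarrow> x \<ominus>\<^bsub>M\<^esub> y \<in> I"
  using I.a_rcos_module[of y x] assms I.a_repr_independence'[of x y] I.a_rcos_self[of x]
  by (auto simp: a_minus_def)

lemma carrier_Q: "carrier Q = coset ` carrier M"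
  by (auto simp: quotient_algebra_def FactRing_def A_RCOSETS_def' )

lemma coset_zero: "\<zero>\<^bsub>Q\<^esub> = coset \<zero>\<^bsub>M\<^esub>"
  using M.a_coset_add_zero[OF I_facts(1)] by (simp add: quotient_algebra_def FactRing_def)

lemma coset_add:
  "x \<in> carrier M \<Longrightarrow> y \<in> carrier M \<Longrightarrow> coset x \<oplus>\<^bsub>Q\<^esub> coset y = coset (x \<oplus>\<^bsub>M\<^esub> y)"
  by (simp add: quotient_algebra_def FactRing_def I.a_rcos_sum)

lemma coset_smult:
  assumes x: "x \<in> carrier M"
  shows "c \<odot>\<^bsub>Q\<^esub> coset x = coset (c \<odot>\<^bsub>M\<^esub> x)"
proof -
  have "coset (c \<odot>\<^bsub>M\<^esub> y) = coset (c \<odot>\<^bsub>M\<^esub> x)" if y: "y \<in> coset x" for y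
  proof -
    have yM: "y \<in> carrier M" using y x I.a_elemrcos_carrier by blast
    have "y \<ominus>\<^bsub>M\<^esub> x \<in> I" using y x yM I.a_rcos_module[of x y] by (simp add: a_minus_def)
    then have "c \<odot>\<^bsub>M\<^esub> (y \<ominus>\<^bsub>M\<^esub> x) \<in> I" by (rule I_facts)
    also have "c \<odot>\<^bsub>M\<^esub> (y \<ominus>\<^bsub>M\<^esub> x) = c \<odot>\<^bsub>M\<^esub> y \<ominus>\<^bsub>M\<^esub> c \<odot>\<^bsub>M\<^esub> x"
    proof -
      have "c \<odot>\<^bsub>M\<^esub> ((- 1) \<odot>\<^bsub>M\<^esub> x) = (- 1) \<odot>\<^bsub>M\<^esub> (c \<odot>\<^bsub>M\<^esub> x)"
        using cmoduleD(9)[OF M x, of c "- 1"] cmoduleD(9)[OF M x, of "- 1" c] by simp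
      then show ?thesis
        using x yM cmoduleD(8)[OF M yM, of "(- 1) \<odot>\<^bsub>M\<^esub> x" c] by (simp only: cmoduleD(6,13)[OF M])
    qed
    finally show ?thesis using coset_eq_iff[of "c \<odot>\<^bsub>M\<^esub> y" "c \<odot>\<^bsub>M\<^esub> x"] x yM cmoduleD(6)[OF M] by blast
  qed
  moreover have "x \<in> coset x" using x by (rule I.a_rcos_self)
  ultimately have "(\<Union>y\<in>coset x. coset (c \<odot>\<^bsub>M\<^esub> y)) = coset (c \<odot>\<^bsub>M\<^esub> x)" by blast
  then show ?thesis by (simp add: quotient_algebra_def)
qed

lemma cmodule_Q: "cmodule Q"
proof (rule module_criteria[OF cring_CC])
  show "\<forall>v\<in>carrier Q. \<exists>w\<in>carrier Q. v \<oplus>\<^bsub>Q\<^esub> w = \<zero>\<^bsub>Q\<^esub>"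
  proof
    fix v assume "v \<in> carrier Q"
    then obtain x where x: "x \<in> carrier M" "v = coset x" by (auto simp: carrier_Q)
    then show "\<exists>w\<in>carrier Q. v \<oplus>\<^bsub>Q\<^esub> w = \<zero>\<^bsub>Q\<^esub>"
      by (intro bexI[of _ "coset (\<ominus>\<^bsub>M\<^esub> x)"]) (auto simp: carrier_Q coset_add coset_zero M.r_neg)
  qed
qed (auto simp: carrier_Q coset_add coset_smult coset_zero cmoduleD[OF M] M.a_ac)

lemma coset_lin: "coset \<in> lin M Q"
  by (intro linI) (auto simp: carrier_Q coset_add coset_smult)

text \<open>
  The induced map of the homomorphism theorem evaluates \<open>f\<close> at a chosen representative of a coset,
  and the hypothesis on \<open>I\<close> makes the choice irrelevant.
\<close>

lemma lin_descend:
  assumes W: "cmodule W" and f: "f \<in> lin M W" and "\<And>x. x \<in> I \<Longrightarrow> f x = \<zero>\<^bsub>W\<^esub>"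
  shows "\<exists>h. h \<in> lin Q W \<and> (\<forall>x\<in>carrier M. h (coset x) = f x)"
proof -
  interpret W: Module.module CC W by (rule W)
  define h where "h X = f (SOME x. x \<in> carrier M \<and> coset x = X)" for X
  have h: "h (coset x) = f x" if x: "x \<in> carrier M" for x
  proof -
    define y where "y = (SOME y. y \<in> carrier M \<and> coset y = coset x)"
    have y: "y \<in> carrier M \<and> coset y = coset x"
      unfolding y_def by (rule someI[of _ x]) (use x in auto)
    then have "f (y \<ominus>\<^bsub>M\<^esub> x) = \<zero>\<^bsub>W\<^esub>" using assms(3) x coset_eq_iff by blast
    then have "f y \<ominus>\<^bsub>W\<^esub> f x = \<zero>\<^bsub>W\<^esub>" using lin_minus[OF M W f, of y x] x y by simp
    then have "f y = f x" using x y linD(1)[OF f] W.minus_other_side by auto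
    then show ?thesis by (simp add: h_def y_def)
  qed
  then have "h \<in> lin Q W"
    by (intro linI) (auto simp: carrier_Q coset_add coset_smult linD[OF f] cmoduleD[OF M])
  with h show ?thesis by blast
qed

end

subsection \<open>Free vector spaces\<close>

lemma lookup_pscale [simp]: "Poly_Mapping.lookup (pscale c p) k = c * Poly_Mapping.lookup p k"
  by (simp add: Poly_Mapping.map.rep_eq when_def)

lemma keys_pscale: "Poly_Mapping.keys (pscale c p) \<subseteq> Poly_Mapping.keys p"
  by (auto simp: in_keys_iff)

lemma keys_pscale_subset: "Poly_Mapping.keys p \<subseteq> S \<Longrightarrow> Poly_Mapping.keys (pscale c p) \<subseteq> S"
  using keys_pscale[of c p] by auto

lemma keys_add_subset:
  "Poly_Mapping.keys p \<subseteq> S \<Longrightarrow> Poly_Mapping.keys q \<subseteq> S \<Longrightarrow> Poly_Mapping.keys (p + q) \<subseteq> S"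
  using Poly_Mapping.keys_add[of p q] by auto

lemma keys_diff_subset:
  fixes p q :: "'a \<Rightarrow>\<^sub>0 complex"
  assumes "Poly_Mapping.keys p \<subseteq> S" "Poly_Mapping.keys q \<subseteq> S"
  shows "Poly_Mapping.keys (p - q) \<subseteq> S"
  using assms Poly_Mapping.keys_diff[of p q] by auto

lemma pscale_algebra:
  fixes p q :: "'a \<Rightarrow>\<^sub>0 complex"
  shows "pscale (a * b) p = pscale a (pscale b p)" "pscale (a + b) p = pscale a p + pscale b p"
    "pscale a (p + q) = pscale a p + pscale a q" "pscale 1 p = p"
  by (rule poly_mapping_eqI; simp add: lookup_add algebra_simps)+

lemma free_vs_simps [simp]:
  "carrier (free_vs S) = {p. Poly_Mapping.keys p \<subseteq> S}" "\<zero>\<^bsub>free_vs S\<^esub> = 0"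
  "p \<oplus>\<^bsub>free_vs S\<^esub> p' = p + p'" "c \<odot>\<^bsub>free_vs S\<^esub> p = pscale c p"
  by (simp_all add: free_vs_def)

text \<open>
  Stated for every record with these components because free vector spaces and free algebras differ
  only in their multiplication.
\<close>

lemma cmodule_pmap_subset:
  assumes "carrier M = {p. Poly_Mapping.keys p \<subseteq> S}" "\<zero>\<^bsub>M\<^esub> = 0"
    "\<And>p p'. p \<oplus>\<^bsub>M\<^esub> p' = p + p'" "\<And>c p. c \<odot>\<^bsub>M\<^esub> p = pscale c p"
  shows "cmodule M"
proof (rule module_criteria[OF cring_CC], goal_cases)
  case 3
  show ?case
  proof
    fix p assume "p \<in> carrier M"
    then show "\<exists>q\<in>carrier M. p \<oplus>\<^bsub>M\<^esub> q = \<zero>\<^bsub>M\<^esub>"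
      by (intro bexI[of _ "- p"]) (auto simp: assms)
  qed
qed (auto simp: assms keys_add_subset keys_pscale_subset pscale_algebra add_ac)

lemma cmodule_free_vs: "cmodule (free_vs S)"
  by (rule cmodule_pmap_subset[of _ S]) auto

text \<open>
  The linear extension of a map given on the basis.
\<close>

definition free_ext :: "(complex, 'b) module \<Rightarrow> ('a \<Rightarrow> 'b) \<Rightarrow> ('a \<Rightarrow>\<^sub>0 complex) \<Rightarrow> 'b" where
  "free_ext Z B p = (\<Oplus>\<^bsub>Z\<^esub>x\<in>Poly_Mapping.keys p. Poly_Mapping.lookup p x \<odot>\<^bsub>Z\<^esub> B x)"

lemma free_ext_superset:
  assumes Z: "cmodule Z" and "\<And>x. x \<in> A \<Longrightarrow> B x \<in> carrier Z"
    and "finite A" "Poly_Mapping.keys p \<subseteq> A"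
  shows "free_ext Z B p = (\<Oplus>\<^bsub>Z\<^esub>x\<in>A. Poly_Mapping.lookup p x \<odot>\<^bsub>Z\<^esub> B x)"
proof -
  interpret Z: Module.module CC Z by (rule Z)
  show ?thesis
    unfolding free_ext_def using assms
    by (intro Z.add.finprod_mono_neutral_cong_left) (auto simp: in_keys_iff cmoduleD[OF Z])
qed

lemma free_ext_single:
  "cmodule Z \<Longrightarrow> B x \<in> carrier Z \<Longrightarrow> free_ext Z B (Poly_Mapping.single x c) = c \<odot>\<^bsub>Z\<^esub> B x"
  using cmoduleD(1)[of Z] abelian_monoid.finsum_insert[of Z "{}" x]
  by (subst free_ext_superset[where A = "{x}"])
    (auto simp: abelian_group_def cmoduleD abelian_monoid.finsum_empty abelian_monoid.r_zero)

lemma free_ext_lin: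
  assumes Z: "cmodule Z" and B: "\<And>x. x \<in> S \<Longrightarrow> B x \<in> carrier Z"
  shows "free_ext Z B \<in> lin (free_vs S) Z"
proof -
  interpret Z: Module.module CC Z by (rule Z)
  show ?thesis
  proof (rule linI)
    fix p assume p: "p \<in> carrier (free_vs S)"
    then show "free_ext Z B p \<in> carrier Z"
      unfolding free_ext_def using B by (auto intro!: Z.finsum_closed)
    fix c
    have "free_ext Z B (pscale c p) = (\<Oplus>\<^bsub>Z\<^esub>x\<in>Poly_Mapping.keys p. c \<odot>\<^bsub>Z\<^esub> (Poly_Mapping.lookup p x \<odot>\<^bsub>Z\<^esub> B x))"
      using p B keys_pscale[of c p]
      by (subst free_ext_superset[OF Z, where A = "Poly_Mapping.keys p"])
        (auto simp flip: cmoduleD(9)[OF Z] intro!: Z.finsum_cong')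
    also have "\<dots> = c \<odot>\<^bsub>Z\<^esub> free_ext Z B p"
      using p B unfolding free_ext_def by (subst Z.finsum_smult) auto
    finally show "free_ext Z B (c \<odot>\<^bsub>free_vs S\<^esub> p) = c \<odot>\<^bsub>Z\<^esub> free_ext Z B p" by simp
  next
    fix p q assume p: "p \<in> carrier (free_vs S)" and q: "q \<in> carrier (free_vs S)"
    define A where "A = Poly_Mapping.keys p \<union> Poly_Mapping.keys q"
    have A: "finite A" "A \<subseteq> S" "Poly_Mapping.keys p \<subseteq> A" "Poly_Mapping.keys q \<subseteq> A"
      "Poly_Mapping.keys (p + q) \<subseteq> A"
      using p q Poly_Mapping.keys_add[of p q] by (auto simp: A_def)
    have "free_ext Z B (p + q) =
        (\<Oplus>\<^bsub>Z\<^esub>x\<in>A. Poly_Mapping.lookup p x \<odot>\<^bsub>Z\<^esub> B x \<oplus>\<^bsub>Z\<^esub> Poly_Mapping.lookup q x \<odot>\<^bsub>Z\<^esub> B x)"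
      using A B by (subst free_ext_superset[OF Z, where A = A])
        (auto simp: lookup_add cmoduleD(7)[OF Z] intro!: Z.finsum_cong')
    also have "\<dots> = free_ext Z B p \<oplus>\<^bsub>Z\<^esub> free_ext Z B q"
      using A B by (subst Z.finsum_addf)
        (auto simp: free_ext_superset[OF Z, where A = A] subset_iff)
    finally show "free_ext Z B (p \<oplus>\<^bsub>free_vs S\<^esub> q) = free_ext Z B p \<oplus>\<^bsub>Z\<^esub> free_ext Z B q" by simp
  qed
qed

subsection \<open>Tensor products\<close>

definition bilin ::
  "(complex, 'a) module \<Rightarrow> (complex, 'b) module \<Rightarrow> (complex, 'c) module \<Rightarrow> ('a \<Rightarrow> 'b \<Rightarrow> 'c) \<Rightarrow> bool"
  where "bilin M W Z B \<longleftrightarrow>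
    (\<forall>u\<in>carrier M. B u \<in> lin W Z) \<and> (\<forall>w\<in>carrier W. (\<lambda>u. B u w) \<in> lin M Z)"

lemma tensor_quotient_space:
  assumes hM: "cmodule M" and W: "cmodule W"
  shows "quotient_space (free_vs (carrier M \<times> carrier W)) (tensor_kernel M W)"
    and "tensor_relations M W \<subseteq> tensor_kernel M W"
proof -
  let ?F = "free_vs (carrier M \<times> carrier W)"
  interpret F: Module.module CC ?F by (rule cmodule_free_vs)
  have R: "tensor_relations M W \<subseteq> carrier ?F"
    unfolding tensor_relations_def
    by (auto simp: cmoduleD(4,6)[OF hM] cmoduleD(4,6)[OF W] simp del: map_single
        dest!: subsetD[OF Poly_Mapping.keys_diff] subsetD[OF keys_pscale])
  show "quotient_space ?F (tensor_kernel M W)"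
    unfolding tensor_kernel_def
    by (rule quotient_space.intro[OF cmodule_free_vs F.span_is_submodule[OF R]])
  show "tensor_relations M W \<subseteq> tensor_kernel M W"
    unfolding tensor_kernel_def by (rule F.in_own_span[OF R])
qed

lemma cmodule_tensor: "cmodule M \<Longrightarrow> cmodule W \<Longrightarrow> cmodule (tensor M W)"
  unfolding tensor_def by (rule quotient_space.cmodule_Q[OF tensor_quotient_space(1)])

lemma tens_bilin:
  assumes hM: "cmodule M" and W: "cmodule W"
  shows "bilin M W (tensor M W) (tens M W)"
proof -
  let ?F = "free_vs (carrier M \<times> carrier W)"
  interpret quotient_space ?F "tensor_kernel M W" by (rule tensor_quotient_space(1)[OF hM W])
  have rel: "r \<in> tensor_kernel M W" if "r \<in> tensor_relations M W" for r
    using that tensor_quotient_space(2)[OF hM W] by auto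
  have minus: "p \<ominus>\<^bsub>?F\<^esub> q = p - q" if "p \<in> carrier ?F" "q \<in> carrier ?F" for p q
    using that by (simp add: cmoduleD(13)[OF cmodule_free_vs] poly_mapping_eq_iff lookup_add
        lookup_minus fun_eq_iff)
  have eqI: "coset p = coset q"
    if "p \<in> carrier ?F" "q \<in> carrier ?F" "p - q \<in> tensor_relations M W" for p q
    using that rel by (simp add: coset_eq_iff minus)
  have "\<And>u u' w. u \<in> carrier M \<Longrightarrow> u' \<in> carrier M \<Longrightarrow> w \<in> carrier W \<Longrightarrow>
      coset (tpair (u \<oplus>\<^bsub>M\<^esub> u') w) = coset (tpair u w + tpair u' w)"
    by (rule eqI) (auto simp: cmoduleD[OF hM] tensor_relations_def diff_diff_eq
      dest!: subsetD[OF Poly_Mapping.keys_add])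
  moreover have "\<And>u w w'. u \<in> carrier M \<Longrightarrow> w \<in> carrier W \<Longrightarrow> w' \<in> carrier W \<Longrightarrow>
      coset (tpair u (w \<oplus>\<^bsub>W\<^esub> w')) = coset (tpair u w + tpair u w')"
    by (rule eqI) (auto simp: cmoduleD[OF W] tensor_relations_def diff_diff_eq
      dest!: subsetD[OF Poly_Mapping.keys_add])
  moreover have "\<And>c u w. u \<in> carrier M \<Longrightarrow> w \<in> carrier W \<Longrightarrow>
      coset (tpair (c \<odot>\<^bsub>M\<^esub> u) w) = coset (pscale c (tpair u w))"
    by (rule eqI) (auto simp: cmoduleD[OF hM] tensor_relations_def simp del: map_single
        dest!: subsetD[OF keys_pscale])
  moreover have "\<And>c u w. u \<in> carrier M \<Longrightarrow> w \<in> carrier W \<Longrightarrow>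
      coset (tpair u (c \<odot>\<^bsub>W\<^esub> w)) = coset (pscale c (tpair u w))"
    by (rule eqI) (auto simp: cmoduleD[OF W] tensor_relations_def simp del: map_single
        dest!: subsetD[OF keys_pscale])
  ultimately show ?thesis
    unfolding bilin_def tensor_def tens_def
    by (auto intro!: linI simp: linD[OF coset_lin, simplified] simp del: map_single)
qed

text \<open>
  The linear extension of \<open>B\<close> to the free vector space on pairs kills the defining relations, which
  is what bilinearity says, and so it kills their span and descends.
\<close>

lemma tensor_lift_ex:
  assumes hM: "cmodule M" and W: "cmodule W" and Z: "cmodule Z" and B: "bilin M W Z B"
  shows "\<exists>L. L \<in> lin (tensor M W) Z \<and>
    (\<forall>u\<in>carrier M. \<forall>w\<in>carrier W. L (tens M W u w) = B u w)"
proof -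
  let ?F = "free_vs (carrier M \<times> carrier W)"
  interpret quotient_space ?F "tensor_kernel M W" by (rule tensor_quotient_space(1)[OF hM W])
  interpret Z: Module.module CC Z by (rule Z)
  define L where "L = free_ext Z (\<lambda>(u, w). B u w)"
  have B1: "B u \<in> lin W Z" if "u \<in> carrier M" for u using B that by (auto simp: bilin_def)
  have B2: "(\<lambda>u. B u w) \<in> lin M Z" if "w \<in> carrier W" for w using B that by (auto simp: bilin_def)
  have L: "L \<in> lin ?F Z"
    unfolding L_def by (rule free_ext_lin[OF Z]) (auto intro: linD(1)[OF B1])
  have Lp: "L (tpair u w) = B u w" if "u \<in> carrier M" "w \<in> carrier W" for u w
    using linD(1)[OF B1[OF that(1)] that(2)] unfolding L_def
    by (subst free_ext_single[OF Z]) (auto simp: cmoduleD[OF Z])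
  have Ldiff: "L (p - q) = L p \<ominus>\<^bsub>Z\<^esub> L q" if "p \<in> carrier ?F" "q \<in> carrier ?F" for p q
  proof -
    have "p - q = p \<ominus>\<^bsub>?F\<^esub> q"
      using that by (simp add: cmoduleD(13)[OF cmodule_free_vs] poly_mapping_eq_iff lookup_add
        lookup_minus fun_eq_iff)
    then show ?thesis using lin_minus[OF cmodule_free_vs Z L that] by simp
  qed
  have Lsc: "L (pscale c p) = c \<odot>\<^bsub>Z\<^esub> L p" if "p \<in> carrier ?F" for c p
    using linD(3)[OF L that] by simp
  have cancel: "(x \<oplus>\<^bsub>Z\<^esub> y) \<ominus>\<^bsub>Z\<^esub> x \<ominus>\<^bsub>Z\<^esub> y = \<zero>\<^bsub>Z\<^esub>" if "x \<in> carrier Z" "y \<in> carrier Z" for x y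
    using that Z.r_neg[of "x \<oplus>\<^bsub>Z\<^esub> y"] by (simp add: Z.minus_eq Z.minus_add Z.a_ac)
  have "tensor_relations M W \<subseteq> carrier ?F"
    using tensor_quotient_space(2)[OF hM W] I_facts(1) by blast
  moreover have "L r = \<zero>\<^bsub>Z\<^esub>" if "r \<in> tensor_relations M W" for r
    using that unfolding tensor_relations_def
    by (auto simp del: map_single simp: Ldiff Lsc Lp keys_diff_subset keys_pscale_subset
        linD[OF B1] linD[OF B2] cmoduleD[OF hM] cmoduleD[OF W] cancel cmoduleD(6)[OF Z])
  ultimately have "tensor_relations M W \<subseteq> {p \<in> carrier ?F. L p = \<zero>\<^bsub>Z\<^esub>}"
    by blast
  moreover have "LinearCombinations.submodule CC {p \<in> carrier ?F. L p = \<zero>\<^bsub>Z\<^esub>} ?F"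
    using mod_hom.ker_is_submodule[of CC ?F Z L] L M.module_axioms Z.module_axioms
    by (simp add: mod_hom_def mod_hom_axioms_def mod_hom.ker_def)
  ultimately have "tensor_kernel M W \<subseteq> {p \<in> carrier ?F. L p = \<zero>\<^bsub>Z\<^esub>}"
    unfolding tensor_kernel_def by (rule M.span_is_subset)
  then obtain h where "h \<in> lin (tensor M W) Z" "\<forall>p\<in>carrier ?F. h (coset p) = L p"
    using lin_descend[OF Z L] unfolding tensor_def by blast
  then show ?thesis by (intro exI[of _ h]) (auto simp: tens_def Lp)
qed

definition tensor_lift ::
  "(complex, 'a) module \<Rightarrow> (complex, 'b) module \<Rightarrow> (complex, 'c) module \<Rightarrow> ('a \<Rightarrow> 'b \<Rightarrow> 'c) \<Rightarrow>
    ('a \<times> 'b \<Rightarrow>\<^sub>0 complex) set \<Rightarrow> 'c" where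
  "tensor_lift M W Z B = (SOME L. L \<in> lin (tensor M W) Z \<and>
    (\<forall>u\<in>carrier M. \<forall>w\<in>carrier W. L (tens M W u w) = B u w))"

lemma tensor_lift:
  assumes "cmodule M" "cmodule W" "cmodule Z" "bilin M W Z B"
  shows "tensor_lift M W Z B \<in> lin (tensor M W) Z"
    and "u \<in> carrier M \<Longrightarrow> w \<in> carrier W \<Longrightarrow> tensor_lift M W Z B (tens M W u w) = B u w"
  using someI_ex[OF tensor_lift_ex[OF assms]] unfolding tensor_lift_def by blast+

section \<open>Quadratic algebras\<close>

text \<open>
  Both quantum algebras are quotients of the free algebra by relations of the form
  \<open>v_i v_j = c_ij v_j v_i\<close>, for the symmetric algebra with \<open>c = q\<close> and for the exterior algebra with
  \<open>c_ij = - 1 / q_ij\<close>.  They are treated together.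
\<close>

definition rel_ideal :: "nat \<Rightarrow> (nat \<Rightarrow> nat \<Rightarrow> complex) \<Rightarrow> (fword \<Rightarrow>\<^sub>0 complex) set" where
  "rel_ideal N c = Idl\<^bsub>free_algebra N\<^esub>
     {gen i * gen j - pscale (c i j) (gen j * gen i) | i j. i < N \<and> j < N}"

abbreviation rel_algebra :: "nat \<Rightarrow> (nat \<Rightarrow> nat \<Rightarrow> complex) \<Rightarrow> (complex, alg_elem) module" where
  "rel_algebra N c \<equiv> quotient_algebra (free_algebra N) (rel_ideal N c)"

abbreviation word :: "nat list \<Rightarrow> (fword \<Rightarrow>\<^sub>0 complex)" where
  "word w \<equiv> Poly_Mapping.single (Word w) 1"

abbreviation cls :: "nat \<Rightarrow> (nat \<Rightarrow> nat \<Rightarrow> complex) \<Rightarrow> (fword \<Rightarrow>\<^sub>0 complex) \<Rightarrow> alg_elem" where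
  "cls N c p \<equiv> rel_ideal N c +>\<^bsub>free_algebra N\<^esub> p"

abbreviation words :: "nat \<Rightarrow> fword set" where
  "words N \<equiv> {w. set (letters w) \<subseteq> {..<N}}"

lemma word_mult: "word u * word v = word (u @ v)"
  by (simp add: mult_single plus_fword_def)

lemma word_mult_single:
  "word u * Poly_Mapping.single w 1 = word (u @ letters w)"
  "Poly_Mapping.single w 1 * word u = word (letters w @ u)"
  by (simp_all add: mult_single plus_fword_def)

lemma one_word: "(1 :: fword \<Rightarrow>\<^sub>0 complex) = word []"
  by (simp flip: single_one add: zero_fword_def)

lemma word_Nil_mult: "word [] * p = p" "p * word [] = p"
  by (simp_all flip: one_word)

lemma free_algebra_simps [simp]:
  "carrier (free_algebra N) = {p. Poly_Mapping.keys p \<subseteq> words N}" "\<zero>\<^bsub>free_algebra N\<^esub> = 0"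
  "p \<oplus>\<^bsub>free_algebra N\<^esub> p' = p + p'" "c \<odot>\<^bsub>free_algebra N\<^esub> p = pscale c p"
  "p \<otimes>\<^bsub>free_algebra N\<^esub> p' = p * p'" "\<one>\<^bsub>free_algebra N\<^esub> = 1"
  by (auto simp add: free_algebra_def)

lemma cmodule_free_algebra: "cmodule (free_algebra N)"
  by (rule cmodule_pmap_subset[of _ "words N"]) auto

lemma keys_mult_words:
  assumes "Poly_Mapping.keys p \<subseteq> words N" "Poly_Mapping.keys q \<subseteq> words N"
  shows "Poly_Mapping.keys (p * q) \<subseteq> words N"
  using assms Poly_Mapping.keys_mult[of p q] by (fastforce simp: plus_fword_def)

lemma ring_free_algebra: "ring (free_algebra N)"
proof (rule ringI)
  show "abelian_group (free_algebra N)" by (rule cmoduleD(1)[OF cmodule_free_algebra])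
  show "Group.monoid (free_algebra N)"
  proof (rule monoidI)
    show "\<one>\<^bsub>free_algebra N\<^esub> \<in> carrier (free_algebra N)" by (simp add: one_word)
    show "x \<otimes>\<^bsub>free_algebra N\<^esub> y \<in> carrier (free_algebra N)"
      if "x \<in> carrier (free_algebra N)" "y \<in> carrier (free_algebra N)" for x y
      using that by (simp add: keys_mult_words)
  qed (auto simp: mult.assoc)
qed (auto simp: algebra_simps)

lemma ideal_rel_ideal: "ideal (rel_ideal N c) (free_algebra N)"
  and rel_ideal_relation:
    "i < N \<Longrightarrow> j < N \<Longrightarrow> gen i * gen j - pscale (c i j) (gen j * gen i) \<in> rel_ideal N c"
proof -
  interpret ring "free_algebra N" by (rule ring_free_algebra)
  have sub: "{gen i * gen j - pscale (c i j) (gen j * gen i) | i j. i < N \<and> j < N}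
      \<subseteq> carrier (free_algebra N)"
    by (auto simp: gen_def word_mult simp del: map_single
        dest!: subsetD[OF Poly_Mapping.keys_diff] subsetD[OF keys_pscale])
  show "ideal (rel_ideal N c) (free_algebra N)"
    unfolding rel_ideal_def by (rule genideal_ideal[OF sub])
  show "i < N \<Longrightarrow> j < N \<Longrightarrow> gen i * gen j - pscale (c i j) (gen j * gen i) \<in> rel_ideal N c"
    unfolding rel_ideal_def using genideal_self[OF sub] by blast
qed

lemma rel_quotient_space: "quotient_space (free_algebra N) (rel_ideal N c)"
proof (rule quotient_space.intro[OF cmodule_free_algebra])
  interpret ideal "rel_ideal N c" "free_algebra N" by (rule ideal_rel_ideal)
  have "pscale a p \<in> rel_ideal N c" if "p \<in> rel_ideal N c" for a p
    using I_l_closed[OF that, of "Poly_Mapping.single 0 a"]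
    by (simp add: mult_map_scale_conv_mult zero_fword_def split: if_splits)
  then show "LinearCombinations.submodule CC (rel_ideal N c) (free_algebra N)"
    using a_subset additive_subgroup.a_closed[OF additive_subgroup_axioms]
    by (intro LinearCombinations.submodule.intro[OF cmodule_free_algebra])
      (auto intro: additive_subgroup.zero_closed[OF additive_subgroup_axioms, simplified])
qed

lemma cls_mult:
  assumes "Poly_Mapping.keys p \<subseteq> words N" "Poly_Mapping.keys q \<subseteq> words N"
  shows "cls N c p \<otimes>\<^bsub>rel_algebra N c\<^esub> cls N c q = cls N c (p * q)"
  using ideal.rcoset_mult_add[OF ideal_rel_ideal, of p N q c] assms
  by (simp add: quotient_algebra_def FactRing_def)

lemma one_rel_algebra: "\<one>\<^bsub>rel_algebra N c\<^esub> = cls N c (word [])"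
  by (simp add: quotient_algebra_def FactRing_def one_word)

subsection \<open>Functionals given by weights of words\<close>

abbreviation weigh :: "(fword \<Rightarrow> complex) \<Rightarrow> (fword \<Rightarrow>\<^sub>0 complex) \<Rightarrow> complex" where
  "weigh \<equiv> free_ext Cmod"

lemma weigh_lin: "weigh f \<in> lin (free_vs UNIV) Cmod"
  by (rule free_ext_lin[OF cmodule_Cmod]) simp

lemma weigh_simps:
  "weigh f (p + q) = weigh f p + weigh f q" "weigh f (p - q) = weigh f p - weigh f q"
  "weigh f (pscale a p) = a * weigh f p" "weigh f (Poly_Mapping.single w a) = a * f w"
  "weigh f 0 = 0"
proof -
  show add: "weigh f (p + q) = weigh f p + weigh f q" for p q
    using linD(2)[OF weigh_lin, of p q f] by simp
  show "weigh f (p - q) = weigh f p - weigh f q"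
    using add[of "p - q" q] by simp
  show "weigh f (pscale a p) = a * weigh f p"
    using linD(3)[OF weigh_lin, of p f a] by simp
  show "weigh f (Poly_Mapping.single w a) = a * f w"
    by (simp add: free_ext_single[OF cmodule_Cmod])
  show "weigh f 0 = 0" by (simp add: free_ext_def)
qed

lemma weigh_sum: "weigh f (sum p A) = (\<Sum>x\<in>A. weigh f (p x))"
  by (induction A rule: infinite_finite_induct) (auto simp: weigh_simps)

lemma pmap_sum_words: "p = (\<Sum>w\<in>Poly_Mapping.keys p. pscale (Poly_Mapping.lookup p w) (word (letters w)))"
  by (rule poly_mapping_eqI)
    (simp add: lookup_sum lookup_single when_def in_keys_iff if_distrib sum.delta cong: if_cong)

lemma pscale_mult: "pscale a p * q = pscale a (p * q)" "p * pscale a q = pscale a (p * q)"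
  for p q :: "fword \<Rightarrow>\<^sub>0 complex"
proof -
  have comm: "Poly_Mapping.single 0 a * p = p * Poly_Mapping.single 0 a" for p :: "fword \<Rightarrow>\<^sub>0 complex"
    by (subst (1 2) pmap_sum_words[of p])
      (simp add: sum_distrib_left sum_distrib_right mult_single mult.commute)
  show "pscale a p * q = pscale a (p * q)" by (simp add: mult_map_scale_conv_mult mult.assoc)
  show "p * pscale a q = pscale a (p * q)"
    by (simp add: mult_map_scale_conv_mult comm[of p, symmetric] flip: mult.assoc)
qed

text \<open>
  Compatibility of \<open>f\<close> with exchanging two adjacent letters, at any place of a word, says that the
  functional \<open>weigh f\<close> vanishes on all products of a word, a defining relation and a word.
\<close>

lemma rel_algebra_functional:
  assumes f: "\<And>u i j v. i < N \<Longrightarrow> j < N \<Longrightarrow> f (Word (u @ i # j # v)) = c i j * f (Word (u @ j # i # v))"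
  shows "\<exists>h. h \<in> lin (rel_algebra N c) Cmod \<and> (\<forall>p. Poly_Mapping.keys p \<subseteq> words N \<longrightarrow> h (cls N c p) = weigh f p)"
proof -
  interpret quotient_space "free_algebra N" "rel_ideal N c" by (rule rel_quotient_space)
  interpret R: ring "free_algebra N" by (rule ring_free_algebra)
  have lin: "weigh f \<in> lin (free_algebra N) Cmod"
    by (intro linI) (auto simp: weigh_simps)
  \<comment> \<open>The elements that stay in the kernel when words are multiplied on both sides form an ideal.\<close>
  define J where "J = {p. Poly_Mapping.keys p \<subseteq> words N \<and> (\<forall>u v. weigh f (word u * p * word v) = 0)}"
  have Jl: "x * p \<in> J" if "p \<in> J" "Poly_Mapping.keys x \<subseteq> words N" for p x
  proof -
    have "weigh f (word u * (x * p) * word v) = 0" for u v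
    proof -
      have "weigh f (word u * (x * p) * word v)
          = weigh f (\<Sum>w\<in>Poly_Mapping.keys x. pscale (Poly_Mapping.lookup x w) (word (u @ letters w) * p * word v))"
        by (subst pmap_sum_words[of x])
          (simp add: sum_distrib_left sum_distrib_right pscale_mult word_mult_single del: map_single flip: mult.assoc)
      also have "\<dots> = 0" using that by (simp add: weigh_sum weigh_simps J_def)
      finally show ?thesis .
    qed
    then show ?thesis using that keys_mult_words[of x N p] by (simp add: J_def)
  qed
  have Jr: "p * x \<in> J" if "p \<in> J" "Poly_Mapping.keys x \<subseteq> words N" for p x
  proof -
    have "weigh f (word u * (p * x) * word v) = 0" for u v
    proof -
      have "weigh f (word u * (p * x) * word v)
          = weigh f (\<Sum>w\<in>Poly_Mapping.keys x. pscale (Poly_Mapping.lookup x w) (word u * p * word (letters w @ v)))"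
        by (subst pmap_sum_words[of x])
          (simp add: sum_distrib_left sum_distrib_right pscale_mult word_mult_single mult.assoc del: map_single)
      also have "\<dots> = 0" using that by (simp add: weigh_sum weigh_simps J_def)
      finally show ?thesis .
    qed
    then show ?thesis using that keys_mult_words[of p N x] by (simp add: J_def)
  qed
  have "ideal J (free_algebra N)"
  proof (rule idealI[OF ring_free_algebra])
    have inv: "\<ominus>\<^bsub>free_algebra N\<^esub> p = - p" if "Poly_Mapping.keys p \<subseteq> words N" for p
      using M.smult_minus_1[of p] that by (simp add: class_ring_simps poly_mapping_eq_iff fun_eq_iff)
    show "subgroup J (add_monoid (free_algebra N))"
    proof
      fix p assume "p \<in> J"
      then show "inv\<^bsub>add_monoid (free_algebra N)\<^esub> p \<in> J"
        using inv[of p] weigh_simps(2)[of f 0]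
        by (simp add: J_def a_inv_def weigh_simps)
    qed (auto simp: J_def weigh_simps distrib_left distrib_right dest!: subsetD[OF Poly_Mapping.keys_add])
  qed (use Jl Jr in auto)
  moreover have "{gen i * gen j - pscale (c i j) (gen j * gen i) | i j. i < N \<and> j < N} \<subseteq> J"
  proof safe
    fix i j assume ij: "i < N" "j < N"
    have "weigh f (word u * (gen i * gen j - pscale (c i j) (gen j * gen i)) * word v) = 0" for u v
      using f[OF ij, of u v]
      by (simp add: gen_def word_mult left_diff_distrib right_diff_distrib pscale_mult weigh_simps del: map_single)
    moreover have "Poly_Mapping.keys (gen i * gen j - pscale (c i j) (gen j * gen i)) \<subseteq> words N"
      using ij by (auto simp: gen_def word_mult simp del: map_single
        dest!: subsetD[OF Poly_Mapping.keys_diff] subsetD[OF keys_pscale])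
    ultimately show "gen i * gen j - pscale (c i j) (gen j * gen i) \<in> J"
      by (simp add: J_def)
  qed
  ultimately have "rel_ideal N c \<subseteq> J" unfolding rel_ideal_def by (rule R.genideal_minimal)
  moreover have "weigh f p = 0" if "p \<in> J" for p
  proof -
    have "weigh f (word [] * p * word []) = 0" using that unfolding J_def by blast
    then show ?thesis by (simp flip: one_word)
  qed
  ultimately have "weigh f p = \<zero>\<^bsub>Cmod\<^esub>" if "p \<in> rel_ideal N c" for p using that by auto
  from lin_descend[OF cmodule_Cmod lin this] show ?thesis by simp
qed

lemma rel_algebra_mult_lin:
  assumes b: "b \<in> carrier (rel_algebra N c)"
  shows "(\<lambda>a. a \<otimes>\<^bsub>rel_algebra N c\<^esub> b) \<in> lin (rel_algebra N c) (rel_algebra N c)"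
    and "(\<lambda>a. b \<otimes>\<^bsub>rel_algebra N c\<^esub> a) \<in> lin (rel_algebra N c) (rel_algebra N c)"
proof -
  interpret quotient_space "free_algebra N" "rel_ideal N c" by (rule rel_quotient_space)
  have add: "coset p \<oplus>\<^bsub>Q\<^esub> coset q = coset (p + q)"
    if "Poly_Mapping.keys p \<subseteq> words N" "Poly_Mapping.keys q \<subseteq> words N" for p q
    using coset_add[of p q] that by simp
  have sm: "a \<odot>\<^bsub>Q\<^esub> coset p = coset (pscale a p)" if "Poly_Mapping.keys p \<subseteq> words N" for a p
    using coset_smult[of p a] that by simp
  from b obtain q where q: "Poly_Mapping.keys q \<subseteq> words N" "b = coset q"
    by (auto simp: carrier_Q)
  show "(\<lambda>a. a \<otimes>\<^bsub>Q\<^esub> b) \<in> lin Q Q" "(\<lambda>a. b \<otimes>\<^bsub>Q\<^esub> a) \<in> lin Q Q"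
    by (rule linI; use q in \<open>auto simp: carrier_Q cls_mult add sm keys_mult_words keys_add_subset
      keys_pscale_subset distrib_left distrib_right pscale_mult\<close>)+
qed

lemma rel_algebra_one_mult:
  assumes "b \<in> carrier (rel_algebra N c)"
  shows "b \<otimes>\<^bsub>rel_algebra N c\<^esub> \<one>\<^bsub>rel_algebra N c\<^esub> = b" "\<one>\<^bsub>rel_algebra N c\<^esub> \<otimes>\<^bsub>rel_algebra N c\<^esub> b = b"
proof -
  interpret quotient_space "free_algebra N" "rel_ideal N c" by (rule rel_quotient_space)
  show "b \<otimes>\<^bsub>Q\<^esub> \<one>\<^bsub>Q\<^esub> = b" "\<one>\<^bsub>Q\<^esub> \<otimes>\<^bsub>Q\<^esub> b = b"
    using assms by (auto simp: carrier_Q one_rel_algebra cls_mult word_Nil_mult)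
qed

lemma cls_carrier: "Poly_Mapping.keys p \<subseteq> words N \<Longrightarrow> cls N c p \<in> carrier (rel_algebra N c)"
  using quotient_space.carrier_Q[OF rel_quotient_space, of N c] by auto

lemma cmodule_rel_algebra: "cmodule (rel_algebra N c)"
  by (rule quotient_space.cmodule_Q[OF rel_quotient_space])

lemma cls_swap:
  assumes "i < N" "j < N"
  shows "cls N c (word [i, j]) = c i j \<odot>\<^bsub>rel_algebra N c\<^esub> cls N c (word [j, i])"
proof -
  interpret quotient_space "free_algebra N" "rel_ideal N c" by (rule rel_quotient_space)
  have minus: "p \<ominus>\<^bsub>free_algebra N\<^esub> q = p - q"
    if "p \<in> carrier (free_algebra N)" "q \<in> carrier (free_algebra N)" for p q
    using that by (simp add: cmoduleD(13)[OF cmodule_free_algebra] poly_mapping_eq_iff lookup_add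
        lookup_minus fun_eq_iff)
  have "coset (word [i, j]) = coset (pscale (c i j) (word [j, i]))"
    using assms rel_ideal_relation[OF assms, of c] keys_pscale_subset[of "word [j, i]" "words N" "c i j"]
    by (subst coset_eq_iff) (auto simp: minus gen_def word_mult simp del: map_single)
  also have "\<dots> = c i j \<odot>\<^bsub>Q\<^esub> coset (word [j, i])"
    using assms by (subst coset_smult) auto
  finally show ?thesis .
qed

section \<open>Quantum symmetric and exterior algebras\<close>

lemma qsym_rel: "qsym N q = rel_algebra N q" "vgen N q i = cls N q (word [i])"
  by (simp_all add: qsym_def qsym_ideal_def vgen_def rel_ideal_def gen_def)

abbreviation cext :: "(nat \<Rightarrow> nat \<Rightarrow> complex) \<Rightarrow> nat \<Rightarrow> nat \<Rightarrow> complex" where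
  "cext q \<equiv> \<lambda>i j. - inverse (q i j)"

lemma qext_rel: "qext N q = rel_algebra N (cext q)" "vdual N q i = cls N (cext q) (word [i])"
  by (simp_all add: qext_def qext_ideal_def vdual_def rel_ideal_def gen_def)

text \<open>
  The relations are homogeneous of degree two, so the coefficient of a word of length at most one is
  well defined on the quotient.
\<close>

lemma qsym_functional:
  assumes "length w \<le> 1"
  shows "\<exists>h. h \<in> lin (qsym N q) Cmod \<and> h \<one>\<^bsub>qsym N q\<^esub> = (if w = [] then 1 else 0) \<and>
    (\<forall>i<N. h (vgen N q i) = (if w = [i] then 1 else 0))"
proof -
  define f where "f = (\<lambda>v. if v = Word w then 1 else 0 :: complex)"
  have "f (Word (u @ i # j # v)) = 0" for u i j v
    using assms by (auto simp: f_def)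
  then have rel: "f (Word (u @ i # j # v)) = q i j * f (Word (u @ j # i # v))" if "i < N" "j < N" for u i j v
    by simp
  then obtain h where h: "h \<in> lin (rel_algebra N q) Cmod"
      "\<And>p. Poly_Mapping.keys p \<subseteq> words N \<Longrightarrow> h (cls N q p) = weigh f p"
    using rel_algebra_functional[of N f q, OF rel] by blast
  show ?thesis
    by (rule exI[of _ h]) (use h in \<open>auto simp: qsym_rel one_rel_algebra weigh_simps f_def\<close>)
qed

text \<open>
  The scalar relating the product of the letters of a word to the product of the same letters in
  increasing order: every letter contributes the factors for moving it past the smaller letters that
  follow it.
\<close>

fun word_coeff :: "(nat \<Rightarrow> nat \<Rightarrow> complex) \<Rightarrow> nat list \<Rightarrow> complex" where
  "word_coeff c [] = 1"
| "word_coeff c (i # w) = (\<Prod>s\<leftarrow>w. if s < i then c i s else 1) * word_coeff c w"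

text \<open>
  The factors belonging to pairs other than the two exchanged letters are the same on both sides.
  The relation of an exchange and that of the reverse exchange must agree, hence the hypothesis on \<open>c\<close>.
\<close>

lemma word_coeff_swap:
  assumes "\<And>i j. c i j * c j i = 1" and "i \<noteq> j"
  shows "word_coeff c (u @ i # j # v) = c i j * word_coeff c (u @ j # i # v)"
proof (induction u)
  case Nil
  then show ?case using assms(1)[of i j] assms(2) by (cases "j < i") (auto simp: mult_ac)
qed (simp add: mult_ac)

lemma word_coeff_sorted: "sorted w \<Longrightarrow> word_coeff c w = 1"
proof (induction w)
  case (Cons i w)
  have "(\<Prod>s\<leftarrow>w. if s < i then c i s else 1) = 1" if "\<forall>s\<in>set w. i \<le> s" for w
    using that by (induction w) auto
  with Cons show ?case by simp
qed simp

lemma wedge_word: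
  "set is \<subseteq> {..<N} \<Longrightarrow> wedge N q is = cls N (cext q) (word is)"
proof (induction "is")
  case (Cons i "is")
  then have "wedge N q (i # is) = cls N (cext q) (word [i]) \<otimes>\<^bsub>rel_algebra N (cext q)\<^esub> cls N (cext q) (word is)"
    by (simp add: wedge_def qext_rel)
  also have "\<dots> = cls N (cext q) (word (i # is))"
    using Cons.prems by (subst cls_mult) (auto simp: word_mult)
  finally show ?case .
qed (simp add: wedge_def qext_rel one_rel_algebra)

text \<open>
  The coordinate at the ordered product with support \<open>\<gamma>\<close>.  Exchanges preserve the set of letters and
  whether a letter is repeated, so weight zero can be given to all words except the arrangements of
  \<open>\<gamma>\<close>; on these the compatibility with exchanges is \<open>word_coeff_swap\<close>.
\<close>

lemma qext_functional:
  assumes "\<And>i j. q i j * q j i = 1"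
  shows "\<exists>h. h \<in> lin (qext N q) Cmod \<and> (\<forall>is. set is \<subseteq> {..<N} \<longrightarrow>
    h (wedge N q is) = (if distinct is \<and> set is = \<gamma> then word_coeff (cext q) is else 0))"
proof -
  define f where "f v = (if distinct (letters v) \<and> set (letters v) = \<gamma>
      then word_coeff (cext q) (letters v) else 0)" for v
  have c: "cext q i j * cext q j i = 1" for i j
    using assms[of i j] by (auto simp: field_simps)
  have rel: "f (Word (u @ i # j # v)) = cext q i j * f (Word (u @ j # i # v))" if "i < N" "j < N" for u i j v
    using word_coeff_swap[of "cext q" i j u v, OF c] by (auto simp: f_def insert_commute)
  then obtain h where h: "h \<in> lin (rel_algebra N (cext q)) Cmod"
      "\<And>p. Poly_Mapping.keys p \<subseteq> words N \<Longrightarrow> h (cls N (cext q) p) = weigh f p"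
    using rel_algebra_functional[of N f "cext q", OF rel] by blast
  show ?thesis
    by (rule exI[of _ h]) (use h in \<open>auto simp: qext_rel wedge_word weigh_simps f_def\<close>)
qed

lemma cmodule_qext: "cmodule (qext N q)" and cmodule_qsym: "cmodule (qsym N q)"
  by (simp_all add: qext_rel qsym_rel cmodule_rel_algebra)

lemma wedge_closed: "set is \<subseteq> {..<N} \<Longrightarrow> wedge N q is \<in> carrier (qext N q)"
  by (simp add: wedge_word qext_rel cls_carrier)

lemma vgen_closed: "i < N \<Longrightarrow> vgen N q i \<in> carrier (qsym N q)"
  by (simp add: qsym_rel cls_carrier)

lemma one_qsym_closed: "\<one>\<^bsub>qsym N q\<^esub> \<in> carrier (qsym N q)"
  by (simp add: qsym_rel one_rel_algebra cls_carrier)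

lemma wedge_swap:
  assumes "i < N" "j < N"
  shows "wedge N q [i, j] = (- inverse (q i j)) \<odot>\<^bsub>qext N q\<^esub> wedge N q [j, i]"
  using assms by (simp add: wedge_word qext_rel cls_swap[of i N j])

subsection \<open>Exterior powers\<close>

lemma ext_power_simps:
  "\<zero>\<^bsub>ext_power N q k\<^esub> = \<zero>\<^bsub>qext N q\<^esub>" "x \<oplus>\<^bsub>ext_power N q k\<^esub> y = x \<oplus>\<^bsub>qext N q\<^esub> y"
  "c \<odot>\<^bsub>ext_power N q k\<^esub> x = c \<odot>\<^bsub>qext N q\<^esub> x"
  by (simp_all add: ext_power_def)

lemma ext_power:
  shows cmodule_ext_power: "cmodule (ext_power N q k)"
    and ext_power_carrier: "carrier (ext_power N q k) = LinearCombinations.module.span CC (qext N q)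
        {wedge N q is | is. length is = k \<and> set is \<subseteq> {..<N}}"
    and ext_power_subset: "carrier (ext_power N q k) \<subseteq> carrier (qext N q)"
    and wedge_ext_power: "length is = k \<Longrightarrow> set is \<subseteq> {..<N} \<Longrightarrow> wedge N q is \<in> carrier (ext_power N q k)"
proof -
  let ?S = "{wedge N q is | is. length is = k \<and> set is \<subseteq> {..<N}}"
  interpret Module.module CC "qext N q" by (rule cmodule_qext)
  have S: "?S \<subseteq> carrier (qext N q)" by (auto simp: wedge_closed)
  show "cmodule (ext_power N q k)"
    unfolding ext_power_def by (rule submodule_is_module[OF span_is_submodule[OF S]])
  show c: "carrier (ext_power N q k) = span ?S" by (simp add: ext_power_def)
  show "carrier (ext_power N q k) \<subseteq> carrier (qext N q)"
    unfolding c by (rule span_is_subset2[OF S])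
  show "length is = k \<Longrightarrow> set is \<subseteq> {..<N} \<Longrightarrow> wedge N q is \<in> carrier (ext_power N q k)"
    using in_own_span[OF S] unfolding c by blast
qed

lemma ext_power_lin: "h \<in> lin (qext N q) W \<Longrightarrow> h \<in> lin (ext_power N q k) W"
  by (intro linI) (simp_all add: ext_power_simps linD subsetD[OF ext_power_subset])

definition ext_coord :: "nat \<Rightarrow> (nat \<Rightarrow> nat \<Rightarrow> complex) \<Rightarrow> nat set \<Rightarrow> alg_elem \<Rightarrow> complex" where
  "ext_coord N q \<gamma> = (SOME h. h \<in> lin (qext N q) Cmod \<and> (\<forall>is. set is \<subseteq> {..<N} \<longrightarrow>
    h (wedge N q is) = (if distinct is \<and> set is = \<gamma> then word_coeff (cext q) is else 0)))"

lemma ext_coord: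
  assumes "\<And>i j. q i j * q j i = 1"
  shows "ext_coord N q \<gamma> \<in> lin (ext_power N q k) Cmod"
    and "\<beta> \<subseteq> {..<N} \<Longrightarrow> ext_coord N q \<gamma> (wedge N q (sorted_list_of_set \<beta>)) = (if \<beta> = \<gamma> then 1 else 0)"
proof -
  note * = someI_ex[OF qext_functional[of q N \<gamma>, OF assms], folded ext_coord_def]
  show "ext_coord N q \<gamma> \<in> lin (ext_power N q k) Cmod" using * by (blast intro: ext_power_lin)
  show "\<beta> \<subseteq> {..<N} \<Longrightarrow> ext_coord N q \<gamma> (wedge N q (sorted_list_of_set \<beta>)) = (if \<beta> = \<gamma> then 1 else 0)"
    using conjunct2[OF *, rule_format, of "sorted_list_of_set \<beta>"] finite_subset[of \<beta> "{..<N}"]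
    by (simp add: word_coeff_sorted)
qed

text \<open>
  Only used for words of length at most one, where the conditions can be met: \<open>w = []\<close> gives the constant
  coefficient and \<open>w = [k]\<close> the coefficient of \<open>v_k\<close>.
\<close>

definition sym_coord :: "nat \<Rightarrow> (nat \<Rightarrow> nat \<Rightarrow> complex) \<Rightarrow> nat list \<Rightarrow> alg_elem \<Rightarrow> complex" where
  "sym_coord N q w = (SOME h. h \<in> lin (qsym N q) Cmod \<and> h \<one>\<^bsub>qsym N q\<^esub> = (if w = [] then 1 else 0) \<and>
    (\<forall>i<N. h (vgen N q i) = (if w = [i] then 1 else 0)))"

lemma sym_coord:
  assumes "length w \<le> 1"
  shows "sym_coord N q w \<in> lin (qsym N q) Cmod"
    and "sym_coord N q w \<one>\<^bsub>qsym N q\<^esub> = (if w = [] then 1 else 0)"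
    and "i < N \<Longrightarrow> sym_coord N q w (vgen N q i) = (if w = [i] then 1 else 0)"
  using someI_ex[OF qsym_functional[OF assms], of N q, folded sym_coord_def] by blast+

section \<open>Spans and dual families\<close>

lemma lin_span_image:
  assumes M: "cmodule M" and W: "cmodule W" and f: "f \<in> lin M W" and S: "S \<subseteq> carrier M"
    and T: "T \<subseteq> carrier W" and sub: "\<And>x. x \<in> S \<Longrightarrow> f x \<in> LinearCombinations.module.span CC W T"
    and x: "x \<in> LinearCombinations.module.span CC M S"
  shows "f x \<in> LinearCombinations.module.span CC W T"
proof -
  interpret M: Module.module CC M by (rule M)
  interpret W: Module.module CC W by (rule W)
  have T': "LinearCombinations.submodule CC (W.span T) W" by (rule W.span_is_submodule[OF T])
  have "LinearCombinations.submodule CC {x \<in> carrier M. f x \<in> W.span T} M"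
    using T' lin_zero[OF M W f]
    by (intro LinearCombinations.submodule.intro[OF M])
      (auto simp: linD[OF f] cmoduleD[OF M] LinearCombinations.submodule_def)
  then have "M.span S \<subseteq> {x \<in> carrier M. f x \<in> W.span T}"
    using sub S by (intro M.span_is_subset) auto
  with x show ?thesis by blast
qed

lemma lin_eq_on_span:
  assumes M: "cmodule M" and W: "cmodule W" and f: "f \<in> lin M W" and h: "h \<in> lin M W"
    and S: "S \<subseteq> carrier M" and eq: "\<And>x. x \<in> S \<Longrightarrow> f x = h x"
    and x: "x \<in> LinearCombinations.module.span CC M S"
  shows "f x = h x"
proof -
  interpret M: Module.module CC M by (rule M)
  have "LinearCombinations.submodule CC {x \<in> carrier M. f x = h x} M"
    using lin_zero[OF M W f] lin_zero[OF M W h]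
    by (intro LinearCombinations.submodule.intro[OF M])
      (auto simp: linD[OF f] linD[OF h] cmoduleD[OF M])
  then have "M.span S \<subseteq> {x \<in> carrier M. f x = h x}"
    using eq S by (intro M.span_is_subset) auto
  with x show ?thesis by blast
qed

text \<open>
  Families with dual functionals are linearly independent, and the functionals compute coordinates
  on the span.  All linear independence statements here come from such functionals.
\<close>

locale dual_family =
  fixes V :: "(complex, 'v) module" and I :: "'i set" and E :: "'i \<Rightarrow> 'v" and \<phi> :: "'i \<Rightarrow> 'v \<Rightarrow> complex"
  assumes V: "cmodule V" and E: "\<And>i. i \<in> I \<Longrightarrow> E i \<in> carrier V"
    and \<phi>: "\<And>i. i \<in> I \<Longrightarrow> \<phi> i \<in> lin V Cmod"
    and dual: "\<And>i j. i \<in> I \<Longrightarrow> j \<in> I \<Longrightarrow> \<phi> i (E j) = (if i = j then 1 else 0)"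
begin

sublocale V: Module.module CC V by (rule V)

lemma E_subset: "E ` I \<subseteq> carrier V" using E by auto

lemma inj_E: "inj_on E I"
proof (rule inj_onI)
  fix i j assume "i \<in> I" "j \<in> I" "E i = E j"
  then show "i = j" using dual[of i i] dual[of i j] by (auto split: if_splits)
qed

lemma functional_sum:
  assumes "finite F" "F \<subseteq> I" "j \<in> I"
  shows "\<phi> j (\<Oplus>\<^bsub>V\<^esub>i\<in>F. a i \<odot>\<^bsub>V\<^esub> E i) = (if j \<in> F then a j else 0)"
proof -
  have "\<phi> j (\<Oplus>\<^bsub>V\<^esub>i\<in>F. a i \<odot>\<^bsub>V\<^esub> E i) = (\<Sum>i\<in>F. \<phi> j (a i \<odot>\<^bsub>V\<^esub> E i))"
    using assms E by (subst lin_finsum[OF V cmodule_Cmod \<phi>]) (auto simp: cmoduleD(6)[OF V])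
  also have "\<dots> = (\<Sum>i\<in>F. if i = j then a i else 0)"
    using assms E by (intro sum.cong) (auto simp: linD[OF \<phi>] dual subset_iff)
  also have "\<dots> = (if j \<in> F then a j else 0)" using assms by simp
  finally show ?thesis .
qed

lemma lincomb_image:
  assumes "finite F" "F \<subseteq> I"
  shows "V.lincomb a (E ` F) = (\<Oplus>\<^bsub>V\<^esub>i\<in>F. a (E i) \<odot>\<^bsub>V\<^esub> E i)"
  unfolding V.lincomb_def using assms E inj_on_subset[OF inj_E assms(2)]
  by (subst V.add.finprod_reindex) (auto simp: cmoduleD(6)[OF V])

lemma finite_image: "A \<subseteq> E ` I \<Longrightarrow> finite A \<Longrightarrow> \<exists>F. finite F \<and> F \<subseteq> I \<and> A = E ` F"
  by (metis finite_subset_image)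

lemma lin_indpt: "V.lin_indpt (E ` I)"
proof
  assume "V.lin_dep (E ` I)"
  then obtain A a v where A: "finite A" "A \<subseteq> E ` I" "V.lincomb a A = \<zero>\<^bsub>V\<^esub>" "v \<in> A" "a v \<noteq> 0"
    unfolding V.lin_dep_def by auto
  then obtain F where F: "finite F" "F \<subseteq> I" "A = E ` F" using finite_image by blast
  from A F obtain j where j: "j \<in> F" "v = E j" by blast
  have "\<phi> j (V.lincomb a A) = a v"
    using F j unfolding F(3) by (subst lincomb_image) (auto simp: functional_sum subset_iff)
  moreover have "\<phi> j (V.lincomb a A) = 0"
    using A(3) lin_zero[OF V cmodule_Cmod \<phi>, of j] F j by auto
  ultimately show False using A by simp
qed

text \<open>
  The index set may be infinite, but a member of the span has only finitely many nonzero coordinates.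
\<close>

lemma expansion:
  assumes c: "c \<in> V.span (E ` I)"
  shows "finite {i \<in> I. \<phi> i c \<noteq> 0}" and "c = (\<Oplus>\<^bsub>V\<^esub>i\<in>{i \<in> I. \<phi> i c \<noteq> 0}. \<phi> i c \<odot>\<^bsub>V\<^esub> E i)"
proof -
  from c obtain A a where A: "finite A" "A \<subseteq> E ` I" "c = V.lincomb a A"
    unfolding V.span_def by auto
  then obtain F where F: "finite F" "F \<subseteq> I" "A = E ` F" using finite_image by blast
  have c': "c = (\<Oplus>\<^bsub>V\<^esub>i\<in>F. a (E i) \<odot>\<^bsub>V\<^esub> E i)" using A(3) F by (simp add: lincomb_image)
  have \<phi>c: "\<phi> j c = (if j \<in> F then a (E j) else 0)" if "j \<in> I" for j
    unfolding c' by (rule functional_sum[OF F(1,2) that])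
  then have sub: "{i \<in> I. \<phi> i c \<noteq> 0} \<subseteq> F" by (auto split: if_splits)
  then show "finite {i \<in> I. \<phi> i c \<noteq> 0}" using F(1) finite_subset by blast
  have "(\<Oplus>\<^bsub>V\<^esub>i\<in>{i \<in> I. \<phi> i c \<noteq> 0}. \<phi> i c \<odot>\<^bsub>V\<^esub> E i) = (\<Oplus>\<^bsub>V\<^esub>i\<in>F. a (E i) \<odot>\<^bsub>V\<^esub> E i)"
  proof (rule V.add.finprod_mono_neutral_cong_left[OF F(1) sub])
    fix i assume "i \<in> F - {i \<in> I. \<phi> i c \<noteq> 0}"
    then have "a (E i) = 0" "i \<in> I" using \<phi>c[of i] F(2) by auto
    then show "a (E i) \<odot>\<^bsub>V\<^esub> E i = \<zero>\<^bsub>V\<^esub>" using cmoduleD(11)[OF V E] by simp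
  next
    fix i assume "i \<in> {i \<in> I. \<phi> i c \<noteq> 0}"
    then have "\<phi> i c = a (E i)" using \<phi>c[of i] by (auto split: if_splits)
    then show "\<phi> i c \<odot>\<^bsub>V\<^esub> E i = a (E i) \<odot>\<^bsub>V\<^esub> E i" by simp
  next
    show "(\<lambda>i. a (E i) \<odot>\<^bsub>V\<^esub> E i) \<in> F \<rightarrow> carrier V"
      using F(2) cmoduleD(6)[OF V E] by blast
  qed
  then show "c = (\<Oplus>\<^bsub>V\<^esub>i\<in>{i \<in> I. \<phi> i c \<noteq> 0}. \<phi> i c \<odot>\<^bsub>V\<^esub> E i)" using c' by simp
qed

lemma eq_zero:
  assumes "c \<in> V.span (E ` I)" "\<And>i. i \<in> I \<Longrightarrow> \<phi> i c = 0"
  shows "c = \<zero>\<^bsub>V\<^esub>"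
proof -
  have "{i \<in> I. \<phi> i c \<noteq> 0} = {}" using assms(2) by auto
  then show ?thesis using expansion(2)[OF assms(1)] by (simp only: V.finsum_empty)
qed

end

lemma lin_diff:
  assumes M: "cmodule M" and W: "cmodule W" and f: "f \<in> lin M W" and h: "h \<in> lin M W"
  shows "(\<lambda>x. f x \<ominus>\<^bsub>W\<^esub> h x) \<in> lin M W"
  using lin_add[OF W f lin_scale[OF W h, of "- 1"]]
  by (rule lin_cong[OF _ _ M]) (simp add: cmoduleD(13)[OF W] linD[OF f] linD[OF h])

section \<open>The Koszul complex\<close>

lemma qpar_sq: "qpar n i j * qpar n j i = 1"
  by (simp add: qpar_def)

lemma cmodule_Sq: "cmodule (Sq n)"
  by (rule cmodule_qsym)

lemma skew_simps:
  "carrier (skew m n) = carrier (Gm1n m n) \<rightarrow>\<^sub>E carrier (Sq n)"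
  "\<zero>\<^bsub>skew m n\<^esub> = (\<lambda>g\<in>carrier (Gm1n m n). \<zero>\<^bsub>Sq n\<^esub>)"
  "f \<oplus>\<^bsub>skew m n\<^esub> h = (\<lambda>g\<in>carrier (Gm1n m n). f g \<oplus>\<^bsub>Sq n\<^esub> h g)"
  "c \<odot>\<^bsub>skew m n\<^esub> f = (\<lambda>g\<in>carrier (Gm1n m n). c \<odot>\<^bsub>Sq n\<^esub> f g)"
  by (simp_all add: skew_def)

lemma cmodule_skew: "cmodule (skew m n)"
proof -
  interpret S: Module.module CC "Sq n" by (rule cmodule_Sq)
  show ?thesis
  proof (rule module_criteria[OF cring_CC], goal_cases)
    case 3
    show ?case
    proof
      fix f assume "f \<in> carrier (skew m n)"
      then show "\<exists>h\<in>carrier (skew m n). f \<oplus>\<^bsub>skew m n\<^esub> h = \<zero>\<^bsub>skew m n\<^esub>"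
        by (intro bexI[of _ "\<lambda>g\<in>carrier (Gm1n m n). \<ominus>\<^bsub>Sq n\<^esub> f g"])
          (auto simp: skew_simps PiE_iff S.r_neg intro!: restrict_ext)
    qed
  qed (auto simp: skew_simps fun_eq_iff PiE_iff S.a_ac cmoduleD[OF cmodule_Sq] extensional_def restrict_def)
qed

lemma skew_eval:
  assumes "h \<in> lin (Sq n) W" "g \<in> carrier (Gm1n m n)"
  shows "(\<lambda>f. h (f g)) \<in> lin (skew m n) W"
  using assms(2) by (intro linI) (auto simp: skew_simps linD[OF assms(1)] PiE_iff)

lemma skew_single_carrier: "a \<in> carrier (Sq n) \<Longrightarrow> skew_single m n a g \<in> carrier (skew m n)"
  using cmoduleD(3)[OF cmodule_Sq] by (auto simp: skew_simps skew_single_def PiE_iff)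

lemma skew_single_lin: "(\<lambda>a. skew_single m n a g) \<in> lin (Sq n) (skew m n)"
proof -
  interpret S: Module.module CC "Sq n" by (rule cmodule_Sq)
  show ?thesis
    by (intro linI skew_single_carrier)
      (auto simp: skew_simps skew_single_def cmoduleD[OF cmodule_Sq] intro!: restrict_ext)
qed

lemma cmodule_cochains: "cmodule (cochains m n k)"
  unfolding cochains_def by (rule cmodule_tensor[OF cmodule_skew cmodule_ext_power])

lemma tens_cochains_bilin: "bilin (skew m n) (Ext n k) (cochains m n k) (tens (skew m n) (Ext n k))"
  unfolding cochains_def by (rule tens_bilin[OF cmodule_skew cmodule_ext_power])

lemma tens_lin:
  shows "w \<in> carrier (Ext n k) \<Longrightarrow> (\<lambda>f. tens (skew m n) (Ext n k) f w) \<in> lin (skew m n) (cochains m n k)"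
    and "f \<in> carrier (skew m n) \<Longrightarrow> tens (skew m n) (Ext n k) f \<in> lin (Ext n k) (cochains m n k)"
  using tens_cochains_bilin by (auto simp: bilin_def)

lemma wedge_set_ext_power:
  "\<beta> \<subseteq> {..<N} \<Longrightarrow> card \<beta> = k \<Longrightarrow> wedge N q (sorted_list_of_set \<beta>) \<in> carrier (ext_power N q k)"
  using finite_subset[of \<beta> "{..<N}"] by (intro wedge_ext_power) auto

lemma cochain_elem_lin:
  assumes "\<beta> \<subseteq> {..<2 * n}" "card \<beta> = k"
  shows "(\<lambda>a. cochain_elem m n k a g \<beta>) \<in> lin (Sq n) (cochains m n k)"
  unfolding cochain_elem_def
  by (rule lin_comp[OF skew_single_lin tens_lin(1)[OF wedge_set_ext_power[OF assms]]])

lemma act_gen_closed: "act_gen n g i \<in> carrier (Sq n)"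
proof -
  interpret S: Module.module CC "Sq n" by (rule cmodule_Sq)
  show ?thesis unfolding act_gen_def
    by (intro S.finsum_closed) (auto simp: cmoduleD(6)[OF cmodule_Sq] vgen_closed)
qed

text \<open>
  The coefficient by which the differential multiplies in direction \<open>v_i*\<close>, up to sign.
\<close>

definition koszul_coeff :: "nat \<Rightarrow> complex mat \<Rightarrow> nat set \<Rightarrow> nat \<Rightarrow> alg_elem \<Rightarrow> alg_elem" where
  "koszul_coeff n g \<beta> i a =
     (\<Prod>s\<in>{s \<in> \<beta>. s \<le> i}. qpar n s i) \<odot>\<^bsub>Sq n\<^esub> (Sq_gen n i \<otimes>\<^bsub>Sq n\<^esub> a)
       \<ominus>\<^bsub>Sq n\<^esub> (\<Prod>s\<in>{s \<in> \<beta>. i \<le> s}. qpar n i s) \<odot>\<^bsub>Sq n\<^esub> (a \<otimes>\<^bsub>Sq n\<^esub> act_gen n g i)"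

lemma koszul_coeff_lin:
  assumes "i < 2 * n"
  shows "koszul_coeff n g \<beta> i \<in> lin (Sq n) (Sq n)"
proof -
  have "(\<lambda>a. Sq_gen n i \<otimes>\<^bsub>Sq n\<^esub> a) \<in> lin (Sq n) (Sq n)" "(\<lambda>a. a \<otimes>\<^bsub>Sq n\<^esub> act_gen n g i) \<in> lin (Sq n) (Sq n)"
    using rel_algebra_mult_lin[of _ "2 * n" "qpar n"] vgen_closed[OF assms] act_gen_closed
    by (simp_all add: qsym_rel(1))
  from this[THEN lin_scale[OF cmodule_Sq]] show ?thesis
    unfolding koszul_coeff_def[abs_def] by (intro lin_diff cmodule_Sq)
qed

lemma koszul_coeff_skew_lin:
  assumes "i < 2 * n"
  shows "(\<lambda>f. \<lambda>g\<in>carrier (Gm1n m n). koszul_coeff n g \<beta> i (f g)) \<in> lin (skew m n) (skew m n)"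
  by (intro linI) (auto simp: skew_simps PiE_iff linD[OF koszul_coeff_lin[OF assms]] intro!: restrict_ext)

lemma koszul_coeff_skew_single:
  assumes "i < 2 * n"
  shows "(\<lambda>h\<in>carrier (Gm1n m n). koszul_coeff n h \<beta> i (skew_single m n a g h)) =
    skew_single m n (koszul_coeff n g \<beta> i a) g"
  using lin_zero[OF cmodule_Sq cmodule_Sq koszul_coeff_lin[OF assms]]
  by (auto simp: skew_single_def intro!: restrict_ext)

text \<open>
  The differential on \<open>f\<close> tensored with the ordered product over \<open>\<beta>\<close>, for an arbitrary element \<open>f\<close>
  of the skew group algebra: it acts on each component \<open>f g\<close> separately.
\<close>

abbreviation koszul_map :: "nat \<Rightarrow> nat \<Rightarrow> nat \<Rightarrow> nat set \<Rightarrow> skew_elem \<Rightarrow> cochain" where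
  "koszul_map m n k \<beta> f \<equiv> (\<Oplus>\<^bsub>cochains m n k\<^esub>i\<in>{..<2 * n} - \<beta>.
     (- 1) ^ card {s \<in> \<beta>. s \<le> i} \<odot>\<^bsub>cochains m n k\<^esub>
     tens (skew m n) (Ext n k) (\<lambda>g\<in>carrier (Gm1n m n). koszul_coeff n g \<beta> i (f g))
       (wedge (2 * n) (qpar n) (sorted_list_of_set (insert i \<beta>))))"

text \<open>
  The differential is chosen among the linear maps with prescribed values, so the point is that one
  exists.  It is obtained from the universal property of the tensor product: the second factor \<open>w\<close> is
  expanded in the ordered products by its coordinates, and \<open>koszul_map\<close> is applied to the first factor.
\<close>

lemma differential:
  assumes k: "k > 0"
  shows "differential m n k \<in> lin (cochains m n (k - 1)) (cochains m n k)"
    and "a \<in> carrier (Sq n) \<Longrightarrow> g \<in> carrier (Gm1n m n) \<Longrightarrow> \<beta> \<subseteq> {..<2 * n} \<Longrightarrow> card \<beta> = k - 1 \<Longrightarrow>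
      differential m n k (cochain_elem m n (k - 1) a g \<beta>) =
        (\<Oplus>\<^bsub>cochains m n k\<^esub>i\<in>{..<2 * n} - \<beta>. (- 1) ^ card {s \<in> \<beta>. s \<le> i} \<odot>\<^bsub>cochains m n k\<^esub>
           cochain_elem m n k (koszul_coeff n g \<beta> i a) g (insert i \<beta>))"
proof -
  let ?N = "2 * n" and ?q = "qpar n"
  let ?Z = "cochains m n k" and ?G = "carrier (Gm1n m n)"
  interpret Z: Module.module CC ?Z by (rule cmodule_cochains)
  define P where "P = {\<beta>. \<beta> \<subseteq> {..<?N} \<and> card \<beta> = k - 1}"
  have finP: "finite P" unfolding P_def by (rule finite_subset[of _ "Pow {..<?N}"]) auto
  have wedge_in: "wedge ?N ?q (sorted_list_of_set (insert i \<beta>)) \<in> carrier (Ext n k)"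
    if "\<beta> \<in> P" "i \<in> {..<?N} - \<beta>" for i \<beta>
    using that k finite_subset[of \<beta> "{..<?N}"] by (intro wedge_set_ext_power) (auto simp: P_def)
  have map_lin: "koszul_map m n k \<beta> \<in> lin (skew m n) ?Z" if "\<beta> \<in> P" for \<beta>
    using that by (intro lin_sum lin_scale cmodule_skew cmodule_cochains
        lin_comp[OF koszul_coeff_skew_lin tens_lin(1)[OF wedge_in]]) auto
  define B where "B f w = (\<Oplus>\<^bsub>?Z\<^esub>\<beta>\<in>P. ext_coord ?N ?q \<beta> w \<odot>\<^bsub>?Z\<^esub> koszul_map m n k \<beta> f)" for f w
  have bil: "bilin (skew m n) (Ext n (k - 1)) ?Z B"
    unfolding bilin_def B_def
  proof (intro conjI ballI)
    fix f assume "f \<in> carrier (skew m n)"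
    then show "(\<lambda>w. \<Oplus>\<^bsub>?Z\<^esub>\<beta>\<in>P. ext_coord ?N ?q \<beta> w \<odot>\<^bsub>?Z\<^esub> koszul_map m n k \<beta> f) \<in> lin (Ext n (k - 1)) ?Z"
      by (intro lin_sum lin_scale_vector cmodule_ext_power cmodule_cochains ext_coord(1) qpar_sq
          linD(1)[OF map_lin])
  next
    fix w assume "w \<in> carrier (Ext n (k - 1))"
    show "(\<lambda>f. \<Oplus>\<^bsub>?Z\<^esub>\<beta>\<in>P. ext_coord ?N ?q \<beta> w \<odot>\<^bsub>?Z\<^esub> koszul_map m n k \<beta> f) \<in> lin (skew m n) ?Z"
      by (intro lin_sum lin_scale cmodule_skew cmodule_cochains map_lin)
  qed
  note L = tensor_lift[OF cmodule_skew cmodule_ext_power cmodule_cochains bil, folded cochains_def]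
  let ?spec = "\<lambda>d. d \<in> lin (cochains m n (k - 1)) ?Z \<and>
     (\<forall>a\<in>carrier (Sq n). \<forall>g\<in>?G. \<forall>\<beta>. \<beta> \<subseteq> {..<?N} \<and> card \<beta> = k - 1 \<longrightarrow>
        d (cochain_elem m n (k - 1) a g \<beta>) =
        (\<Oplus>\<^bsub>?Z\<^esub>i\<in>{..<?N} - \<beta>. (- 1) ^ card {s \<in> \<beta>. s \<le> i} \<odot>\<^bsub>?Z\<^esub>
           cochain_elem m n k (koszul_coeff n g \<beta> i a) g (insert i \<beta>)))"
  have spec: "?spec (tensor_lift (skew m n) (Ext n (k - 1)) ?Z B)"
  proof (intro conjI ballI allI impI, rule L(1))
    fix a g \<beta> assume a: "a \<in> carrier (Sq n)" and g: "g \<in> ?G" and "\<beta> \<subseteq> {..<?N} \<and> card \<beta> = k - 1"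
    then have \<beta>: "\<beta> \<in> P" "\<beta> \<subseteq> {..<?N}" "card \<beta> = k - 1" by (auto simp: P_def)
    let ?f = "skew_single m n a g" and ?w = "wedge ?N ?q (sorted_list_of_set \<beta>)"
    have f: "?f \<in> carrier (skew m n)" by (rule skew_single_carrier[OF a])
    have "tensor_lift (skew m n) (Ext n (k - 1)) ?Z B (cochain_elem m n (k - 1) a g \<beta>) = B ?f ?w"
      unfolding cochain_elem_def using f wedge_set_ext_power[OF \<beta>(2,3)] by (intro L(2))
    also have "\<dots> = (\<Oplus>\<^bsub>?Z\<^esub>\<beta>'\<in>P. if \<beta> = \<beta>' then koszul_map m n k \<beta>' ?f else \<zero>\<^bsub>?Z\<^esub>)"
      unfolding B_def using linD(1)[OF map_lin f] cmoduleD(10,11)[OF cmodule_cochains] \<beta>(2)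
      by (intro Z.finsum_cong') (auto simp: ext_coord(2)[OF qpar_sq] Pi_iff Z.zero_closed)
    also have "\<dots> = koszul_map m n k \<beta> ?f"
      using linD(1)[OF map_lin f] \<beta>(1) finP by (intro Z.add.finprod_singleton) auto
    also have "\<dots> = (\<Oplus>\<^bsub>?Z\<^esub>i\<in>{..<?N} - \<beta>. (- 1) ^ card {s \<in> \<beta>. s \<le> i} \<odot>\<^bsub>?Z\<^esub>
           cochain_elem m n k (koszul_coeff n g \<beta> i a) g (insert i \<beta>))"
    proof (rule Z.finsum_cong'[OF refl])
      show "(\<lambda>i. (- 1) ^ card {s \<in> \<beta>. s \<le> i} \<odot>\<^bsub>?Z\<^esub>
           cochain_elem m n k (koszul_coeff n g \<beta> i a) g (insert i \<beta>)) \<in> {..<?N} - \<beta> \<rightarrow> carrier ?Z"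
      proof
        fix i assume i: "i \<in> {..<?N} - \<beta>"
        have "insert i \<beta> \<subseteq> {..<?N}" "card (insert i \<beta>) = k"
          using i \<beta> k finite_subset[of \<beta> "{..<?N}"] by auto
        then show "(- 1) ^ card {s \<in> \<beta>. s \<le> i} \<odot>\<^bsub>?Z\<^esub>
           cochain_elem m n k (koszul_coeff n g \<beta> i a) g (insert i \<beta>) \<in> carrier ?Z"
          using i by (intro cmoduleD(6)[OF cmodule_cochains] linD(1)[OF cochain_elem_lin]
            linD(1)[OF koszul_coeff_lin] a) auto
      qed
    qed (simp add: koszul_coeff_skew_single cochain_elem_def)
    finally show "tensor_lift (skew m n) (Ext n (k - 1)) ?Z B (cochain_elem m n (k - 1) a g \<beta>) =
      (\<Oplus>\<^bsub>?Z\<^esub>i\<in>{..<?N} - \<beta>. (- 1) ^ card {s \<in> \<beta>. s \<le> i} \<odot>\<^bsub>?Z\<^esub>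
           cochain_elem m n k (koszul_coeff n g \<beta> i a) g (insert i \<beta>))" .
  qed
  have def: "differential m n k = (SOME d. ?spec d)"
    by (simp only: differential_def koszul_coeff_def)
  have "?spec (differential m n k)"
    unfolding def by (rule someI[of ?spec, OF spec])
  then show "differential m n k \<in> lin (cochains m n (k - 1)) ?Z"
    and "a \<in> carrier (Sq n) \<Longrightarrow> g \<in> ?G \<Longrightarrow> \<beta> \<subseteq> {..<?N} \<Longrightarrow> card \<beta> = k - 1 \<Longrightarrow>
      differential m n k (cochain_elem m n (k - 1) a g \<beta>) =
        (\<Oplus>\<^bsub>?Z\<^esub>i\<in>{..<?N} - \<beta>. (- 1) ^ card {s \<in> \<beta>. s \<le> i} \<odot>\<^bsub>?Z\<^esub>
           cochain_elem m n k (koszul_coeff n g \<beta> i a) g (insert i \<beta>))"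
    by blast+
qed

section \<open>Constant cochains in coordinates\<close>

text \<open>
  The coordinate of a cochain at the coefficient of the word \<open>w\<close> (of length at most one) times \<open>g\<close>,
  and at the ordered product over \<open>\<gamma>\<close>.
\<close>

definition coord :: "nat \<Rightarrow> nat \<Rightarrow> nat \<Rightarrow> nat list \<Rightarrow> complex mat \<Rightarrow> nat set \<Rightarrow> cochain \<Rightarrow> complex" where
  "coord m n k w g \<gamma> = tensor_lift (skew m n) (Ext n k) Cmod
     (\<lambda>f x. sym_coord (2 * n) (qpar n) w (f g) * ext_coord (2 * n) (qpar n) \<gamma> x)"

lemma coord:
  assumes w: "length w \<le> 1" and g: "g \<in> carrier (Gm1n m n)"
  shows "coord m n k w g \<gamma> \<in> lin (cochains m n k) Cmod"
    and "a \<in> carrier (Sq n) \<Longrightarrow> \<beta> \<subseteq> {..<2 * n} \<Longrightarrow> card \<beta> = k \<Longrightarrow>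
      coord m n k w g \<gamma> (cochain_elem m n k a h \<beta>) =
        (if g = h \<and> \<beta> = \<gamma> then sym_coord (2 * n) (qpar n) w a else 0)"
proof -
  have S: "(\<lambda>f. sym_coord (2 * n) (qpar n) w (f g)) \<in> lin (skew m n) Cmod"
    by (rule skew_eval[OF sym_coord(1)[OF w] g])
  have E: "ext_coord (2 * n) (qpar n) \<gamma> \<in> lin (Ext n k) Cmod"
    by (rule ext_coord(1)[OF qpar_sq])
  have "bilin (skew m n) (Ext n k) Cmod
      (\<lambda>f x. sym_coord (2 * n) (qpar n) w (f g) * ext_coord (2 * n) (qpar n) \<gamma> x)"
    unfolding bilin_def
  proof (intro conjI ballI)
    fix f
    show "(\<lambda>x. sym_coord (2 * n) (qpar n) w (f g) * ext_coord (2 * n) (qpar n) \<gamma> x) \<in> lin (Ext n k) Cmod"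
      using lin_scale[OF cmodule_Cmod E] by simp
  next
    fix x
    show "(\<lambda>f. sym_coord (2 * n) (qpar n) w (f g) * ext_coord (2 * n) (qpar n) \<gamma> x) \<in> lin (skew m n) Cmod"
      using lin_scale_vector[OF cmodule_Cmod S, of "ext_coord (2 * n) (qpar n) \<gamma> x"] by simp
  qed
  note L = tensor_lift[OF cmodule_skew cmodule_ext_power cmodule_Cmod this,
      folded coord_def, folded cochains_def]
  show "coord m n k w g \<gamma> \<in> lin (cochains m n k) Cmod" by (rule L(1))
  assume a: "a \<in> carrier (Sq n)" and \<beta>: "\<beta> \<subseteq> {..<2 * n}" "card \<beta> = k"
  have "coord m n k w g \<gamma> (cochain_elem m n k a h \<beta>) =
      sym_coord (2 * n) (qpar n) w (skew_single m n a h g) *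
        ext_coord (2 * n) (qpar n) \<gamma> (wedge (2 * n) (qpar n) (sorted_list_of_set \<beta>))"
    unfolding cochain_elem_def by (rule L(2)[OF skew_single_carrier[OF a] wedge_set_ext_power[OF \<beta>]])
  also have "\<dots> = (if g = h \<and> \<beta> = \<gamma> then sym_coord (2 * n) (qpar n) w a else 0)"
    using lin_zero[OF cmodule_Sq cmodule_Cmod sym_coord(1)[OF w, of "2 * n" "qpar n"]] g
    by (simp add: ext_coord(2)[OF qpar_sq \<beta>(1)] skew_single_def)
  finally show "coord m n k w g \<gamma> (cochain_elem m n k a h \<beta>) =
      (if g = h \<and> \<beta> = \<gamma> then sym_coord (2 * n) (qpar n) w a else 0)" .
qed

abbreviation cells :: "nat \<Rightarrow> nat \<Rightarrow> nat \<Rightarrow> (complex mat \<times> nat set) set" where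
  "cells m n k \<equiv> carrier (Gm1n m n) \<times> {\<beta>. \<beta> \<subseteq> {..<2 * n} \<and> card \<beta> = k}"

abbreviation const_elem :: "nat \<Rightarrow> nat \<Rightarrow> nat \<Rightarrow> complex mat \<times> nat set \<Rightarrow> cochain" where
  "const_elem m n k \<equiv> \<lambda>(g, \<beta>). cochain_elem m n k \<one>\<^bsub>Sq n\<^esub> g \<beta>"

abbreviation const_coord :: "nat \<Rightarrow> nat \<Rightarrow> nat \<Rightarrow> complex mat \<times> nat set \<Rightarrow> cochain \<Rightarrow> complex" where
  "const_coord m n k \<equiv> \<lambda>(g, \<beta>). coord m n k [] g \<beta>"

lemma const_dual: "dual_family (cochains m n k) (cells m n k) (const_elem m n k) (const_coord m n k)"
proof (rule dual_family.intro[OF cmodule_cochains])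
  show "const_elem m n k i \<in> carrier (cochains m n k)" if "i \<in> cells m n k" for i
    using that linD(1)[OF cochain_elem_lin one_qsym_closed] by auto
  show "const_coord m n k i \<in> lin (cochains m n k) Cmod" if "i \<in> cells m n k" for i
    using that coord(1) by auto
  show "const_coord m n k i (const_elem m n k j) = (if i = j then 1 else 0)"
    if "i \<in> cells m n k" "j \<in> cells m n k" for i j
    using that by (auto simp: coord(2)[OF _ _ one_qsym_closed] sym_coord(2) split: if_splits)
qed

text \<open>
  The exterior square is spanned by all products of two generators.  The ordered ones suffice, since
  exchanging the factors only changes the scalar and squares of generators vanish.
\<close>

lemma const_cochains_span:
  "const_cochains m n 2 = LinearCombinations.module.span CC (cochains m n 2) (const_elem m n 2 ` cells m n 2)"
proof -
  interpret dual_family "cochains m n 2" "cells m n 2" "const_elem m n 2" "const_coord m n 2"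
    by (rule const_dual)
  let ?X = "V.span (const_elem m n 2 ` cells m n 2)"
  have X: "LinearCombinations.submodule CC ?X (cochains m n 2)" by (rule V.span_is_submodule[OF E_subset])
  define T where "T = {tens (skew m n) (Ext n 2) (skew_single m n \<one>\<^bsub>Sq n\<^esub> g) w | g w.
        g \<in> carrier (Gm1n m n) \<and> w \<in> carrier (Ext n 2)}"
  have "tens (skew m n) (Ext n 2) (skew_single m n \<one>\<^bsub>Sq n\<^esub> g) w \<in> ?X"
    if g: "g \<in> carrier (Gm1n m n)" and w: "w \<in> carrier (Ext n 2)" for g w
  proof -
    let ?t = "tens (skew m n) (Ext n 2) (skew_single m n \<one>\<^bsub>Sq n\<^esub> g)"
    interpret Q: Module.module CC "qext (2 * n) (qpar n)" by (rule cmodule_qext)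
    interpret X: Module.module CC "Ext n 2" by (rule cmodule_ext_power)
    have t: "?t \<in> lin (Ext n 2) (cochains m n 2)"
      by (rule tens_lin(2)[OF skew_single_carrier[OF one_qsym_closed]])
    have Xc: "\<zero>\<^bsub>cochains m n 2\<^esub> \<in> ?X" "\<And>x y. x \<in> ?X \<Longrightarrow> y \<in> ?X \<Longrightarrow> x \<oplus>\<^bsub>cochains m n 2\<^esub> y \<in> ?X"
      "\<And>c x. x \<in> ?X \<Longrightarrow> c \<odot>\<^bsub>cochains m n 2\<^esub> x \<in> ?X"
      using X by (auto simp: LinearCombinations.submodule_def)
    let ?S = "{wedge (2 * n) (qpar n) is | is. length is = 2 \<and> set is \<subseteq> {..<2 * n}}"
    have sorted: "?t (wedge (2 * n) (qpar n) [i, j]) \<in> ?X" if "i < j" "j < 2 * n" for i j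
    proof -
      have "(g, {i, j}) \<in> cells m n 2" using g that by auto
      then have "const_elem m n 2 (g, {i, j}) \<in> ?X"
        using V.in_own_span[OF E_subset] by blast
      then have "cochain_elem m n 2 \<one>\<^bsub>Sq n\<^esub> g {i, j} \<in> ?X" by simp
      moreover have "sorted_list_of_set {i, j} = [i, j]" using that by simp
      ultimately show ?thesis by (simp only: cochain_elem_def)
    qed
    have wedge: "?t (wedge (2 * n) (qpar n) [i, j]) \<in> ?X" if ij: "i < 2 * n" "j < 2 * n" for i j
    proof -
      have wc: "wedge (2 * n) (qpar n) [i, j] \<in> carrier (Ext n 2)"
        "wedge (2 * n) (qpar n) [j, i] \<in> carrier (Ext n 2)"
        using ij by (auto intro!: wedge_ext_power)
      consider "i < j" | "i = j" | "j < i" by linarith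
      then show ?thesis
      proof cases
        case 2
        let ?w = "wedge (2 * n) (qpar n) [i, i]"
        \<comment> \<open>The relation gives that twice the square of a generator is zero.\<close>
        have "?w = (- 1) \<odot>\<^bsub>Ext n 2\<^esub> ?w"
          using wedge_swap[OF ij(1) ij(1), of "qpar n"] by (simp add: qpar_def ext_power_simps)
        moreover have "?w = 1 \<odot>\<^bsub>Ext n 2\<^esub> ?w" using wc 2 cmoduleD(10)[OF cmodule_ext_power] by simp
        ultimately have "(1 + 1) \<odot>\<^bsub>Ext n 2\<^esub> ?w = (- 1 + 1) \<odot>\<^bsub>Ext n 2\<^esub> ?w"
          using wc 2 cmoduleD(7)[OF cmodule_ext_power, of ?w] by metis
        then have "(1 / 2) \<odot>\<^bsub>Ext n 2\<^esub> (2 \<odot>\<^bsub>Ext n 2\<^esub> ?w) = \<zero>\<^bsub>Ext n 2\<^esub>"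
          using wc 2 cmoduleD(11,12)[OF cmodule_ext_power] by simp
        then have "?w = \<zero>\<^bsub>Ext n 2\<^esub>"
          using wc 2 cmoduleD(9)[OF cmodule_ext_power, of ?w _ _ _ "1 / 2" 2]
            cmoduleD(10)[OF cmodule_ext_power, of ?w] by simp
        then show ?thesis using 2 Xc(1) lin_zero[OF cmodule_ext_power cmodule_cochains t] by simp
      next
        case 3
        have "?t (wedge (2 * n) (qpar n) [i, j]) =
            (- inverse (qpar n i j)) \<odot>\<^bsub>cochains m n 2\<^esub> ?t (wedge (2 * n) (qpar n) [j, i])"
          using wedge_swap[OF ij, of "qpar n"] linD(3)[OF t wc(2)] by (simp add: ext_power_simps)
        then show ?thesis using sorted[OF 3 ij(1)] Xc(3) by simp
      qed (use sorted ij in auto)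
    qed
    have "LinearCombinations.submodule CC {x \<in> carrier (Ext n 2). ?t x \<in> ?X} (qext (2 * n) (qpar n))"
    proof (rule LinearCombinations.submodule.intro[OF cmodule_qext])
      show "{x \<in> carrier (Ext n 2). ?t x \<in> ?X} \<subseteq> carrier (qext (2 * n) (qpar n))"
        using ext_power_subset by blast
    next
      fix x y assume xy: "x \<in> {x \<in> carrier (Ext n 2). ?t x \<in> ?X}" "y \<in> {x \<in> carrier (Ext n 2). ?t x \<in> ?X}"
      then have "x \<oplus>\<^bsub>Ext n 2\<^esub> y \<in> carrier (Ext n 2)" "?t (x \<oplus>\<^bsub>Ext n 2\<^esub> y) \<in> ?X"
        using cmoduleD(4)[OF cmodule_ext_power] linD(2)[OF t] Xc(2) by auto
      then show "x \<oplus>\<^bsub>qext (2 * n) (qpar n)\<^esub> y \<in> {x \<in> carrier (Ext n 2). ?t x \<in> ?X}"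
        by (simp add: ext_power_simps)
    next
      show "\<zero>\<^bsub>qext (2 * n) (qpar n)\<^esub> \<in> {x \<in> carrier (Ext n 2). ?t x \<in> ?X}"
        using cmoduleD(3)[OF cmodule_ext_power] lin_zero[OF cmodule_ext_power cmodule_cochains t] Xc(1)
        by (metis (mono_tags, lifting) ext_power_simps(1) mem_Collect_eq)
    next
      fix c x assume x: "x \<in> {x \<in> carrier (Ext n 2). ?t x \<in> ?X}"
      then have "c \<odot>\<^bsub>Ext n 2\<^esub> x \<in> carrier (Ext n 2)" "?t (c \<odot>\<^bsub>Ext n 2\<^esub> x) \<in> ?X"
        using cmoduleD(6)[OF cmodule_ext_power] linD(3)[OF t] Xc(3) by auto
      then show "c \<odot>\<^bsub>qext (2 * n) (qpar n)\<^esub> x \<in> {x \<in> carrier (Ext n 2). ?t x \<in> ?X}"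
        by (simp add: ext_power_simps)
    qed
    moreover have "?S \<subseteq> {x \<in> carrier (Ext n 2). ?t x \<in> ?X}"
      using wedge wedge_ext_power[of _ 2 "2 * n" "qpar n"] by (auto simp: length_Suc_conv numeral_2_eq_2)
    ultimately have "Q.span ?S \<subseteq> {x \<in> carrier (Ext n 2). ?t x \<in> ?X}"
      by (intro Q.span_is_subset)
    then show ?thesis using w unfolding ext_power_carrier by blast
  qed
  then have "T \<subseteq> ?X" by (auto simp: T_def)
  then have "V.span T \<subseteq> ?X" by (rule V.span_is_subset[OF _ X])
  moreover have "const_elem m n 2 ` cells m n 2 \<subseteq> T"
  proof
    fix x assume "x \<in> const_elem m n 2 ` cells m n 2"
    then obtain g \<beta> where "g \<in> carrier (Gm1n m n)" "\<beta> \<subseteq> {..<2 * n}" "card \<beta> = 2"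
      "x = cochain_elem m n 2 \<one>\<^bsub>Sq n\<^esub> g \<beta>" by auto
    then show "x \<in> T"
      unfolding T_def cochain_elem_def using wedge_set_ext_power by blast
  qed
  then have "?X \<subseteq> V.span T" by (rule V.span_is_monotone)
  ultimately show ?thesis unfolding const_cochains_def T_def by blast
qed

lemma gtens_const_elem: "i < j \<Longrightarrow> gtens m n g i j = const_elem m n 2 (g, {i, j})"
  by (simp add: gtens_def cochain_elem_def)

text \<open>
  The coefficient of \<open>v_k g\<close> tensored with the product over \<open>\<beta> \<union> {i}\<close> in the differential of \<open>g\<close>
  tensored with the product over \<open>\<beta>\<close>, for \<open>i \<notin> \<beta>\<close>.
\<close>

definition koszul_weight :: "nat \<Rightarrow> complex mat \<Rightarrow> nat set \<Rightarrow> nat \<Rightarrow> nat \<Rightarrow> complex" where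
  "koszul_weight n g \<beta> i k = (- 1) ^ card {s \<in> \<beta>. s \<le> i} *
     ((\<Prod>s\<in>{s \<in> \<beta>. s \<le> i}. qpar n s i) * (if k = i then 1 else 0) -
      (\<Prod>s\<in>{s \<in> \<beta>. i \<le> s}. qpar n i s) * act_coeff n g k i)"

lemma koszul_coeff_one:
  assumes i: "i < 2 * n"
  shows "koszul_coeff n g \<beta> i \<one>\<^bsub>Sq n\<^esub> =
    (\<Prod>s\<in>{s \<in> \<beta>. s \<le> i}. qpar n s i) \<odot>\<^bsub>Sq n\<^esub> Sq_gen n i
      \<ominus>\<^bsub>Sq n\<^esub> (\<Prod>s\<in>{s \<in> \<beta>. i \<le> s}. qpar n i s) \<odot>\<^bsub>Sq n\<^esub> act_gen n g i"
  using rel_algebra_one_mult[of _ "2 * n" "qpar n"] vgen_closed[OF i, of "qpar n"] act_gen_closed[of n g i]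
  by (simp add: koszul_coeff_def qsym_rel(1))

lemma linear_coord_act_gen:
  assumes "k < 2 * n"
  shows "sym_coord (2 * n) (qpar n) [k] (act_gen n g i) = act_coeff n g k i"
proof -
  have lin: "sym_coord (2 * n) (qpar n) [k] \<in> lin (Sq n) Cmod" by (rule sym_coord(1)) simp
  have "sym_coord (2 * n) (qpar n) [k] (act_gen n g i) = (\<Sum>l<2 * n. act_coeff n g l i * (if k = l then 1 else 0))"
    unfolding act_gen_def
    by (subst lin_finsum[OF cmodule_Sq cmodule_Cmod lin])
      (auto simp: cmoduleD(6)[OF cmodule_Sq] vgen_closed linD(3)[OF lin] sym_coord(3) intro!: sum.cong)
  then show ?thesis using assms by (simp add: if_distrib cong: if_cong)
qed

lemma linear_coord_koszul_coeff:
  assumes "i < 2 * n" "k < 2 * n"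
  shows "(- 1) ^ card {s \<in> \<beta>. s \<le> i} * sym_coord (2 * n) (qpar n) [k] (koszul_coeff n g \<beta> i \<one>\<^bsub>Sq n\<^esub>)
    = koszul_weight n g \<beta> i k"
proof -
  have lin: "sym_coord (2 * n) (qpar n) [k] \<in> lin (Sq n) Cmod" by (rule sym_coord(1)) simp
  have minus: "x \<ominus>\<^bsub>Cmod\<^esub> y = x - y" for x y using cmoduleD(13)[OF cmodule_Cmod] by simp
  show ?thesis
    unfolding koszul_coeff_one[OF assms(1)] koszul_weight_def using assms
    by (simp add: lin_minus[OF cmodule_Sq cmodule_Cmod lin] linD(3)[OF lin] cmoduleD(6)[OF cmodule_Sq]
        vgen_closed act_gen_closed minus linear_coord_act_gen sym_coord(3))
qed

text \<open>
  The product over \<open>\<gamma>\<close> arises exactly from the products over \<open>\<gamma> - {i}\<close> with \<open>i \<in> \<gamma>\<close>.  Both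
  sides are linear in \<open>c\<close>, so it suffices to compare them on the basis of the constant cochains.
\<close>

lemma coord_differential:
  assumes c: "c \<in> const_cochains m n 2" and g: "g \<in> carrier (Gm1n m n)"
    and \<gamma>: "\<gamma> \<subseteq> {..<2 * n}" and k: "k < 2 * n"
  shows "coord m n 3 [k] g \<gamma> (differential m n 3 c) =
    (\<Sum>i\<in>\<gamma>. koszul_weight n g (\<gamma> - {i}) i k * coord m n 2 [] g (\<gamma> - {i}) c)"
proof -
  interpret dual_family "cochains m n 2" "cells m n 2" "const_elem m n 2" "const_coord m n 2"
    by (rule const_dual)
  have fin: "finite \<gamma>" using \<gamma> finite_subset by blast
  have d: "differential m n 3 \<in> lin (cochains m n 2) (cochains m n 3)"
    using differential(1)[of 3] by simp
  have lin1: "(\<lambda>c. coord m n 3 [k] g \<gamma> (differential m n 3 c)) \<in> lin (cochains m n 2) Cmod"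
    by (rule lin_comp[OF d coord(1)]) (use g in auto)
  have "(\<lambda>c. \<Oplus>\<^bsub>Cmod\<^esub>i\<in>\<gamma>. koszul_weight n g (\<gamma> - {i}) i k \<odot>\<^bsub>Cmod\<^esub> coord m n 2 [] g (\<gamma> - {i}) c)
      \<in> lin (cochains m n 2) Cmod"
    by (intro lin_sum lin_scale cmodule_cochains cmodule_Cmod coord(1) g) simp
  then have lin2: "(\<lambda>c. \<Sum>i\<in>\<gamma>. koszul_weight n g (\<gamma> - {i}) i k * coord m n 2 [] g (\<gamma> - {i}) c)
      \<in> lin (cochains m n 2) Cmod" by simp
  show ?thesis
  proof (rule lin_eq_on_span[OF cmodule_cochains cmodule_Cmod lin1 lin2 E_subset])
    show "c \<in> V.span (const_elem m n 2 ` cells m n 2)" using c by (simp add: const_cochains_span)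
  next
    fix x assume "x \<in> const_elem m n 2 ` cells m n 2"
    then obtain h \<beta> where h: "h \<in> carrier (Gm1n m n)" and \<beta>: "\<beta> \<subseteq> {..<2 * n}" "card \<beta> = 2"
      and x: "x = cochain_elem m n 2 \<one>\<^bsub>Sq n\<^esub> h \<beta>" by auto
    have fin\<beta>: "finite \<beta>" using \<beta> finite_subset by blast
    let ?N = "2 * n"
    let ?t = "\<lambda>i. cochain_elem m n 3 (koszul_coeff n h \<beta> i \<one>\<^bsub>Sq n\<^esub>) h (insert i \<beta>)"
    have kc: "koszul_coeff n h \<beta> i \<one>\<^bsub>Sq n\<^esub> \<in> carrier (Sq n)" if "i < ?N" for i
      by (rule linD(1)[OF koszul_coeff_lin[OF that] one_qsym_closed])
    have ins: "insert i \<beta> \<subseteq> {..<?N}" "card (insert i \<beta>) = 3" if "i \<in> {..<?N} - \<beta>" for i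
      using that \<beta> fin\<beta> by auto
    have t: "?t i \<in> carrier (cochains m n 3)" if "i \<in> {..<?N} - \<beta>" for i
      using that by (intro linD(1)[OF cochain_elem_lin[OF ins] kc]) auto
    have co: "coord m n 3 [k] g \<gamma> \<in> lin (cochains m n 3) Cmod" by (rule coord(1)) (use g in auto)
    have "coord m n 3 [k] g \<gamma> (differential m n 3 x) =
        coord m n 3 [k] g \<gamma> (\<Oplus>\<^bsub>cochains m n 3\<^esub>i\<in>{..<?N} - \<beta>.
          (- 1) ^ card {s \<in> \<beta>. s \<le> i} \<odot>\<^bsub>cochains m n 3\<^esub> ?t i)"
      unfolding x using differential(2)[of 3 "\<one>\<^bsub>Sq n\<^esub>" n h m \<beta>] one_qsym_closed h \<beta> by simp
    also have "\<dots> = (\<Sum>i\<in>{..<?N} - \<beta>. (- 1) ^ card {s \<in> \<beta>. s \<le> i} * coord m n 3 [k] g \<gamma> (?t i))"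
      using t by (subst lin_finsum[OF cmodule_cochains cmodule_Cmod co])
        (auto simp: cmoduleD(6)[OF cmodule_cochains] linD(3)[OF co] intro!: sum.cong)
    also have "\<dots> = (\<Sum>i\<in>{..<?N} - \<beta>. if g = h \<and> insert i \<beta> = \<gamma> then koszul_weight n h \<beta> i k else 0)"
    proof (rule sum.cong[OF refl])
      fix i assume i: "i \<in> {..<?N} - \<beta>"
      then have "coord m n 3 [k] g \<gamma> (?t i) = (if g = h \<and> insert i \<beta> = \<gamma>
          then sym_coord ?N (qpar n) [k] (koszul_coeff n h \<beta> i \<one>\<^bsub>Sq n\<^esub>) else 0)"
        using ins[OF i] g by (intro coord(2)[OF _ _ kc]) auto
      then show "(- 1) ^ card {s \<in> \<beta>. s \<le> i} * coord m n 3 [k] g \<gamma> (?t i) =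
          (if g = h \<and> insert i \<beta> = \<gamma> then koszul_weight n h \<beta> i k else 0)"
        using linear_coord_koszul_coeff[of i n k \<beta> h] i k by auto
    qed
    also have "\<dots> = (\<Sum>i\<in>{i \<in> {..<?N} - \<beta>. g = h \<and> insert i \<beta> = \<gamma>}. koszul_weight n h \<beta> i k)"
      by (rule sum.inter_filter[symmetric]) simp
    also have "{i \<in> {..<?N} - \<beta>. g = h \<and> insert i \<beta> = \<gamma>} = {i \<in> \<gamma>. g = h \<and> \<beta> = \<gamma> - {i}}"
      using \<gamma> by auto
    also have "(\<Sum>i\<in>{i \<in> \<gamma>. g = h \<and> \<beta> = \<gamma> - {i}}. koszul_weight n h \<beta> i k) =
        (\<Sum>i\<in>\<gamma>. if g = h \<and> \<beta> = \<gamma> - {i} then koszul_weight n h \<beta> i k else 0)"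
      by (rule sum.inter_filter) (rule fin)
    also have "\<dots> = (\<Sum>i\<in>\<gamma>. koszul_weight n g (\<gamma> - {i}) i k * coord m n 2 [] g (\<gamma> - {i}) x)"
      unfolding x by (intro sum.cong refl, subst coord(2)[OF _ g one_qsym_closed \<beta>])
        (auto simp: sym_coord(2))
    finally show "coord m n 3 [k] g \<gamma> (differential m n 3 x) =
        (\<Sum>i\<in>\<gamma>. koszul_weight n g (\<gamma> - {i}) i k * coord m n 2 [] g (\<gamma> - {i}) x)" .
  qed
qed

abbreviation linear_elem :: "nat \<Rightarrow> nat \<Rightarrow> nat \<Rightarrow> nat \<times> complex mat \<times> nat set \<Rightarrow> cochain" where
  "linear_elem m n k \<equiv> \<lambda>(l, g, \<beta>). cochain_elem m n k (Sq_gen n l) g \<beta>"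

abbreviation linear_coord :: "nat \<Rightarrow> nat \<Rightarrow> nat \<Rightarrow> nat \<times> complex mat \<times> nat set \<Rightarrow> cochain \<Rightarrow> complex" where
  "linear_coord m n k \<equiv> \<lambda>(l, g, \<beta>). coord m n k [l] g \<beta>"

lemma linear_dual:
  "dual_family (cochains m n k) ({..<2 * n} \<times> cells m n k) (linear_elem m n k) (linear_coord m n k)"
proof (rule dual_family.intro[OF cmodule_cochains])
  show "linear_elem m n k i \<in> carrier (cochains m n k)" if "i \<in> {..<2 * n} \<times> cells m n k" for i
    using that linD(1)[OF cochain_elem_lin vgen_closed] by auto
  show "linear_coord m n k i \<in> lin (cochains m n k) Cmod" if "i \<in> {..<2 * n} \<times> cells m n k" for i
    using that coord(1) by auto
  show "linear_coord m n k i (linear_elem m n k j) = (if i = j then 1 else 0)"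
    if "i \<in> {..<2 * n} \<times> cells m n k" "j \<in> {..<2 * n} \<times> cells m n k" for i j
    using that by (auto simp: coord(2)[OF _ _ vgen_closed] sym_coord(3) split: if_splits)
qed

text \<open>
  This makes the coordinates in degree one decisive: by \<open>linear_dual\<close>, an element of this span vanishes
  as soon as they do.
\<close>

lemma differential_const_in_linear_span:
  assumes c: "c \<in> const_cochains m n 2"
  shows "differential m n 3 c \<in> LinearCombinations.module.span CC (cochains m n 3)
    (linear_elem m n 3 ` ({..<2 * n} \<times> cells m n 3))"
proof -
  interpret C: dual_family "cochains m n 2" "cells m n 2" "const_elem m n 2" "const_coord m n 2"
    by (rule const_dual)
  interpret L: dual_family "cochains m n 3" "{..<2 * n} \<times> cells m n 3" "linear_elem m n 3" "linear_coord m n 3"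
    by (rule linear_dual)
  let ?N = "2 * n" and ?Z = "cochains m n 3"
  let ?X = "L.V.span (linear_elem m n 3 ` ({..<?N} \<times> cells m n 3))"
  have X: "LinearCombinations.submodule CC ?X ?Z" by (rule L.V.span_is_submodule[OF L.E_subset])
  then have Xc: "?X \<subseteq> carrier ?Z" "\<zero>\<^bsub>?Z\<^esub> \<in> ?X" "\<And>x y. x \<in> ?X \<Longrightarrow> y \<in> ?X \<Longrightarrow> x \<oplus>\<^bsub>?Z\<^esub> y \<in> ?X"
    "\<And>c x. x \<in> ?X \<Longrightarrow> c \<odot>\<^bsub>?Z\<^esub> x \<in> ?X"
    by (auto simp: LinearCombinations.submodule_def)
  have sum: "finsum ?Z f A \<in> ?X" if "\<And>i. i \<in> A \<Longrightarrow> f i \<in> ?X" for f and A :: "nat set"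
    using that
  proof (induction A rule: infinite_finite_induct)
    case (insert i A)
    then have "f \<in> A \<rightarrow> carrier ?Z" "f i \<in> carrier ?Z" using Xc(1) by auto
    then show ?case using insert Xc(3) by simp
  qed (use Xc(2) in auto)
  have d: "differential m n 3 \<in> lin (cochains m n 2) ?Z"
    using differential(1)[of 3] by simp
  show ?thesis
  proof (rule lin_span_image[OF cmodule_cochains cmodule_cochains d C.E_subset L.E_subset])
    show "c \<in> C.V.span (const_elem m n 2 ` cells m n 2)" using c by (simp add: const_cochains_span)
  next
    fix x assume "x \<in> const_elem m n 2 ` cells m n 2"
    then obtain h \<beta> where h: "h \<in> carrier (Gm1n m n)" and \<beta>: "\<beta> \<subseteq> {..<2 * n}" "card \<beta> = 2"
      and x: "x = cochain_elem m n 2 \<one>\<^bsub>Sq n\<^esub> h \<beta>" by auto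
    have fin\<beta>: "finite \<beta>" using \<beta> finite_subset by blast
    have "cochain_elem m n 3 (koszul_coeff n h \<beta> i \<one>\<^bsub>Sq n\<^esub>) h (insert i \<beta>) \<in> ?X" if i: "i \<in> {..<?N} - \<beta>" for i
    proof -
      have ins: "insert i \<beta> \<subseteq> {..<?N}" "card (insert i \<beta>) = 3" using i \<beta> fin\<beta> by auto
      note lin = cochain_elem_lin[OF ins, of m h]
      have gen: "cochain_elem m n 3 (Sq_gen n l) h (insert i \<beta>) \<in> ?X" if "l < ?N" for l
        using L.V.in_own_span[OF L.E_subset] that h ins by (force simp: image_iff subset_iff)
      have "cochain_elem m n 3 (act_gen n h i) h (insert i \<beta>) =
          (\<Oplus>\<^bsub>?Z\<^esub>l\<in>{..<?N}. act_coeff n h l i \<odot>\<^bsub>?Z\<^esub> cochain_elem m n 3 (Sq_gen n l) h (insert i \<beta>))"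
        unfolding act_gen_def
      proof (subst lin_finsum[OF cmodule_Sq cmodule_cochains lin])
        show "(\<Oplus>\<^bsub>?Z\<^esub>l\<in>{..<?N}. cochain_elem m n 3 (act_coeff n h l i \<odot>\<^bsub>Sq n\<^esub> Sq_gen n l) h (insert i \<beta>)) =
          (\<Oplus>\<^bsub>?Z\<^esub>l\<in>{..<?N}. act_coeff n h l i \<odot>\<^bsub>?Z\<^esub> cochain_elem m n 3 (Sq_gen n l) h (insert i \<beta>))"
          using subsetD[OF Xc(1)] Xc(4)[OF gen]
          by (intro L.V.finsum_cong') (simp_all add: linD(3)[OF lin] vgen_closed)
      qed (simp add: cmoduleD(6)[OF cmodule_Sq] vgen_closed)
      also have "\<dots> \<in> ?X" using gen Xc(4) by (intro sum) auto
      finally have actX: "cochain_elem m n 3 (act_gen n h i) h (insert i \<beta>) \<in> ?X" .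
      have "cochain_elem m n 3 (koszul_coeff n h \<beta> i \<one>\<^bsub>Sq n\<^esub>) h (insert i \<beta>) =
        (\<Prod>s\<in>{s \<in> \<beta>. s \<le> i}. qpar n s i) \<odot>\<^bsub>?Z\<^esub> cochain_elem m n 3 (Sq_gen n i) h (insert i \<beta>) \<oplus>\<^bsub>?Z\<^esub>
        (- 1) \<odot>\<^bsub>?Z\<^esub> ((\<Prod>s\<in>{s \<in> \<beta>. i \<le> s}. qpar n i s) \<odot>\<^bsub>?Z\<^esub> cochain_elem m n 3 (act_gen n h i) h (insert i \<beta>))"
        using i by (simp add: koszul_coeff_one lin_minus[OF cmodule_Sq cmodule_cochains lin] linD[OF lin]
          cmoduleD(6)[OF cmodule_Sq] cmoduleD(6,13)[OF cmodule_cochains] vgen_closed act_gen_closed)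
      then show ?thesis using gen[of i] i actX Xc(3,4) by simp
    qed
    then have "(\<Oplus>\<^bsub>?Z\<^esub>i\<in>{..<?N} - \<beta>. (- 1) ^ card {s \<in> \<beta>. s \<le> i} \<odot>\<^bsub>?Z\<^esub>
          cochain_elem m n 3 (koszul_coeff n h \<beta> i \<one>\<^bsub>Sq n\<^esub>) h (insert i \<beta>)) \<in> ?X"
      using Xc(4) by (intro sum) auto
    then show "differential m n 3 x \<in> ?X"
      unfolding x using differential(2)[of 3 "\<one>\<^bsub>Sq n\<^esub>" n h m \<beta>] one_qsym_closed h \<beta> by simp
  qed
qed

definition cocycle_eqs :: "nat \<Rightarrow> complex mat \<Rightarrow> (nat set \<Rightarrow> complex) \<Rightarrow> bool" where
  "cocycle_eqs n g C \<longleftrightarrow> (\<forall>\<gamma> k. \<gamma> \<subseteq> {..<2 * n} \<longrightarrow> card \<gamma> = 3 \<longrightarrow> k < 2 * n \<longrightarrow>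
     (\<Sum>i\<in>\<gamma>. koszul_weight n g (\<gamma> - {i}) i k * C (\<gamma> - {i})) = 0)"

lemma differential_eq_zero_iff:
  assumes c: "c \<in> const_cochains m n 2"
  shows "differential m n 3 c = \<zero>\<^bsub>cochains m n 3\<^esub> \<longleftrightarrow>
    (\<forall>g\<in>carrier (Gm1n m n). cocycle_eqs n g (\<lambda>\<beta>. coord m n 2 [] g \<beta> c))"
proof
  assume *: "differential m n 3 c = \<zero>\<^bsub>cochains m n 3\<^esub>"
  show "\<forall>g\<in>carrier (Gm1n m n). cocycle_eqs n g (\<lambda>\<beta>. coord m n 2 [] g \<beta> c)"
    unfolding cocycle_eqs_def
  proof (intro ballI allI impI)
    fix g \<gamma> k assume "g \<in> carrier (Gm1n m n)" "\<gamma> \<subseteq> {..<2 * n}" "k < 2 * n"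
    then show "(\<Sum>i\<in>\<gamma>. koszul_weight n g (\<gamma> - {i}) i k * coord m n 2 [] g (\<gamma> - {i}) c) = 0"
      using lin_zero[OF cmodule_cochains cmodule_Cmod coord(1)[of "[k]" g m n 3 \<gamma>]]
      by (subst coord_differential[OF c, symmetric]) (auto simp: *)
  qed
next
  assume *: "\<forall>g\<in>carrier (Gm1n m n). cocycle_eqs n g (\<lambda>\<beta>. coord m n 2 [] g \<beta> c)"
  show "differential m n 3 c = \<zero>\<^bsub>cochains m n 3\<^esub>"
    by (rule dual_family.eq_zero[OF linear_dual differential_const_in_linear_span[OF c]])
      (use * in \<open>auto simp: coord_differential[OF c] cocycle_eqs_def\<close>)
qed

section \<open>Solving the cocycle equations\<close>

text \<open>
  The factor for moving \<open>v_a*\<close> past \<open>v_s*\<close> to its place in increasing order.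
\<close>

definition swap_sign :: "nat \<Rightarrow> nat \<Rightarrow> nat \<Rightarrow> complex" where
  "swap_sign n s a = (if s \<le> a then - qpar n s a else 1)"

text \<open>
  The product over the larger indices in the second term of the differential is the product over the
  smaller ones times the product over all, because the parameters are signs.  So the factor for
  ordering can be taken out, and the rest is symmetric in \<open>b\<close> and \<open>e\<close>.
\<close>

lemma koszul_weight_pair:
  assumes "a \<noteq> b" "a \<noteq> e" "b \<noteq> e"
  shows "koszul_weight n g {b, e} a k =
    swap_sign n b a * swap_sign n e a *
      ((if k = a then 1 else 0) - qpar n b a * qpar n e a * act_coeff n g k a)"
proof -
  have low: "{s \<in> {b, e}. s \<le> a} = (if b \<le> a then {b} else {}) \<union> (if e \<le> a then {e} else {})"
    and high: "{s \<in> {b, e}. a \<le> s} = (if a \<le> b then {b} else {}) \<union> (if a \<le> e then {e} else {})"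
    by auto
  have sym: "qpar n a b = qpar n b a" "qpar n a e = qpar n e a" by (auto simp: qpar_def)
  have sq: "qpar n b a * (qpar n b a * z) = z" "qpar n e a * (qpar n e a * z) = z" for z
    by (auto simp: qpar_def)
  show ?thesis
    unfolding koszul_weight_def low high using assms
    by (cases "b \<le> a"; cases "e \<le> a") (auto simp: swap_sign_def sym sq algebra_simps)
qed

definition triple_eq :: "nat \<Rightarrow> complex mat \<Rightarrow> (nat set \<Rightarrow> complex) \<Rightarrow> nat \<Rightarrow> nat \<Rightarrow> nat \<Rightarrow> nat \<Rightarrow> bool" where
  "triple_eq n g C a b e k \<longleftrightarrow> koszul_weight n g {b, e} a k * C {b, e} +
     koszul_weight n g {a, e} b k * C {a, e} + koszul_weight n g {a, b} e k * C {a, b} = 0"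

lemma triple_sum:
  assumes "a \<noteq> b" "a \<noteq> e" "b \<noteq> e"
  shows "(\<Sum>i\<in>{a, b, e}. koszul_weight n g ({a, b, e} - {i}) i k * C ({a, b, e} - {i})) = 0 \<longleftrightarrow>
    triple_eq n g C a b e k"
proof -
  have "{a, b, e} - {a} = {b, e}" "{a, b, e} - {b} = {a, e}" "{a, b, e} - {e} = {a, b}"
    using assms by auto
  then show ?thesis using assms by (simp add: triple_eq_def add.assoc)
qed

lemma cocycle_eqsD:
  assumes "cocycle_eqs n g C" "a \<noteq> b" "a \<noteq> e" "b \<noteq> e" "a < 2 * n" "b < 2 * n" "e < 2 * n" "k < 2 * n"
  shows "triple_eq n g C a b e k"
proof -
  have "{a, b, e} \<subseteq> {..<2 * n}" "card {a, b, e} = 3" using assms by auto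
  then show ?thesis using assms triple_sum[OF assms(2-4), of n g k C] unfolding cocycle_eqs_def by blast
qed

text \<open>
  A monomial matrix given with its permutation: column \<open>j\<close> has its nonzero entry in row \<open>p j\<close>.
\<close>

locale monomial =
  fixes n :: nat and g :: "complex mat" and p :: "nat \<Rightarrow> nat"
  assumes p_less: "j < n \<Longrightarrow> p j < n" and inj_p: "inj_on p {..<n}"
    and entry_nz: "k < n \<Longrightarrow> j < n \<Longrightarrow> g $$ (k, j) \<noteq> 0 \<longleftrightarrow> k = p j"
begin

text \<open>
  The permutation of all \<open>2n\<close> lines spanned by the \<open>x_i\<close> and the \<open>y_i\<close>, and the scalars by which \<open>g\<close>
  acts between them; those on the \<open>y_i\<close> are inverse to those on the \<open>x_i\<close>.
\<close>

definition dperm :: "nat \<Rightarrow> nat" where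
  "dperm i = (if i < n then p i else n + p (i - n))"

definition lam :: "nat \<Rightarrow> complex" where
  "lam i = (if i < n then g $$ (p i, i) else inverse (g $$ (p (i - n), i - n)))"

lemma dperm_less: "i < 2 * n \<Longrightarrow> dperm i < 2 * n"
  using p_less[of i] p_less[of "i - n"] by (auto simp: dperm_def)

lemma dperm_side: "i < 2 * n \<Longrightarrow> dperm i < n \<longleftrightarrow> i < n"
  using p_less[of i] by (auto simp: dperm_def)

lemma dperm_inj:
  assumes "i < 2 * n" "j < 2 * n"
  shows "dperm i = dperm j \<longleftrightarrow> i = j"
proof
  note ij = assms
  assume eq: "dperm i = dperm j"
  with ij have side: "i < n \<longleftrightarrow> j < n" using dperm_side by metis
  show "i = j"
  proof (cases "i < n")
    case True
    then show ?thesis using eq side inj_onD[OF inj_p, of i j] by (simp add: dperm_def)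
  next
    case False
    then have "i - n < n" "j - n < n" using ij by linarith+
    then have "i - n = j - n"
      using eq side False inj_onD[OF inj_p, of "i - n" "j - n"] by (simp add: dperm_def)
    then show ?thesis using side False by linarith
  qed
qed simp

lemma lam_nz: "i < 2 * n \<Longrightarrow> lam i \<noteq> 0"
  using entry_nz[OF p_less[of i], of i] entry_nz[OF p_less[of "i - n"], of "i - n"]
  by (cases "i < n") (simp_all add: lam_def)

lemma act_coeff:
  assumes "k < 2 * n" "i < 2 * n"
  shows "act_coeff n g k i = (if k = dperm i then lam i else 0)"
proof (cases "i < n")
  case True
  then show ?thesis
    using entry_nz[of k i] p_less[of i] assms by (cases "k < n") (auto simp: act_coeff_def dperm_def lam_def)
next
  case False
  then have i: "i - n < n" using assms by linarith
  show ?thesis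
  proof (cases "k < n")
    case True
    then show ?thesis using False assms by (simp add: act_coeff_def dperm_def)
  next
    case k: False
    then have "k - n < n" "k = n + p (i - n) \<longleftrightarrow> k - n = p (i - n)" using assms by linarith+
    then show ?thesis
      using False k i entry_nz[of "k - n" "i - n"] p_less[OF i] assms
      by (auto simp: act_coeff_def dperm_def lam_def)
  qed
qed

lemma swap_sign_nz: "swap_sign n s a \<noteq> 0"
  by (auto simp: swap_sign_def qpar_def)

lemma qpar_nz: "qpar n s a \<noteq> 0"
  by (auto simp: qpar_def)

text \<open>
  In the coefficient of \<open>v_a\<close> at \<open>{a, b, e}\<close> the terms of \<open>v_b\<close>, \<open>v_e\<close> and their images do not occur,
  since \<open>g\<close> permutes lines and fixes that of \<open>v_a\<close>.
\<close>

lemma support_fixed: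
  assumes C: "cocycle_eqs n g C" "C {b, e} \<noteq> 0" and ne: "b \<noteq> e" "a \<noteq> b" "a \<noteq> e"
    and lt: "a < 2 * n" "b < 2 * n" "e < 2 * n" and fixed: "dperm a = a"
  shows "qpar n b a * qpar n e a * lam a = 1"
proof -
  have "a \<noteq> dperm b" "a \<noteq> dperm e" using fixed ne lt dperm_inj[of a b] dperm_inj[of a e] by auto
  then have "swap_sign n b a * swap_sign n e a * (1 - qpar n b a * qpar n e a * lam a) * C {b, e} = 0"
    using cocycle_eqsD[OF C(1) ne(2,3,1) lt lt(1)] ne lt fixed
    by (simp add: triple_eq_def koszul_weight_pair act_coeff)
  then show ?thesis using C(2) swap_sign_nz by simp
qed

text \<open>
  If one of the two conclusions failed, then the coefficient of the image of \<open>v_a\<close>, respectively of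
  \<open>v_a\<close> itself, at \<open>{a, b, e}\<close> would be a nonzero multiple of \<open>C {b, e}\<close> alone.
\<close>

lemma support_moved:
  assumes C: "cocycle_eqs n g C" "C {b, e} \<noteq> 0" and ne: "b \<noteq> e" "a \<noteq> b" "a \<noteq> e"
    and lt: "a < 2 * n" "b < 2 * n" "e < 2 * n" and moved: "dperm a \<noteq> a"
  shows "dperm a \<in> {b, e}" and "a \<in> {dperm b, dperm e}"
proof -
  note eq = cocycle_eqsD[OF C(1) ne(2,3,1) lt]
  show "dperm a \<in> {b, e}"
  proof (rule ccontr)
    assume *: "dperm a \<notin> {b, e}"
    have "dperm a \<noteq> dperm b" "dperm a \<noteq> dperm e" using ne lt dperm_inj[of a b] dperm_inj[of a e] by auto
    then have "swap_sign n b a * swap_sign n e a * (qpar n b a * qpar n e a * lam a) * C {b, e} = 0"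
      using eq[OF dperm_less[OF lt(1)]] ne lt * moved dperm_less[OF lt(1)]
      by (simp add: triple_eq_def koszul_weight_pair act_coeff)
    then show False using C(2) swap_sign_nz qpar_nz lam_nz[OF lt(1)] by simp
  qed
  show "a \<in> {dperm b, dperm e}"
  proof (rule ccontr)
    assume "a \<notin> {dperm b, dperm e}"
    then have "swap_sign n b a * swap_sign n e a * C {b, e} = 0"
      using eq[OF lt(1)] ne lt moved
      by (auto simp: triple_eq_def koszul_weight_pair act_coeff)
    then show False using C(2) swap_sign_nz by simp
  qed
qed

end

lemma monomial_ex:
  assumes g: "g \<in> carrier (Gm1n m n)"
  shows "\<exists>p. monomial n g p"
proof -
  have col: "\<forall>j<n. \<exists>!i. i < n \<and> g $$ (i, j) \<noteq> 0" and row: "\<forall>i<n. \<exists>!j. j < n \<and> g $$ (i, j) \<noteq> 0"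
    using g by (auto simp: Gm1n_def)
  define p where "p j = (THE i. i < n \<and> g $$ (i, j) \<noteq> 0)" for j
  have p: "p j < n" "g $$ (p j, j) \<noteq> 0" if "j < n" for j
    using theI'[OF col[rule_format, OF that]] by (auto simp: p_def)
  have "monomial n g p"
  proof
    show "inj_on p {..<n}"
    proof (rule inj_onI)
      fix i j assume "i \<in> {..<n}" "j \<in> {..<n}" "p i = p j"
      then show "i = j" using p[of i] p[of j] row by (metis lessThan_iff)
    qed
    show "g $$ (k, j) \<noteq> 0 \<longleftrightarrow> k = p j" if "k < n" "j < n" for k j
      using p[of j] col that by blast
  qed (use p in auto)
  then show ?thesis by blast
qed

lemma Gm1n_entry_root:
  "g \<in> carrier (Gm1n m n) \<Longrightarrow> i < n \<Longrightarrow> j < n \<Longrightarrow> g $$ (i, j) \<noteq> 0 \<Longrightarrow> g $$ (i, j) ^ m = 1"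
  by (simp add: Gm1n_def)

lemma Gm1n_dim: "g \<in> carrier (Gm1n m n) \<Longrightarrow> g \<in> carrier_mat n n"
  by (simp add: Gm1n_def)

subsection \<open>The reflections and the elements sigma as matrices\<close>

lemma trefl_entry: "k < n \<Longrightarrow> i < n \<Longrightarrow> trefl n r c $$ (k, i) = (if k = i then if i = r then c else 1 else 0)"
  by (simp add: trefl_def)

lemma trefl_mult_entry:
  assumes "k < n" "i < n"
  shows "(trefl n r c * trefl n s d) $$ (k, i) =
    (if k = i then (if i = r then c else 1) * (if i = s then d else 1) else 0)"
proof -
  have "(trefl n r c * trefl n s d) $$ (k, i) =
      (\<Sum>l<n. (if k = l then if l = r then c else 1 else 0) * (if l = i then if i = s then d else 1 else 0))"
    using assms by (simp add: trefl_def scalar_prod_def atLeast0LessThan)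
  also have "\<dots> = (\<Sum>l<n. if l = k then (if k = r then c else 1) * (if k = i then if i = s then d else 1 else 0) else 0)"
    by (intro sum.cong) auto
  also have "\<dots> = (if k = i then (if i = r then c else 1) * (if i = s then d else 1) else 0)"
    using assms by simp
  finally show ?thesis .
qed

lemma sgm_entry: "k < n \<Longrightarrow> i < n \<Longrightarrow> sgm n r s \<xi> $$ (k, i) =
    (if i = r then (if k = s then \<xi> else 0)
     else if i = s then (if k = r then - inverse \<xi> else 0)
     else if k = i then 1 else 0)"
  by (simp add: sgm_def)

lemma trefl_dim: "trefl n r c \<in> carrier_mat n n" "trefl n r c * trefl n s d \<in> carrier_mat n n"
  "sgm n r s \<xi> \<in> carrier_mat n n"
  by (auto simp: trefl_def sgm_def)

lemma diagonal_mem: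
  assumes "g \<in> carrier_mat n n" "\<And>k i. k < n \<Longrightarrow> i < n \<Longrightarrow> g $$ (k, i) = (if k = i then d i else 0)"
    "\<And>i. i < n \<Longrightarrow> d i \<noteq> 0 \<and> d i ^ m = 1"
  shows "g \<in> carrier (Gm1n m n)"
  using assms by (auto simp: Gm1n_def split: if_splits)

lemma root_nz: "m > 0 \<Longrightarrow> (c :: complex) ^ m = 1 \<Longrightarrow> c \<noteq> 0"
  by (auto simp: zero_power)

lemma trefl_mem: "m > 0 \<Longrightarrow> c ^ m = 1 \<Longrightarrow> trefl n r c \<in> carrier (Gm1n m n)"
  by (rule diagonal_mem[where d = "\<lambda>i. if i = r then c else 1"])
    (auto simp: trefl_dim trefl_entry root_nz)

lemma trefl_mult_mem:
  "even m \<Longrightarrow> r \<noteq> s \<Longrightarrow> trefl n r (- 1) * trefl n s (- 1) \<in> carrier (Gm1n m n)"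
  by (rule diagonal_mem[where d = "\<lambda>i. (if i = r then - 1 else 1) * (if i = s then - 1 else 1)"])
    (auto simp: trefl_dim trefl_mult_entry simp del: carrier_mat_triv)

lemma sgm_mem:
  assumes "even m" "m > 0" "r < n" "s < n" "r \<noteq> s" "\<xi> ^ m = 1"
  shows "sgm n r s \<xi> \<in> carrier (Gm1n m n)"
proof -
  have xi: "\<xi> \<noteq> 0" using root_nz assms by blast
  have root: "(- inverse \<xi>) ^ m = 1" using assms by (simp add: power_minus_even power_inverse)
  let ?t = "\<lambda>i. if i = r then s else if i = s then r else i"
  have nz: "sgm n r s \<xi> $$ (k, i) \<noteq> 0 \<longleftrightarrow> k = ?t i" if "k < n" "i < n" for k i
    using that xi assms(5) by (auto simp: sgm_entry)
  have t: "?t i < n" "?t (?t i) = i" if "i < n" for i using that assms by auto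
  have "\<exists>!j. j < n \<and> sgm n r s \<xi> $$ (i, j) \<noteq> 0" if "i < n" for i
    by (rule ex1I[of _ "?t i"]) (use nz t that in \<open>auto split: if_splits\<close>)
  moreover have "\<exists>!i. i < n \<and> sgm n r s \<xi> $$ (i, j) \<noteq> 0" if "j < n" for j
    by (rule ex1I[of _ "?t j"]) (use nz t that in \<open>auto split: if_splits\<close>)
  moreover have "sgm n r s \<xi> $$ (i, j) ^ m = 1" if "i < n" "j < n" "sgm n r s \<xi> $$ (i, j) \<noteq> 0" for i j
    using that root assms(6) by (auto simp: sgm_entry split: if_splits)
  ultimately show ?thesis by (auto simp: Gm1n_def trefl_dim)
qed

lemma qpar_values:
  assumes "i < n" "j < n"
  shows "qpar n i j = (if i = j then 1 else - 1)" "qpar n (n + i) j = (if i = j then 1 else - 1)"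
    "qpar n i (n + j) = (if i = j then 1 else - 1)" "qpar n (n + i) (n + j) = (if i = j then 1 else - 1)"
  using assms by (simp_all add: qpar_def)

text \<open>
  Names for the listed cochains, one constructor for each family in their order.  A label carries its
  group element, a distinguished pair of indices, and the coordinates of its cochain at
  that group element.
\<close>

datatype label = XX nat nat | YY nat nat | XY nat nat | Refl nat complex | Sig nat nat complex

definition labels :: "nat \<Rightarrow> nat \<Rightarrow> label set" where
  "labels m n = {XX r s | r s. r < s \<and> s < n} \<union> {YY r s | r s. r < s \<and> s < n} \<union>
     {XY r s | r s. r < n \<and> s < n \<and> r \<noteq> s} \<union> {Refl r \<epsilon> | r \<epsilon>. r < n \<and> \<epsilon> ^ m = 1} \<union>
     {Sig r s \<xi> | r s \<xi>. r < s \<and> s < n \<and> \<xi> ^ m = 1}"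

fun label_mat :: "nat \<Rightarrow> label \<Rightarrow> complex mat" where
  "label_mat n (XX r s) = trefl n r (- 1) * trefl n s (- 1)"
| "label_mat n (YY r s) = trefl n r (- 1) * trefl n s (- 1)"
| "label_mat n (XY r s) = trefl n r (- 1) * trefl n s (- 1)"
| "label_mat n (Refl r \<epsilon>) = trefl n r \<epsilon>"
| "label_mat n (Sig r s \<xi>) = sgm n r s \<xi>"

text \<open>
  The combination attached to sigma is normalized by its coordinate at \<open>x_r* \<and> y_r*\<close>.
\<close>

fun label_cell :: "nat \<Rightarrow> label \<Rightarrow> nat set" where
  "label_cell n (XX r s) = {r, s}"
| "label_cell n (YY r s) = {n + r, n + s}"
| "label_cell n (XY r s) = {r, n + s}"
| "label_cell n (Refl r \<epsilon>) = {r, n + r}"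
| "label_cell n (Sig r s \<xi>) = {r, n + r}"

definition sigma_sol :: "nat \<Rightarrow> nat \<Rightarrow> nat \<Rightarrow> complex \<Rightarrow> nat set \<Rightarrow> complex" where
  "sigma_sol n r s \<xi> \<beta> = (if \<beta> = {r, n + r} \<or> \<beta> = {s, n + s} then 1
     else if \<beta> = {r, n + s} then \<xi> else if \<beta> = {s, n + r} then - inverse \<xi> else 0)"

fun label_sol :: "nat \<Rightarrow> label \<Rightarrow> nat set \<Rightarrow> complex" where
  "label_sol n (Sig r s \<xi>) = sigma_sol n r s \<xi>"
| "label_sol n l = (\<lambda>\<beta>. if \<beta> = label_cell n l then 1 else 0)"

lemma mat_eqI:
  "A \<in> carrier_mat n n \<Longrightarrow> B \<in> carrier_mat n n \<Longrightarrow>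
    (\<And>k i. k < n \<Longrightarrow> i < n \<Longrightarrow> A $$ (k, i) = B $$ (k, i)) \<Longrightarrow> A = (B :: complex mat)"
  by (intro eq_matI) auto

lemma neg_inverse_eq_oneD: "- inverse z = 1 \<Longrightarrow> - z = (1 :: complex)"
  by (metis inverse_1 inverse_inverse_eq inverse_minus_eq)

subsection \<open>Every solution is visible at a label\<close>

context monomial
begin

text \<open>
  All lines are fixed, so \<open>lam a = q_ba q_ea\<close> for all \<open>a\<close> outside \<open>{b, e}\<close>.  The right hand side is
  \<open>- 1\<close> if exactly one of \<open>b, e\<close> is congruent to \<open>a\<close> modulo \<open>n\<close>, and otherwise 1.  An entry
  of \<open>g\<close> can be read off at \<open>x_i\<close> or at \<open>y_i\<close>, whichever is not in \<open>{b, e}\<close>; only if both are in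
  \<open>{b, e}\<close> it remains free.
\<close>

lemma diagonal_support:
  assumes g: "g \<in> carrier (Gm1n m n)" and C: "cocycle_eqs n g C" "C {b, e} \<noteq> 0"
    and be: "b < e" "e < 2 * n" and id: "\<And>i. i < n \<Longrightarrow> p i = i"
  shows "\<exists>l\<in>labels m n. label_mat n l = g \<and> label_cell n l = {b, e}"
proof -
  note dim = Gm1n_dim[OF g]
  have fixed: "dperm a = a" if "a < 2 * n" for a
  proof (cases "a < n")
    case False
    then have "a - n < n" using that by linarith
    then show ?thesis using False id by (simp add: dperm_def)
  qed (simp add: dperm_def id)
  have D: "qpar n b a * qpar n e a * lam a = 1" if "a < 2 * n" "a \<noteq> b" "a \<noteq> e" for a
    using support_fixed[OF C _ that(2,3,1) _ be(2) fixed[OF that(1)]] be by simp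
  have lam: "lam i = g $$ (i, i)" "lam (n + i) = inverse (g $$ (i, i))" if "i < n" for i
    using that by (simp_all add: lam_def id)
  have off: "g $$ (k, i) = (if k = i then g $$ (i, i) else 0)" if "k < n" "i < n" for k i
    using entry_nz[OF that] id[OF that(2)] by auto
  have prod: "g = trefl n r (- 1) * trefl n s (- 1)"
    if "\<And>i. i < n \<Longrightarrow> g $$ (i, i) = (if i = r then - 1 else 1) * (if i = s then - 1 else 1)" for r s
    by (rule mat_eqI[OF dim trefl_dim(2)], subst off) (auto simp: that trefl_mult_entry)
  consider "e < n" | "b < n" "e \<ge> n" | "b \<ge> n" by linarith
  then show ?thesis
  proof cases
    case 1
    have "g = trefl n b (- 1) * trefl n e (- 1)"
    proof (rule prod)
      fix i assume i: "i < n"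
      show "g $$ (i, i) = (if i = b then - 1 else 1) * (if i = e then - 1 else 1)"
        using D[of i] D[of "n + i"] i be 1 lam[OF i]
        by (cases "i = b"; cases "i = e") (auto simp: qpar_values equation_minus_iff dest: neg_inverse_eq_oneD)
    qed
    then show ?thesis using be 1 by (intro bexI[of _ "XX b e"]) (auto simp: labels_def)
  next
    case 2
    define s where "s = e - n"
    have s: "s < n" "e = n + s" using 2 be by (auto simp: s_def)
    show ?thesis
    proof (cases "s = b")
      case True
      have "g $$ (b, b) \<noteq> 0" using entry_nz[of b b] id[of b] 2 by simp
      then have root: "g $$ (b, b) ^ m = 1" using Gm1n_entry_root[OF g] 2 by blast
      have "g = trefl n b (g $$ (b, b))"
      proof (rule mat_eqI[OF dim trefl_dim(1)], subst off)
        fix k i assume ki: "k < n" "i < n"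
        show "(if k = i then g $$ (i, i) else 0) = trefl n b (g $$ (b, b)) $$ (k, i)"
          using D[of i] ki True s 2 lam[OF ki(2)] by (auto simp: trefl_entry qpar_values)
      qed
      then show ?thesis using True s root 2
        by (intro bexI[of _ "Refl b (g $$ (b, b))"]) (auto simp: labels_def)
    next
      case False
      have "g = trefl n b (- 1) * trefl n s (- 1)"
      proof (rule prod)
        fix i assume i: "i < n"
        show "g $$ (i, i) = (if i = b then - 1 else 1) * (if i = s then - 1 else 1)"
          using D[of i] D[of "n + i"] i be 2 s lam[OF i] False
          by (cases "i = b"; cases "i = s") (auto simp: qpar_values equation_minus_iff dest: neg_inverse_eq_oneD)
      qed
      then show ?thesis using False s 2 by (intro bexI[of _ "XY b s"]) (auto simp: labels_def)
    qed
  next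
    case 3
    define r s where "r = b - n" and "s = e - n"
    have rs: "r < s" "s < n" "b = n + r" "e = n + s" using 3 be by (auto simp: r_def s_def)
    have "g = trefl n r (- 1) * trefl n s (- 1)"
    proof (rule prod)
      fix i assume i: "i < n"
      show "g $$ (i, i) = (if i = r then - 1 else 1) * (if i = s then - 1 else 1)"
        using D[of i] i rs lam[OF i]
        by (cases "i = r"; cases "i = s") (auto simp: qpar_values equation_minus_iff)
    qed
    then show ?thesis using rs by (intro bexI[of _ "YY r s"]) (auto simp: labels_def)
  qed
qed

text \<open>
  These are the coefficients of \<open>x_s\<close> and \<open>x_r\<close> at \<open>{x_r, x_s, y_r}\<close>, of \<open>x_r\<close> at \<open>{x_r, x_s, y_s}\<close> and
  of \<open>y_r\<close> at \<open>{x_r, y_r, y_s}\<close>.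
\<close>

lemma swap_equations:
  assumes C: "cocycle_eqs n g C" and rs: "r < s" "s < n" and p: "p r = s" "p s = r"
  shows "lam r * C {s, n + r} = - C {r, n + r}" "C {s, n + r} = lam s * C {r, n + r}"
    "C {s, n + s} = - lam s * C {r, n + s}" "lam s * C {r, n + s} = - C {r, n + r}"
proof -
  have dp: "dperm r = s" "dperm s = r" "dperm (n + r) = n + s" "dperm (n + s) = n + r"
    using p rs by (auto simp: dperm_def)
  note simps = triple_eq_def koszul_weight_pair act_coeff dp swap_sign_def qpar_values
  have 1: "triple_eq n g C r s (n + r) s" and 2: "triple_eq n g C r s (n + r) r"
    and 3: "triple_eq n g C r s (n + s) r" and 4: "triple_eq n g C r (n + r) (n + s) (n + r)"
    by (rule cocycle_eqsD[OF C]; use rs in simp)+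
  show "lam r * C {s, n + r} = - C {r, n + r}"
    using 1 rs by (simp add: simps add_eq_0_iff)
  show "C {s, n + r} = lam s * C {r, n + r}"
    using 2 rs by (simp add: simps)
  show "C {s, n + s} = - lam s * C {r, n + s}"
    using 3 rs by (simp add: simps add_eq_0_iff)
  have "lam s * lam (n + s) = 1" using lam_nz[of s] rs by (simp add: lam_def)
  moreover have "C {r, n + s} = - (lam (n + s) * C {r, n + r})"
    using 4 rs by (simp add: simps add_eq_0_iff2) (metis add.inverse_inverse)
  ultimately show "lam s * C {r, n + s} = - C {r, n + r}"
    by (simp flip: mult.assoc)
qed

text \<open>
  The moved indices include \<open>r\<close> and \<open>s = p r\<close> on the \<open>x\<close> side and likewise on the \<open>y\<close> side.  By
  \<open>support_moved\<close> a moved index outside \<open>{b, e}\<close> has its image in \<open>{b, e}\<close>.  So \<open>{b, e}\<close> contains one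
  index of each side, which forces \<open>p s = r\<close> and leaves no room for further moved indices.
\<close>

lemma nondiagonal_support:
  assumes g: "g \<in> carrier (Gm1n m n)" and C: "cocycle_eqs n g C" "C {b, e} \<noteq> 0"
    and be: "b < e" "e < 2 * n" and r: "r < n" "p r \<noteq> r"
  shows "\<exists>l\<in>labels m n. label_mat n l = g \<and> C (label_cell n l) \<noteq> 0"
proof -
  have be': "b \<noteq> e" "b < 2 * n" using be by auto
  define s where "s = p r"
  have s: "s < n" "s \<noteq> r" "p s \<noteq> s"
    using r p_less inj_onD[OF inj_p, of r s] by (auto simp: s_def)
  have p_eq: "p i = p j \<longleftrightarrow> i = j" if "i < n" "j < n" for i j
    using inj_onD[OF inj_p, of i j] that by auto
  have moved: "dperm a \<in> {b, e}" "a \<in> {dperm b, dperm e}"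
    if "a < 2 * n" "a \<notin> {b, e}" "dperm a \<noteq> a" for a
    using support_moved[OF C be'(1) _ _ that(1) be'(2) be(2) that(3)] that(2) by auto
  have dp: "dperm i = p i" "dperm (n + i) = n + p i" if "i < n" for i
    using that by (auto simp: dperm_def)
  have "r \<in> {b, e} \<or> s \<in> {b, e}"
    using moved(1)[of r] r dp[OF r(1)] by (auto simp: s_def)
  moreover have "n + r \<in> {b, e} \<or> n + s \<in> {b, e}"
    using moved(1)[of "n + r"] r dp[OF r(1)] by (auto simp: s_def)
  ultimately have bx: "b \<in> {r, s}" and ey: "e \<in> {n + r, n + s}"
    using be r s by auto
  have swap: "p s = r"
  proof (cases "b = s")
    case True
    have "r \<in> {dperm b, dperm e}" using moved(2)[of r] r ey True s be dp[OF r(1)] by auto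
    then show ?thesis using True s dp[OF s(1)] dperm_side[OF be(2)] ey r by auto
  next
    case False
    then have b: "b = r" using bx by simp
    have "dperm s \<in> {b, e}" using moved(1)[of s] s ey b be dp[OF s(1)] by auto
    then show ?thesis using b s dp[OF s(1)] p_less[OF s(1)] ey by auto
  qed
  have fixed: "p t = t \<and> lam t = 1" if t: "t < n" "t \<noteq> r" "t \<noteq> s" for t
  proof -
    have tbe: "t \<noteq> b" "t \<noteq> e" using t bx ey by auto
    have pt: "p t = t"
    proof (rule ccontr)
      assume "p t \<noteq> t"
      then have "p t \<in> {b, e}" using moved(1)[of t] t tbe dp[OF t(1)] by auto
      then have "p t = b" using p_less[OF t(1)] ey by auto
      then show False using bx swap p_eq[OF t(1) s(1)] p_eq[OF t(1) r(1)] t by (auto simp: s_def)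
    qed
    have "qpar n b t * qpar n e t * lam t = 1"
      using support_fixed[OF C be'(1) tbe _ be'(2) be(2)] pt t dp[OF t(1)] by simp
    moreover have "qpar n b t = - 1" "qpar n e t = - 1"
      using bx ey t r s by (auto simp: qpar_values)
    ultimately show ?thesis using pt by simp
  qed
  \<comment> \<open>Labels of sigma are ordered pairs, but the indices r and s are not ordered yet.\<close>
  have main: "\<exists>l\<in>labels m n. label_mat n l = g \<and> C (label_cell n l) \<noteq> 0"
    if uv: "u < v" "v < n" "p u = v" "p v = u" and buv: "b \<in> {u, v}" "e \<in> {n + u, n + v}"
      and others: "\<And>t. t < n \<Longrightarrow> t \<noteq> u \<Longrightarrow> t \<noteq> v \<Longrightarrow> p t = t \<and> lam t = 1" for u v
  proof -
    note eqs = swap_equations[OF C(1) uv]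
    have c1: "C {u, n + u} \<noteq> 0"
    proof
      assume "C {u, n + u} = 0"
      then have "C {v, n + u} = 0" "C {u, n + v} = 0" "C {v, n + v} = 0"
        using eqs lam_nz[of v] uv by auto
      with \<open>C {u, n + u} = 0\<close> show False using C(2) buv by auto
    qed
    have "(lam u * lam v + 1) * C {u, n + u} = 0"
      using eqs(1,2) by (simp add: algebra_simps)
    then have "lam u * lam v = - 1" using c1 by (simp add: add_eq_0_iff2)
    then have lam_v: "lam v = - inverse (lam u)"
      using lam_nz[of u] uv by (simp add: field_simps)
    have entries: "g $$ (k, i) = (if k = p i then lam i else 0)" if "k < n" "i < n" for k i
      using entry_nz[OF that] that by (auto simp: lam_def)
    have "sgm n u v (lam u) = g"
    proof (rule mat_eqI[OF trefl_dim(3) Gm1n_dim[OF g]])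
      fix k i assume ki: "k < n" "i < n"
      show "sgm n u v (lam u) $$ (k, i) = g $$ (k, i)"
        using ki uv others[OF ki(2)] lam_v by (auto simp: sgm_entry entries)
    qed
    moreover have "lam u ^ m = 1"
      using Gm1n_entry_root[OF g, of "p u" u] entry_nz[of "p u" u] uv by (simp add: lam_def)
    ultimately show ?thesis
      using uv c1 by (intro bexI[of _ "Sig u v (lam u)"]) (auto simp: labels_def)
  qed
  have pr: "p r = s" by (simp add: s_def)
  show ?thesis
  proof (cases "r < s")
    case True
    then show ?thesis by (rule main[OF _ s(1) pr swap bx ey fixed])
  next
    case False
    then have "s < r" using s(2) by simp
    moreover have "b \<in> {s, r}" "e \<in> {n + s, n + r}" using bx ey by blast+
    ultimately show ?thesis by (rule main[OF _ r(1) swap pr]) (use fixed in blast)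
  qed
qed

end

lemma support_label:
  assumes g: "g \<in> carrier (Gm1n m n)" and C: "cocycle_eqs n g C" "C \<beta> \<noteq> 0"
    and \<beta>: "\<beta> \<subseteq> {..<2 * n}" "card \<beta> = 2"
  shows "\<exists>l\<in>labels m n. label_mat n l = g \<and> C (label_cell n l) \<noteq> 0"
proof -
  obtain p where "monomial n g p" using monomial_ex[OF g] by blast
  then interpret monomial n g p .
  obtain b e where be: "\<beta> = {b, e}" "b < e"
    using \<beta>(2) by (metis card_2_iff insert_commute nat_neq_iff)
  then have e: "e < 2 * n" using \<beta> by auto
  show ?thesis
  proof (cases "\<forall>i<n. p i = i")
    case True
    then show ?thesis using diagonal_support[OF g C(1) _ be(2) e] C(2) be(1) by auto
  next
    case False
    then show ?thesis using nondiagonal_support[OF g C(1) _ be(2) e] C(2) be(1) by auto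
  qed
qed

subsection \<open>The listed cochains solve the equations\<close>

text \<open>
  The converse of \<open>support_fixed\<close> for a single basis cochain: every weight that meets it is zero.
\<close>

lemma diagonal_eqs:
  assumes "b \<noteq> e" and d: "\<And>a k. a < 2 * n \<Longrightarrow> a \<noteq> b \<Longrightarrow> a \<noteq> e \<Longrightarrow> k < 2 * n \<Longrightarrow>
      qpar n b a * qpar n e a * act_coeff n g k a = (if k = a then 1 else 0)"
  shows "cocycle_eqs n g (\<lambda>\<beta>. if \<beta> = {b, e} then 1 else 0)"
  unfolding cocycle_eqs_def
proof (intro allI impI sum.neutral ballI)
  fix \<gamma> k i assume \<gamma>: "\<gamma> \<subseteq> {..<2 * n}" "card \<gamma> = 3" "k < 2 * n" "i \<in> \<gamma>"
  show "koszul_weight n g (\<gamma> - {i}) i k * (if \<gamma> - {i} = {b, e} then 1 else 0) = 0"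
  proof (cases "\<gamma> - {i} = {b, e}")
    case True
    then have "i \<noteq> b" "i \<noteq> e" by auto
    then have "koszul_weight n g {b, e} i k = 0"
      using assms(1) d[of i k] \<gamma> by (subst koszul_weight_pair) auto
    then show ?thesis by (simp only: True) simp
  qed simp
qed

lemma act_coeff_diagonal:
  assumes "\<And>k i. k < n \<Longrightarrow> i < n \<Longrightarrow> g $$ (k, i) = (if k = i then d i else 0)" "k < 2 * n" "a < 2 * n"
  shows "act_coeff n g k a = (if k = a then if a < n then d a else inverse (d (a - n)) else 0)"
  using assms(2,3) by (auto simp: act_coeff_def assms(1))

lemma index_cases:
  fixes a n :: nat
  assumes "a < 2 * n"
  obtains "a < n" | t where "t < n" "a = n + t"
proof (cases "a < n")
  case False
  then have "a - n < n" "a = n + (a - n)" using assms by linarith+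
  then show thesis by (rule that(2))
qed (rule that(1))

text \<open>
  A set \<open>\<gamma>\<close> containing an index \<open>a\<close> that sigma fixes can contribute only through \<open>\<gamma> - {a}\<close>, and that
  weight vanishes: both parameters are \<open>- 1\<close> and the scalar at \<open>a\<close> is 1.  The other sets \<open>\<gamma>\<close> are
  the four 3-subsets of \<open>{r, s, n + r, n + s}\<close>, and they are checked one by one.
\<close>

lemma sigma_eqs:
  assumes rs: "r < s" "s < n" and xi: "\<xi> \<noteq> 0"
  shows "cocycle_eqs n (sgm n r s \<xi>) (sigma_sol n r s \<xi>)"
proof -
  let ?g = "sgm n r s \<xi>" and ?C = "sigma_sol n r s \<xi>"
  define t where "t i = (if i = r then s else if i = s then r else i)" for i
  interpret monomial n ?g t
  proof
    fix k j assume "k < n" "j < n"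
    then show "?g $$ (k, j) \<noteq> 0 \<longleftrightarrow> k = t j"
      using rs xi by (simp add: t_def sgm_entry)
  qed (use rs in \<open>auto simp: t_def inj_on_def split: if_splits\<close>)
  have dp: "dperm r = s" "dperm s = r" "dperm (n + r) = n + s" "dperm (n + s) = n + r"
    using rs by (auto simp: dperm_def t_def)
  have lam: "lam r = \<xi>" "lam s = - inverse \<xi>" "lam (n + r) = inverse \<xi>" "lam (n + s) = - \<xi>"
    using rs by (auto simp: lam_def t_def sgm_entry)
  have vals: "?C {r, n + r} = 1" "?C {s, n + s} = 1" "?C {r, n + s} = \<xi>" "?C {s, n + r} = - inverse \<xi>"
    "?C {r, s} = 0" "?C {n + r, n + s} = 0"
    using rs by (auto simp: sigma_sol_def doubleton_eq_iff)
  let ?S = "{r, s, n + r, n + s}"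
  have supp: "?C \<beta> = 0" if "\<not> \<beta> \<subseteq> ?S" for \<beta>
    using that by (auto simp: sigma_sol_def)
  show ?thesis
    unfolding cocycle_eqs_def
  proof (intro allI impI)
    fix \<gamma> k assume \<gamma>: "\<gamma> \<subseteq> {..<2 * n}" "card \<gamma> = 3" and k: "k < 2 * n"
    show "(\<Sum>i\<in>\<gamma>. koszul_weight n ?g (\<gamma> - {i}) i k * ?C (\<gamma> - {i})) = 0"
    proof (cases "\<gamma> \<subseteq> ?S")
      case True
      have "card (?S - \<gamma>) = 1" using True \<gamma>(2) rs by (subst card_Diff_subset) (auto intro: finite_subset)
      then obtain j where j: "?S - \<gamma> = {j}" by (rule card_1_singletonE)
      then have \<gamma>j: "\<gamma> = ?S - {j}" and "j \<in> ?S" using True by blast+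
      from this(2) consider "j = r" | "j = s" | "j = n + r" | "j = n + s" by blast
      then consider "\<gamma> = {s, n + r, n + s}" | "\<gamma> = {r, n + r, n + s}" | "\<gamma> = {r, s, n + s}" | "\<gamma> = {r, s, n + r}"
      proof cases
        case 1
        then have "\<gamma> = {s, n + r, n + s}" unfolding \<gamma>j using rs by auto
        then show thesis using that by blast
      next
        case 2
        then have "\<gamma> = {r, n + r, n + s}" unfolding \<gamma>j using rs by auto
        then show thesis using that by blast
      next
        case 3
        then have "\<gamma> = {r, s, n + s}" unfolding \<gamma>j using rs by auto
        then show thesis using that by blast
      next
        case 4
        then have "\<gamma> = {r, s, n + r}" unfolding \<gamma>j using rs by auto
        then show thesis using that by blast
      qed
      then show ?thesis
      proof cases
        case 1
        have "triple_eq n ?g ?C s (n + r) (n + s) k"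
          using rs k xi by (auto simp: triple_eq_def koszul_weight_pair act_coeff dp lam vals swap_sign_def qpar_values)
        then show ?thesis unfolding 1 using rs by (subst triple_sum) auto
      next
        case 2
        have "triple_eq n ?g ?C r (n + r) (n + s) k"
          using rs k xi by (auto simp: triple_eq_def koszul_weight_pair act_coeff dp lam vals swap_sign_def qpar_values)
        then show ?thesis unfolding 2 using rs by (subst triple_sum) auto
      next
        case 3
        have "triple_eq n ?g ?C r s (n + s) k"
          using rs k xi by (auto simp: triple_eq_def koszul_weight_pair act_coeff dp lam vals swap_sign_def qpar_values)
        then show ?thesis unfolding 3 using rs by (subst triple_sum) auto
      next
        case 4
        have "triple_eq n ?g ?C r s (n + r) k"
          using rs k xi by (auto simp: triple_eq_def koszul_weight_pair act_coeff dp lam vals swap_sign_def qpar_values)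
        then show ?thesis unfolding 4 using rs by (subst triple_sum) auto
      qed
    next
      case False
      then obtain a where a: "a \<in> \<gamma>" "a \<notin> ?S" by blast
      show ?thesis
      proof (intro sum.neutral ballI)
        fix i assume i: "i \<in> \<gamma>"
        show "koszul_weight n ?g (\<gamma> - {i}) i k * ?C (\<gamma> - {i}) = 0"
        proof (cases "i = a \<and> ?C (\<gamma> - {i}) \<noteq> 0")
          case False
          then show ?thesis using a supp[of "\<gamma> - {i}"] by auto
        next
          case True
          have "\<gamma> - {i} \<in> {{r, n + r}, {s, n + s}, {r, n + s}, {s, n + r}}"
            by (rule ccontr) (use conjunct2[OF True] in \<open>simp add: sigma_sol_def\<close>)
          then obtain x y where xy: "\<gamma> - {i} = {x, n + y}" "x \<in> {r, s}" "y \<in> {r, s}" by blast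
          have ia: "i < 2 * n" "i \<notin> ?S" using a \<gamma>(1) conjunct1[OF True] by auto
          have ne: "i \<noteq> x" "i \<noteq> n + y" "x \<noteq> n + y" using xy(2,3) ia rs by auto
          have "qpar n x i = - 1 \<and> qpar n (n + y) i = - 1 \<and> dperm i = i \<and> lam i = 1"
            using ia(1)
          proof (cases rule: index_cases)
            case 1
            then show ?thesis using ia xy(2,3) rs
              by (auto simp: qpar_values dperm_def lam_def t_def sgm_entry)
          next
            case (2 t')
            then show ?thesis using ia xy(2,3) rs
              by (auto simp: qpar_values dperm_def lam_def t_def sgm_entry)
          qed
          then have "koszul_weight n ?g {x, n + y} i k = 0"
            using ne k ia(1) by (subst koszul_weight_pair) (auto simp: act_coeff)
          then show ?thesis by (simp add: xy(1))
        qed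
      qed
    qed
  qed
qed

lemma label_eqs:
  assumes m: "m > 0" and l: "l \<in> labels m n"
  shows "cocycle_eqs n (label_mat n l) (label_sol n l)"
proof -
  have prod: "act_coeff n (trefl n r (- 1) * trefl n s (- 1)) k a =
      (if k = a then if a < n then (if a = r then - 1 else 1) * (if a = s then - 1 else 1)
        else inverse ((if a - n = r then - 1 else 1) * (if a - n = s then - 1 else 1)) else 0)"
    if "k < 2 * n" "a < 2 * n" for r s k a
    by (rule act_coeff_diagonal[OF trefl_mult_entry that])
  show ?thesis
  proof (cases l)
    case (XX r s)
    have "cocycle_eqs n (label_mat n l) (\<lambda>\<beta>. if \<beta> = {r, s} then 1 else 0)"
    proof (rule diagonal_eqs)
      fix a k assume a: "a < 2 * n" "a \<noteq> r" "a \<noteq> s" "k < 2 * n"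
      from a(1) show "qpar n r a * qpar n s a * act_coeff n (label_mat n l) k a = (if k = a then 1 else 0)"
        by (cases rule: index_cases) (use a l XX in \<open>auto simp: labels_def prod qpar_values\<close>)
    qed (use l XX in \<open>auto simp: labels_def\<close>)
    then show ?thesis using XX by simp
  next
    case (YY r s)
    have "cocycle_eqs n (label_mat n l) (\<lambda>\<beta>. if \<beta> = {n + r, n + s} then 1 else 0)"
    proof (rule diagonal_eqs)
      fix a k assume a: "a < 2 * n" "a \<noteq> n + r" "a \<noteq> n + s" "k < 2 * n"
      from a(1) show "qpar n (n + r) a * qpar n (n + s) a * act_coeff n (label_mat n l) k a = (if k = a then 1 else 0)"
        by (cases rule: index_cases) (use a l YY in \<open>auto simp: labels_def prod qpar_values\<close>)
    qed (use l YY in \<open>auto simp: labels_def\<close>)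
    then show ?thesis using YY by simp
  next
    case (XY r s)
    have "cocycle_eqs n (label_mat n l) (\<lambda>\<beta>. if \<beta> = {r, n + s} then 1 else 0)"
    proof (rule diagonal_eqs)
      fix a k assume a: "a < 2 * n" "a \<noteq> r" "a \<noteq> n + s" "k < 2 * n"
      from a(1) show "qpar n r a * qpar n (n + s) a * act_coeff n (label_mat n l) k a = (if k = a then 1 else 0)"
        by (cases rule: index_cases) (use a l XY in \<open>auto simp: labels_def prod qpar_values\<close>)
    qed (use l XY in \<open>auto simp: labels_def\<close>)
    then show ?thesis using XY by simp
  next
    case (Refl r c)
    have act: "act_coeff n (trefl n r c) k a =
        (if k = a then if a < n then (if a = r then c else 1) else inverse (if a - n = r then c else 1) else 0)"
      if "k < 2 * n" "a < 2 * n" for k a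
      by (rule act_coeff_diagonal[OF _ that]) (auto simp: trefl_entry)
    have "cocycle_eqs n (label_mat n l) (\<lambda>\<beta>. if \<beta> = {r, n + r} then 1 else 0)"
    proof (rule diagonal_eqs)
      fix a k assume a: "a < 2 * n" "a \<noteq> r" "a \<noteq> n + r" "k < 2 * n"
      from a(1) show "qpar n r a * qpar n (n + r) a * act_coeff n (label_mat n l) k a = (if k = a then 1 else 0)"
        by (cases rule: index_cases) (use a l Refl in \<open>auto simp: labels_def act qpar_values\<close>)
    qed (use l Refl in \<open>auto simp: labels_def\<close>)
    then show ?thesis using Refl by simp
  next
    case (Sig r s \<xi>)
    then show ?thesis using l sigma_eqs[of r s n \<xi>] root_nz[OF m] by (auto simp: labels_def)
  qed
qed

section \<open>The basis\<close>

fun label_cochain :: "nat \<Rightarrow> nat \<Rightarrow> label \<Rightarrow> cochain" where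
  "label_cochain m n (XX r s) = gtens m n (trefl n r (- 1) * trefl n s (- 1)) r s"
| "label_cochain m n (YY r s) = gtens m n (trefl n r (- 1) * trefl n s (- 1)) (n + r) (n + s)"
| "label_cochain m n (XY r s) = gtens m n (trefl n r (- 1) * trefl n s (- 1)) r (n + s)"
| "label_cochain m n (Refl r \<epsilon>) = gtens m n (trefl n r \<epsilon>) r (n + r)"
| "label_cochain m n (Sig r s \<xi>) = sigma_cocycle m n r s \<xi>"

lemma label_cochain_image:
  "label_cochain m n ` labels m n =
      {gtens m n (trefl n r (- 1) * trefl n s (- 1)) r s | r s. r < s \<and> s < n} \<union>
       {gtens m n (trefl n r (- 1) * trefl n s (- 1)) (n + r) (n + s) | r s. r < s \<and> s < n} \<union>
       {gtens m n (trefl n r (- 1) * trefl n s (- 1)) r (n + s) | r s. r < n \<and> s < n \<and> r \<noteq> s} \<union>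
       {gtens m n (trefl n r \<epsilon>) r (n + r) | r \<epsilon>. r < n \<and> \<epsilon> ^ m = 1} \<union>
       {sigma_cocycle m n r s \<xi> | r s \<xi>. r < s \<and> s < n \<and> \<xi> ^ m = 1}"
proof -
  have img: "f ` {h x y | x y. P x y} = {f (h x y) | x y. P x y}" for f :: "label \<Rightarrow> cochain" and h :: "nat \<Rightarrow> 'b \<Rightarrow> label" and P
    by blast
  have img3: "f ` {h x y z | x y z. P x y z} = {f (h x y z) | x y z. P x y z}"
    for f :: "label \<Rightarrow> cochain" and h :: "nat \<Rightarrow> nat \<Rightarrow> complex \<Rightarrow> label" and P
    by blast
  show ?thesis
    unfolding labels_def image_Un img img3 label_cochain.simps ..
qed

lemma label_mat_mem:
  "even m \<Longrightarrow> m > 0 \<Longrightarrow> l \<in> labels m n \<Longrightarrow> label_mat n l \<in> carrier (Gm1n m n)"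
  by (auto simp: labels_def intro!: trefl_mem trefl_mult_mem sgm_mem)

lemma label_cell_mem: "l \<in> labels m n \<Longrightarrow> label_cell n l \<subseteq> {..<2 * n} \<and> card (label_cell n l) = 2"
  by (auto simp: labels_def)

lemma sgm_labels_unique:
  assumes eq: "sgm n r s \<xi> = sgm n r' s' \<xi>'" and "r < s" "s < n" "r' < s'" "s' < n" "\<xi> \<noteq> 0" "\<xi>' \<noteq> 0"
  shows "r = r' \<and> s = s' \<and> \<xi> = \<xi>'"
proof -
  have "sgm n r' s' \<xi>' $$ (s, r) = \<xi>" using assms by (simp add: sgm_entry flip: eq)
  then show ?thesis using assms(2-) by (auto simp: sgm_entry split: if_splits)
qed

lemma label_mat_diagonal:
  assumes "\<And>r s \<xi>. l \<noteq> Sig r s \<xi>" "k < n" "i < n" "k \<noteq> i"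
  shows "label_mat n l $$ (k, i) = 0"
  using assms by (cases l) (auto simp: trefl_entry trefl_mult_entry)

text \<open>
  For labels with different group elements the corresponding coordinates vanish trivially, so equal
  group elements are assumed.  A sigma is not diagonal and therefore never meets the other families,
  and it determines its label.  The remaining cochains are basis cochains, told apart by their pair of
  indices, or by the matrix entry if both are reflections at the same index.
\<close>

lemma label_dual:
  assumes m: "m > 0" and l: "l \<in> labels m n" and l': "l' \<in> labels m n" and eq: "label_mat n l = label_mat n l'"
  shows "label_sol n l (label_cell n l') = (if l' = l then 1 else 0)"
proof (cases "\<exists>r s \<xi>. l = Sig r s \<xi> \<or> l' = Sig r s \<xi>")
  case True
  have sig: "\<exists>r s \<xi>. h = Sig r s \<xi>" if h: "h \<in> labels m n" "h' = Sig r s \<xi>" "h' \<in> labels m n"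
    "label_mat n h = label_mat n h'" for h h' r s \<xi>
  proof (rule ccontr)
    assume *: "\<nexists>r s \<xi>. h = Sig r s \<xi>"
    have rs: "r < s" "s < n" "\<xi> \<noteq> 0" using h root_nz[OF m] by (auto simp: labels_def)
    have "label_mat n h $$ (s, r) = 0" by (rule label_mat_diagonal) (use * rs in auto)
    moreover have "label_mat n h' $$ (s, r) = \<xi>" using h rs by (simp add: sgm_entry)
    ultimately show False using h(4) rs by simp
  qed
  obtain r s \<xi> where lS: "l = Sig r s \<xi>" using True sig[OF l _ l' eq] by blast
  then obtain r' s' \<xi>' where l'S: "l' = Sig r' s' \<xi>'" using sig[OF l' _ l eq[symmetric]] by blast
  have "r = r' \<and> s = s' \<and> \<xi> = \<xi>'"
    using eq l l' root_nz[OF m] unfolding lS l'S labels_def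
    by (intro sgm_labels_unique) auto
  then show ?thesis by (simp add: lS l'S sigma_sol_def)
next
  case False
  have refl: "c = c'" if "trefl n r c = trefl n r c'" "r < n" for r c c'
  proof -
    have "trefl n r c $$ (r, r) = trefl n r c' $$ (r, r)" using that(1) by simp
    then show ?thesis using that(2) by (simp add: trefl_entry)
  qed
  have "label_cell n l' = label_cell n l \<longleftrightarrow> l' = l"
  proof
    assume "label_cell n l' = label_cell n l"
    then have "l' = l \<or> (\<exists>r c c'. l = Refl r c \<and> l' = Refl r c' \<and> r < n)"
      using l l' False unfolding labels_def
      by (cases l; cases l') (auto simp: doubleton_eq_iff)
    then show "l' = l"
    proof (elim disjE exE conjE)
      fix r c c' assume "l = Refl r c" "l' = Refl r c'" "r < n"
      then show "l' = l" using refl[of r c c'] eq by simp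
    qed
  qed simp
  then show ?thesis using False by (cases l) auto
qed

lemma coord_gtens:
  assumes "i < j" "j < 2 * n" "h \<in> carrier (Gm1n m n)" "g \<in> carrier (Gm1n m n)"
  shows "coord m n 2 [] g \<beta> (gtens m n h i j) = (if g = h \<and> \<beta> = {i, j} then 1 else 0)"
    and "gtens m n h i j \<in> const_cochains m n 2" and "gtens m n h i j \<in> carrier (cochains m n 2)"
proof -
  interpret C: dual_family "cochains m n 2" "cells m n 2" "const_elem m n 2" "const_coord m n 2"
    by (rule const_dual)
  have ij: "{i, j} \<subseteq> {..<2 * n}" "card {i, j} = 2" using assms by auto
  show "coord m n 2 [] g \<beta> (gtens m n h i j) = (if g = h \<and> \<beta> = {i, j} then 1 else 0)"
    using coord(2)[OF _ assms(4) one_qsym_closed ij, of "[]"]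
    by (auto simp: gtens_const_elem[OF assms(1)] sym_coord(2))
  have "(h, {i, j}) \<in> cells m n 2" using ij assms by simp
  then show "gtens m n h i j \<in> const_cochains m n 2" "gtens m n h i j \<in> carrier (cochains m n 2)"
    unfolding gtens_const_elem[OF assms(1)] const_cochains_span
    using C.V.in_own_span[OF C.E_subset] C.E by blast+
qed

lemma const_cochains_submodule: "LinearCombinations.submodule CC (const_cochains m n 2) (cochains m n 2)"
proof -
  interpret C: dual_family "cochains m n 2" "cells m n 2" "const_elem m n 2" "const_coord m n 2"
    by (rule const_dual)
  show ?thesis unfolding const_cochains_span by (rule C.V.span_is_submodule[OF C.E_subset])
qed

lemma label_cochain_coord:
  assumes m: "even m" "m > 0" and l: "l \<in> labels m n" and g: "g \<in> carrier (Gm1n m n)"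
  shows "coord m n 2 [] g \<beta> (label_cochain m n l) = (if g = label_mat n l then label_sol n l \<beta> else 0)"
    and "label_cochain m n l \<in> const_cochains m n 2"
proof -
  let ?Z = "cochains m n 2"
  have co: "coord m n 2 [] g \<beta> \<in> lin ?Z Cmod" by (rule coord(1)) (use g in auto)
  have minus: "x \<ominus>\<^bsub>Cmod\<^esub> y = x - y" for x y using cmoduleD(13)[OF cmodule_Cmod] by simp
  have K: "x \<oplus>\<^bsub>?Z\<^esub> y \<in> const_cochains m n 2" "c \<odot>\<^bsub>?Z\<^esub> x \<in> const_cochains m n 2"
    if "x \<in> const_cochains m n 2" "y \<in> const_cochains m n 2" for x y c
    using const_cochains_submodule that by (auto simp: LinearCombinations.submodule_def)
  note mem = label_mat_mem[OF m l]
  have "coord m n 2 [] g \<beta> (label_cochain m n l) = (if g = label_mat n l then label_sol n l \<beta> else 0) \<and>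
    label_cochain m n l \<in> const_cochains m n 2"
  proof (cases l)
    case (Sig r s \<xi>)
    let ?g = "sgm n r s \<xi>"
    have rs: "r < s" "s < n" using l Sig by (auto simp: labels_def)
    have h: "?g \<in> carrier (Gm1n m n)" using mem Sig by simp
    have lt: "r < n + r" "n + r < 2 * n" "s < n + s" "n + s < 2 * n" "r < n + s" "s < n + r"
      using rs by auto
    note t1 = coord_gtens[OF lt(1,2) h g] and t2 = coord_gtens[OF lt(3,4) h g]
      and t3 = coord_gtens[OF lt(5,4) h g] and t4 = coord_gtens[OF lt(6,2) h g]
    note cl = cmoduleD(4,6)[OF cmodule_cochains]
    have "coord m n 2 [] g \<beta> (sigma_cocycle m n r s \<xi>) =
        coord m n 2 [] g \<beta> (gtens m n ?g r (n + r)) + coord m n 2 [] g \<beta> (gtens m n ?g s (n + s))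
        + \<xi> * coord m n 2 [] g \<beta> (gtens m n ?g r (n + s)) - inverse \<xi> * coord m n 2 [] g \<beta> (gtens m n ?g s (n + r))"
      unfolding sigma_cocycle_def
      using t1(3) t2(3) t3(3) t4(3)
      by (simp add: lin_minus[OF cmodule_cochains cmodule_Cmod co] linD[OF co] cl minus)
    also have "\<dots> = (if g = ?g then sigma_sol n r s \<xi> \<beta> else 0)"
      unfolding t1(1) t2(1) t3(1) t4(1) using rs by (auto simp: sigma_sol_def doubleton_eq_iff)
    finally have "coord m n 2 [] g \<beta> (sigma_cocycle m n r s \<xi>) = (if g = ?g then sigma_sol n r s \<xi> \<beta> else 0)" .
    moreover have "sigma_cocycle m n r s \<xi> \<in> const_cochains m n 2"
      unfolding sigma_cocycle_def using t1(2,3) t2(2,3) t3(2,3) t4(2,3)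
      by (simp add: cmoduleD(13)[OF cmodule_cochains] cl K)
    ultimately show ?thesis using Sig by simp
  qed (use coord_gtens[OF _ _ mem g] coord_gtens(2)[OF _ _ mem g] l in \<open>auto simp: labels_def\<close>)
  then show "coord m n 2 [] g \<beta> (label_cochain m n l) = (if g = label_mat n l then label_sol n l \<beta> else 0)"
    and "label_cochain m n l \<in> const_cochains m n 2" by auto
qed

lemma cocycle_submodule:
  "LinearCombinations.submodule CC (carrier (const_2_cocycles m n)) (cochains m n 2)"
proof -
  have d: "differential m n 3 \<in> lin (cochains m n 2) (cochains m n 3)"
    using differential(1)[of 3] by simp
  note K = const_cochains_submodule[of m n]
  have sub: "const_cochains m n 2 \<subseteq> carrier (cochains m n 2)"
    using K by (simp add: LinearCombinations.submodule_def)
  interpret Z: Module.module CC "cochains m n 3" by (rule cmodule_cochains)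
  show ?thesis
    by (rule LinearCombinations.submodule.intro[OF cmodule_cochains])
      (use K sub lin_zero[OF cmodule_cochains cmodule_cochains d] in
        \<open>auto simp: const_2_cocycles_def LinearCombinations.submodule_def linD[OF d] subset_iff
          cmoduleD(12)[OF cmodule_cochains]\<close>)
qed

theorem theorem7p1:
  fixes m n :: nat
  assumes "even m" and "m > 0" and "n \<ge> 3"
  shows "vectorspace CC (const_2_cocycles m n) \<and>
    vectorspace.basis CC (const_2_cocycles m n)
      ({gtens m n (trefl n r (- 1) * trefl n s (- 1)) r s | r s. r < s \<and> s < n} \<union>
       {gtens m n (trefl n r (- 1) * trefl n s (- 1)) (n + r) (n + s) | r s. r < s \<and> s < n} \<union>
       {gtens m n (trefl n r (- 1) * trefl n s (- 1)) r (n + s) | r s. r < n \<and> s < n \<and> r \<noteq> s} \<union>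
       {gtens m n (trefl n r \<epsilon>) r (n + r) | r \<epsilon>. r < n \<and> \<epsilon> ^ m = 1} \<union>
       {sigma_cocycle m n r s \<xi> | r s \<xi>. r < s \<and> s < n \<and> \<xi> ^ m = 1})"
proof -
  let ?Z = "cochains m n 2" and ?L = "labels m n" and ?K = "carrier (const_2_cocycles m n)"
  let ?E = "label_cochain m n" and ?\<phi> = "\<lambda>l. coord m n 2 [] (label_mat n l) (label_cell n l)"
  note m = assms(1,2)
  note K = cocycle_submodule[of m n]
  have K_eq: "const_2_cocycles m n = ?Z\<lparr>carrier := ?K\<rparr>" by (simp add: const_2_cocycles_def)
  have mem: "c \<in> ?K \<longleftrightarrow> c \<in> const_cochains m n 2 \<and>
      (\<forall>g\<in>carrier (Gm1n m n). cocycle_eqs n g (\<lambda>\<beta>. coord m n 2 [] g \<beta> c))" for c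
    using differential_eq_zero_iff[of c m n] by (auto simp: const_2_cocycles_def)
  have Kc: "?K \<subseteq> carrier ?Z" "\<And>x y. x \<in> ?K \<Longrightarrow> y \<in> ?K \<Longrightarrow> x \<oplus>\<^bsub>?Z\<^esub> y \<in> ?K"
    "\<And>c x. x \<in> ?K \<Longrightarrow> c \<odot>\<^bsub>?Z\<^esub> x \<in> ?K"
    using K by (auto simp: LinearCombinations.submodule_def)
  have E_K: "?E l \<in> ?K" if l: "l \<in> ?L" for l
    unfolding mem
  proof (intro conjI ballI)
    show "?E l \<in> const_cochains m n 2"
      using label_cochain_coord(2)[OF m l label_mat_mem[OF m l]] .
    fix g assume g: "g \<in> carrier (Gm1n m n)"
    show "cocycle_eqs n g (\<lambda>\<beta>. coord m n 2 [] g \<beta> (?E l))"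
      unfolding label_cochain_coord(1)[OF m l g] using label_eqs[OF m(2) l]
      by (cases "g = label_mat n l") (simp_all add: cocycle_eqs_def)
  qed
  interpret B: dual_family ?Z ?L ?E ?\<phi>
  proof (rule dual_family.intro[OF cmodule_cochains])
    show "?E l \<in> carrier ?Z" if "l \<in> ?L" for l using E_K[OF that] Kc(1) by blast
    show "?\<phi> l \<in> lin ?Z Cmod" if "l \<in> ?L" for l
      by (rule coord(1)) (use label_mat_mem[OF m that] in auto)
    show "?\<phi> l (?E l') = (if l = l' then 1 else 0)" if "l \<in> ?L" "l' \<in> ?L" for l l'
      using label_dual[OF m(2) that(2,1)] label_cochain_coord(1)[OF m that(2) label_mat_mem[OF m that(1)]]
      by auto
  qed
  interpret C: dual_family ?Z "cells m n 2" "const_elem m n 2" "const_coord m n 2"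
    by (rule const_dual)
  have "cmodule (const_2_cocycles m n)"
    using B.V.submodule_is_module[OF K] by (simp flip: K_eq)
  then have vs: "vectorspace CC (const_2_cocycles m n)" by (rule cmoduleD(2))
  have EK: "?E ` ?L \<subseteq> ?K" using E_K by auto
  have span: "c \<in> B.V.span (?E ` ?L)" if c: "c \<in> ?K" for c
  proof -
    define F where "F = {l \<in> ?L. ?\<phi> l c \<noteq> 0}"
    have "inj_on (\<lambda>l. (label_mat n l, label_cell n l)) ?L"
    proof (rule inj_onI)
      fix l l' assume l: "l \<in> ?L" "l' \<in> ?L" "(label_mat n l, label_cell n l) = (label_mat n l', label_cell n l')"
      then have eq: "label_mat n l = label_mat n l'" "label_cell n l = label_cell n l'" by blast+
      have "label_sol n l (label_cell n l) = (if l' = l then 1 else 0)"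
        unfolding eq(2) by (rule label_dual[OF m(2) l(1,2) eq(1)])
      moreover have "label_sol n l (label_cell n l) = 1"
        using label_dual[OF m(2) l(1,1)] by simp
      ultimately show "l = l'" by (simp split: if_splits)
    qed
    moreover have "(\<lambda>l. (label_mat n l, label_cell n l)) ` F \<subseteq> {x \<in> cells m n 2. const_coord m n 2 x c \<noteq> 0}"
    proof (rule image_subsetI)
      fix l assume "l \<in> F"
      then have l: "l \<in> ?L" "?\<phi> l c \<noteq> 0" by (simp_all add: F_def)
      show "(label_mat n l, label_cell n l) \<in> {x \<in> cells m n 2. const_coord m n 2 x c \<noteq> 0}"
        using label_mat_mem[OF m l(1)] label_cell_mem[OF l(1)] l(2) by simp
    qed
    moreover have "finite {x \<in> cells m n 2. const_coord m n 2 x c \<noteq> 0}"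
      using C.expansion(1) c mem const_cochains_span by blast
    moreover have sub: "F \<subseteq> ?L" by (auto simp: F_def)
    ultimately have "finite F" by (meson finite_imageD finite_subset inj_on_subset)
    note F = this sub
    \<comment> \<open>The combination of listed cochains with the same distinguished coordinates as c.\<close>
    define c' where "c' = (\<Oplus>\<^bsub>?Z\<^esub>l\<in>F. ?\<phi> l c \<odot>\<^bsub>?Z\<^esub> ?E l)"
    have X: "LinearCombinations.submodule CC (B.V.span (?E ` ?L)) ?Z"
      by (rule B.V.span_is_submodule[OF B.E_subset])
    have in_span: "?E l \<in> B.V.span (?E ` ?L)" if "l \<in> ?L" for l
      using B.V.in_own_span[OF B.E_subset] that by blast
    have c'span: "c' \<in> B.V.span (?E ` ?L)"
      unfolding c'_def using F
    proof (induction F rule: finite_induct)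
      case empty
      then show ?case using X by (simp add: LinearCombinations.submodule_def)
    next
      case (insert l F)
      then show ?case
        using X B.E in_span by (subst B.V.finsum_insert)
          (auto simp: LinearCombinations.submodule_def Pi_iff subset_iff cmoduleD(6)[OF cmodule_cochains])
    qed
    have "B.V.span (?E ` ?L) \<subseteq> ?K" by (rule B.V.span_is_subset[OF EK K])
    with c'span have c'K: "c' \<in> ?K" by blast
    define d where "d = c \<ominus>\<^bsub>?Z\<^esub> c'"
    have cc: "c \<in> carrier ?Z" "c' \<in> carrier ?Z" using c c'K Kc(1) by auto
    have dK: "d \<in> ?K"
      unfolding d_def cmoduleD(13)[OF cmodule_cochains cc] using c c'K Kc(2,3) by blast
    have minus: "x \<ominus>\<^bsub>Cmod\<^esub> y = x - y" for x y using cmoduleD(13)[OF cmodule_Cmod] by simp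
    \<comment> \<open>All distinguished coordinates of the difference are zero, so by support_label it has no support.\<close>
    have d0: "?\<phi> l d = 0" if l: "l \<in> ?L" for l
    proof -
      have "?\<phi> l c' = (if l \<in> F then ?\<phi> l c else 0)"
        unfolding c'_def using B.functional_sum[OF F l, of "\<lambda>l. ?\<phi> l c"] by simp
      also have "\<dots> = ?\<phi> l c" using l by (simp add: F_def)
      finally show ?thesis
        using lin_minus[OF cmodule_cochains cmodule_Cmod B.\<phi>[OF l] cc] by (simp add: d_def minus)
    qed
    have "const_coord m n 2 x d = 0" if x: "x \<in> cells m n 2" for x
    proof -
      obtain g \<beta> where x': "x = (g, \<beta>)" "g \<in> carrier (Gm1n m n)" "\<beta> \<subseteq> {..<2 * n}" "card \<beta> = 2"
        using x by auto
      have "cocycle_eqs n g (\<lambda>\<beta>. coord m n 2 [] g \<beta> d)" using dK x'(2) mem by blast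
      from support_label[OF x'(2) this _ x'(3,4)] d0 show ?thesis using x'(1) by auto
    qed
    then have "d = \<zero>\<^bsub>?Z\<^esub>" using dK mem by (intro C.eq_zero) (auto simp: const_cochains_span)
    then have "c = c'" using cc unfolding d_def by simp
    then show ?thesis using c'span by simp
  qed
  have "B.V.span (?E ` ?L) = ?K"
    using span B.V.span_is_subset[OF EK K] by blast
  moreover note B.V.span_li_not_depend[OF EK K]
  ultimately have "vectorspace.basis CC (const_2_cocycles m n) (?E ` ?L)"
    unfolding vectorspace.basis_def[OF vs] using B.lin_indpt EK by (simp flip: K_eq)
  then show ?thesis using vs unfolding label_cochain_image by blast
qed

end
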